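(* There is a (deterministic) algorithm for Structural Partial Grundy Coloring running in time $2^{\mathcal{O}(k^2 d)}\cdot 2^{\ell k+k^2\log k}\cdot n^{\mathcal{O}(1)}$, where $n=|V(G)|$.
   Context: Structural Partial Grundy Coloring: the input consists of positive integers $k,d,\ell$, a graph $G$, and $\ell$ subgraphs $A_1,\dots,A_\ell$ of $G$, each a biclique (bipartite with nonempty sides $L_t,R_t$ and all edges between them), such that $G-F$ is $d$-degenerate, where $F$ is the union of the edge sets of the $A_t$ and $G-F=(V(G),E(G)\setminus F)$. The question is whether $G$ admits a partial Grundy coloring using at least $k$ colors. A graph is $d$-degenerate if every subgraph has a vertex of degree at most $d$. A partial Grundy coloring of $G$ using $k'$ colors is a proper coloring $c:V(G)\to[k']$ such that for every $i\in[k']$ there is a vertex $v$ with $c(v)=i$ which, for every $j\in[i-1]$, has a neighbor $u$ with $c(u)=j$; "using at least $k$ colors" means for some $k'\ge k$. *)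

theory Defs
  imports Complex_Main "HOL-Library.Discrete_Functions"
begin

section \<open>Graphs\<close>

record 'a ugraph =
  verts :: "'a set"
  edges :: "'a set set"

definition simple_graph :: "'a ugraph \<Rightarrow> bool" where
  "simple_graph G \<longleftrightarrow> finite (verts G) \<and> (\<forall>e \<in> edges G. e \<subseteq> verts G \<and> card e = 2)"

definition subgraph :: "'a ugraph \<Rightarrow> 'a ugraph \<Rightarrow> bool" where
  "subgraph H G \<longleftrightarrow> simple_graph H \<and> verts H \<subseteq> verts G \<and> edges H \<subseteq> edges G"

definition degree :: "'a ugraph \<Rightarrow> 'a \<Rightarrow> nat" where
  "degree G v = card {e \<in> edges G. v \<in> e}"

text \<open>The quantification is over subgraphs with at least one vertex; the empty subgraph has no
  vertex at all.\<close>
definition degenerate :: "nat \<Rightarrow> 'a ugraph \<Rightarrow> bool" where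
  "degenerate d G \<longleftrightarrow>
     (\<forall>H. subgraph H G \<and> verts H \<noteq> {} \<longrightarrow> (\<exists>v \<in> verts H. degree H v \<le> d))"

definition biclique :: "'a ugraph \<Rightarrow> bool" where
  "biclique A \<longleftrightarrow>
     (\<exists>L R. L \<noteq> {} \<and> R \<noteq> {} \<and> L \<inter> R = {} \<and> verts A = L \<union> R \<and>
            edges A = {{u, v} | u v. u \<in> L \<and> v \<in> R})"

definition delete_edges :: "'a ugraph \<Rightarrow> 'a set set \<Rightarrow> 'a ugraph" where
  "delete_edges G F = \<lparr>verts = verts G, edges = edges G - F\<rparr>"

definition partial_grundy_coloring :: "'a ugraph \<Rightarrow> nat \<Rightarrow> ('a \<Rightarrow> nat) \<Rightarrow> bool" where
  "partial_grundy_coloring G k c \<longleftrightarrow>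
     (\<forall>v \<in> verts G. c v \<in> {1..k}) \<and>
     (\<forall>u \<in> verts G. \<forall>v \<in> verts G. {u, v} \<in> edges G \<longrightarrow> c u \<noteq> c v) \<and>
     (\<forall>i \<in> {1..k}. \<exists>v \<in> verts G. c v = i \<and>
        (\<forall>j \<in> {1..<i}. \<exists>u \<in> verts G. {u, v} \<in> edges G \<and> c u = j))"


section \<open>Random access machines with logarithmic cost\<close>

text \<open>
  The model of computation is a random access machine with arithmetic on natural numbers and the
  \<^emph>\<open>logarithmic\<close> cost criterion (as in Aho, Hopcroft and Ullman), programmed by structured
  commands.  The memory consists of arrays of unbounded length; a program names finitely many of
  them, and a scalar variable is an array used at index 0 only.  Subtraction is truncated.
\<close>

type_synonym state = "nat \<Rightarrow> nat \<Rightarrow> nat"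

datatype exp =
    Const nat
  | Read nat exp
  | Add exp exp
  | Sub exp exp
  | Mul exp exp
  | Div exp exp

datatype com =
    Skip
  | Write nat exp exp
  | Seq com com
  | If exp com com
  | While exp com

text \<open>Length of the binary representation of a number, where 0 has length 1.\<close>
definition bitlen :: "nat \<Rightarrow> nat" where
  "bitlen n = Suc (floor_log n)"

primrec eval :: "exp \<Rightarrow> state \<Rightarrow> nat" where
  "eval (Const n) s = n"
| "eval (Read a e) s = s a (eval e s)"
| "eval (Add e f) s = eval e s + eval f s"
| "eval (Sub e f) s = eval e s - eval f s"
| "eval (Mul e f) s = eval e s * eval f s"
| "eval (Div e f) s = eval e s div eval f s"

primrec eval_cost :: "exp \<Rightarrow> state \<Rightarrow> nat" where
  "eval_cost (Const n) s = bitlen n"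
| "eval_cost (Read a e) s =
     eval_cost e s + bitlen (eval e s) + bitlen (s a (eval e s))"
| "eval_cost (Add e f) s =
     eval_cost e s + eval_cost f s + bitlen (eval e s) + bitlen (eval f s)"
| "eval_cost (Sub e f) s =
     eval_cost e s + eval_cost f s + bitlen (eval e s) + bitlen (eval f s)"
| "eval_cost (Mul e f) s =
     eval_cost e s + eval_cost f s + bitlen (eval e s) + bitlen (eval f s)"
| "eval_cost (Div e f) s =
     eval_cost e s + eval_cost f s + bitlen (eval e s) + bitlen (eval f s)"

text \<open>\<open>exec P s t s'\<close>: started in memory \<open>s\<close>, the program \<open>P\<close> halts after time \<open>t\<close> with
  memory \<open>s'\<close>.  Conditions count as true if their value is nonzero.\<close>
inductive exec :: "com \<Rightarrow> state \<Rightarrow> nat \<Rightarrow> state \<Rightarrow> bool" where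
  Skip: "exec Skip s 1 s"
| Write: "exec (Write a e f) s
     (eval_cost e s + eval_cost f s + bitlen (eval e s) + bitlen (eval f s))
     (s(a := (s a)(eval e s := eval f s)))"
| Seq: "\<lbrakk>exec P s t s'; exec Q s' t' s''\<rbrakk> \<Longrightarrow> exec (Seq P Q) s (t + t') s''"
| IfTrue: "\<lbrakk>eval e s \<noteq> 0; exec P s t s'\<rbrakk>
     \<Longrightarrow> exec (If e P Q) s (eval_cost e s + bitlen (eval e s) + t) s'"
| IfFalse: "\<lbrakk>eval e s = 0; exec Q s t s'\<rbrakk>
     \<Longrightarrow> exec (If e P Q) s (eval_cost e s + bitlen (eval e s) + t) s'"
| WhileTrue: "\<lbrakk>eval e s \<noteq> 0; exec P s t s'; exec (While e P) s' t' s''\<rbrakk>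
     \<Longrightarrow> exec (While e P) s (eval_cost e s + bitlen (eval e s) + t + t') s''"
| WhileFalse: "eval e s = 0
     \<Longrightarrow> exec (While e P) s (eval_cost e s + bitlen (eval e s)) s"

inductive_cases SkipE: "exec Skip s t s'"
  and WriteE: "exec (Write a e f) s t s'"
  and SeqE: "exec (Seq P Q) s t s'"
  and IfE: "exec (If e P Q) s t s'"
  and WhileE: "exec (While e P) s t s'"

lemma exec_deterministic:
  "exec P s t s' \<Longrightarrow> exec P s u s'' \<Longrightarrow> u = t \<and> s'' = s'"
proof (induction arbitrary: u s'' rule: exec.induct)
  case (Skip s)
  then show ?case by (auto elim: SkipE)
next
  case (Write a e f s)
  then show ?case by (auto elim: WriteE)
next
  case (Seq P s t s' Q t' s'')
  then show ?case by (metis SeqE)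
next
  case (IfTrue e s P t s' Q)
  from IfTrue.prems IfTrue.hyps show ?case by (cases rule: exec.cases) (auto dest: IfTrue.IH)
next
  case (IfFalse e s Q t s' P)
  from IfFalse.prems IfFalse.hyps show ?case by (cases rule: exec.cases) (auto dest: IfFalse.IH)
next
  case (WhileTrue e s P t s' t' s'')
  from WhileTrue.prems WhileTrue.hyps show ?case
    by (cases rule: exec.cases) (auto dest!: WhileTrue.IH)
next
  case (WhileFalse e s P)
  from WhileFalse.prems WhileFalse.hyps show ?case by (cases rule: exec.cases) auto
qed

text \<open>The input word is stored in array 0, everything else is 0; the answer is read off cell 0 of
  array 1.\<close>
definition initial :: "nat list \<Rightarrow> state" where
  "initial xs = (\<lambda>a i. if a = 0 \<and> i < length xs then xs ! i else 0)"

definition accepting :: "state \<Rightarrow> bool" where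
  "accepting s \<longleftrightarrow> s 1 0 \<noteq> 0"

text \<open>The program decides the promise problem with valid inputs \<open>valid\<close> and yes-instances \<open>yes\<close>
  in time \<open>T\<close>.\<close>
definition decides_in_time ::
  "com \<Rightarrow> ('i \<Rightarrow> nat list) \<Rightarrow> ('i \<Rightarrow> bool) \<Rightarrow> ('i \<Rightarrow> bool) \<Rightarrow> ('i \<Rightarrow> real) \<Rightarrow> bool" where
  "decides_in_time P encode valid yes T \<longleftrightarrow>
     (\<forall>x. valid x \<longrightarrow>
        (\<exists>t s. exec P (initial (encode x)) t s \<and> real t \<le> T x \<and> (accepting s \<longleftrightarrow> yes x)))"


section \<open>Structural Partial Grundy Coloring\<close>

record spgc_input =
  colors :: nat
  degeneracy :: nat
  graph :: "nat ugraph"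
  bicliques :: "nat ugraph list"

definition num_vertices :: "spgc_input \<Rightarrow> nat" where
  "num_vertices x = card (verts (graph x))"

text \<open>As usual for graphs that are given to an algorithm, the vertices are numbered
  \<open>0, \<dots>, n - 1\<close>.\<close>
definition spgc_valid :: "spgc_input \<Rightarrow> bool" where
  "spgc_valid x \<longleftrightarrow>
     colors x > 0 \<and> degeneracy x > 0 \<and> length (bicliques x) > 0 \<and>
     simple_graph (graph x) \<and> verts (graph x) = {..<num_vertices x} \<and>
     (\<forall>A \<in> set (bicliques x). subgraph A (graph x) \<and> biclique A) \<and>
     degenerate (degeneracy x) (delete_edges (graph x) (\<Union>A \<in> set (bicliques x). edges A))"

definition spgc_yes :: "spgc_input \<Rightarrow> bool" where
  "spgc_yes x \<longleftrightarrow> (\<exists>k' \<ge> colors x. \<exists>c. partial_grundy_coloring (graph x) k' c)"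

definition adjacency_matrix :: "nat \<Rightarrow> nat ugraph \<Rightarrow> nat list" where
  "adjacency_matrix n G =
     concat (map (\<lambda>u. map (\<lambda>v. if {u, v} \<in> edges G then 1 else 0) [0..<n]) [0..<n])"

text \<open>The vertex set of a biclique need not be stored, see \<open>biclique_verts\<close> below.\<close>
definition spgc_encode :: "spgc_input \<Rightarrow> nat list" where
  "spgc_encode x =
     [colors x, degeneracy x, length (bicliques x), num_vertices x]
     @ adjacency_matrix (num_vertices x) (graph x)
     @ concat (map (adjacency_matrix (num_vertices x)) (bicliques x))"

lemma biclique_verts: "biclique A \<Longrightarrow> verts A = \<Union>(edges A)"
  unfolding biclique_def by (elim exE conjE) auto

end

theory Submission
  imports Defs
begin

text \<open>
  By greedy extension, a partial Grundy coloring with at least \<open>k\<close> colors exists iff there are disjoint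
  independent sets \<open>X\<^sub>1, \<dots>, X\<^sub>k\<close> with at most \<open>k - i + 1\<close> vertices in \<open>X\<^sub>i\<close> such that every \<open>X\<^sub>i\<close> has a vertex
  with neighbors in all \<open>X\<^sub>j\<close>, \<open>j < i\<close>. The algorithm runs through a set of guesses and decodes each of them to
  a partial coloring, which is made proper by uncoloring every vertex with an equally colored neighbor that
  comes later in a degeneracy order of \<open>G - F\<close>; it then tests the remaining condition. This is sound for
  arbitrary guesses.

  For completeness, one bit for every biclique and color \<open>i\<close> tells which side \<open>X\<^sub>i\<close> avoids (\<open>2\<^bsup>l k\<^esup>\<close> choices). Among
  the vertices allowed for color \<open>i\<close> all edges belong to \<open>G - F\<close>, so that \<open>X\<^sub>i\<close> survives if none of its at most
  \<open>k d\<close> later neighbors gets color \<open>i\<close>. A global hash function into a range polynomial in \<open>d\<close> and \<open>k\<close>, followed by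
  one hash function for each color into a range of size \<open>O(d k\<^sup>3)\<close>, separates \<open>X\<^sub>i\<close> from these vertices and from
  the other \<open>X\<^sub>j\<close>. The at most \<open>k (k + 1) / 2\<close> hash values of the \<open>X\<^sub>i\<close> are guessed as a set of cells in \<open>k\<^sup>2\<close> blocks
  of \<open>13 d k\<^sup>2\<close> cells, that is by \<open>2 k\<^sup>2\<close> bits and \<open>k (k + 1) / 2\<close> offsets, which contributes the factor
  \<open>2\<^bsup>O(k\<^sup>2 d)\<^esup> k\<^bsup>k\<^sup>2\<^esup>\<close>.

  A verification time polynomial in \<open>l\<close> is affordable if \<open>2\<^sup>l < n\<^bsup>2 k\<^esup>\<close>. Otherwise the \<open>X\<^sub>i\<close> are listed directly:
  these are \<open>n\<^bsup>k\<^sup>2\<^esup> \<le> 2\<^bsup>l k / 2\<^esup>\<close> guesses, which leaves room for the polynomial factor.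
\<close>

section \<open>Running time and correctness of programs\<close>

primrec writes :: "com \<Rightarrow> nat set" where
  "writes Skip = {}"
| "writes (Write a e f) = {a}"
| "writes (Seq P Q) = writes P \<union> writes Q"
| "writes (If e P Q) = writes P \<union> writes Q"
| "writes (While e P) = writes P"

lemma exec_frame: "exec P s t s' \<Longrightarrow> a \<notin> writes P \<Longrightarrow> s' a = s a"
  by (induction rule: exec.induct) auto

text \<open>The lower bound 2 lets one extra factor \<open>B\<close> absorb the doubling caused by
  an addition.\<close>

definition bounded_by :: "nat \<Rightarrow> state \<Rightarrow> bool" where
  "bounded_by B s \<longleftrightarrow> 2 \<le> B \<and> (\<forall>a i. s a i \<le> B)"

text \<open>A constant counts with its value, so that \<open>eval_le_power\<close> holds without a bound on constants.\<close>
primrec esize :: "exp \<Rightarrow> nat" where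
  "esize (Const n) = Suc n"
| "esize (Read a e) = Suc (esize e)"
| "esize (Add e f) = Suc (esize e + esize f)"
| "esize (Sub e f) = Suc (esize e + esize f)"
| "esize (Mul e f) = Suc (esize e + esize f)"
| "esize (Div e f) = Suc (esize e + esize f)"

lemma esize_pos: "0 < esize e"
  by (cases e) auto

text \<open>The value of a compound expression is at most the product of the bounds of its operands,
  up to a factor 2 for sums; the \<open>Suc\<close> in \<open>esize\<close> pays for that
  factor.\<close>

lemma eval_le_power:
  assumes "bounded_by B s"
  shows "eval e s \<le> B ^ esize e"
proof (induction e)
  case (Const n)
  have "n \<le> 2 ^ n" by simp
  also have "\<dots> \<le> B ^ n" using assms by (intro power_mono) (auto simp: bounded_by_def)
  also have "\<dots> \<le> B ^ Suc n" using assms by (intro power_increasing) (auto simp: bounded_by_def)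
  finally show ?case by simp
next
  case (Read a e)
  have "s a (eval e s) \<le> B ^ 1" using assms by (auto simp: bounded_by_def)
  also have "\<dots> \<le> B ^ Suc (esize e)" using assms by (intro power_increasing) (auto simp: bounded_by_def)
  finally show ?case by simp
next
  case (Add e f)
  have "eval e s + eval f s \<le> B ^ esize e + B ^ esize f" using Add by linarith
  also have "\<dots> \<le> 2 * (B ^ esize e * B ^ esize f)"
  proof -
    have "1 \<le> B ^ esize e" "1 \<le> B ^ esize f" using assms by (auto simp: bounded_by_def)
    then have "B ^ esize e \<le> B ^ esize e * B ^ esize f" "B ^ esize f \<le> B ^ esize e * B ^ esize f"
      by (metis mult.right_neutral mult_le_mono2, metis mult.left_neutral mult_le_mono1)
    then show ?thesis by linarith
  qed
  also have "\<dots> \<le> B * (B ^ esize e * B ^ esize f)" using assms by (auto simp: bounded_by_def)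
  finally show ?case by (simp add: power_add)
next
  case (Sub e f)
  have "eval e s - eval f s \<le> B ^ esize e" using Sub by linarith
  also have "\<dots> \<le> B ^ esize (Sub e f)" using assms by (intro power_increasing) (auto simp: bounded_by_def)
  finally show ?case by simp
next
  case (Mul e f)
  have "eval e s * eval f s \<le> B ^ (esize e + esize f)" using Mul by (simp add: power_add mult_le_mono)
  also have "\<dots> \<le> B ^ esize (Mul e f)" using assms by (intro power_increasing) (auto simp: bounded_by_def)
  finally show ?case by simp
next
  case (Div e f)
  have "eval e s div eval f s \<le> B ^ esize e" using Div by (meson div_le_dividend le_trans)
  also have "\<dots> \<le> B ^ esize (Div e f)" using assms by (intro power_increasing) (auto simp: bounded_by_def)
  finally show ?case by simp
qed

section \<open>Bit lengths and logarithmic costs of expressions\<close>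

lemma less_two_power_bitlen: "n < 2 ^ bitlen n"
  using floor_log_exp2_gt[of n] by (simp add: bitlen_def)

lemma bitlen_le:
  assumes "n < 2 ^ m" "0 < m"
  shows "bitlen n \<le> m"
proof (cases "n = 0")
  case True
  then show ?thesis using assms by (simp add: bitlen_def)
next
  case False
  then have "(2::nat) ^ floor_log n < 2 ^ m" using assms floor_log_exp2_le[of n] by linarith
  then show ?thesis by (simp add: bitlen_def)
qed

lemma bitlen_pos: "0 < bitlen n"
  by (simp add: bitlen_def)

lemma bitlen_eval_le:
  assumes "bounded_by B s"
  shows "bitlen (eval e s) \<le> esize e * bitlen B"
proof (rule bitlen_le)
  have "eval e s \<le> B ^ esize e" by (rule eval_le_power[OF assms])
  also have "\<dots> < (2 ^ bitlen B) ^ esize e"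
    by (intro power_strict_mono less_two_power_bitlen) (auto simp: esize_pos)
  finally show "eval e s < 2 ^ (esize e * bitlen B)"
    by (simp add: power_mult[symmetric] mult.commute)
qed (simp add: esize_pos bitlen_pos)

text \<open>Each node of the expression tree is charged for the bits of its operands, which are
  linear in \<open>esize\<close> in units of \<open>bitlen B\<close>. Summed over the tree this is
  quadratic.\<close>

lemma eval_cost_le:
  assumes "bounded_by B s"
  shows "eval_cost e s \<le> 2 * (esize e)\<^sup>2 * bitlen B"
proof (induction e)
  case (Const n)
  have "bitlen n \<le> Suc n * bitlen B" using bitlen_eval_le[OF assms, of "Const n"] by simp
  also have "\<dots> \<le> 2 * (Suc n)\<^sup>2 * bitlen B" by (intro mult_le_mono1) (simp add: power2_eq_square)
  finally show ?case by simp
next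
  case (Read a e)
  have "bitlen (eval e s) \<le> esize e * bitlen B"
    "bitlen (s a (eval e s)) \<le> Suc (esize e) * bitlen B"
    using bitlen_eval_le[OF assms, of e] bitlen_eval_le[OF assms, of "Read a e"] by simp_all
  then have "eval_cost (Read a e) s \<le>
      2 * (esize e)\<^sup>2 * bitlen B + (esize e * bitlen B + Suc (esize e) * bitlen B)"
    using Read by (simp only: eval_cost.simps)
  also have "\<dots> \<le> 2 * (Suc (esize e))\<^sup>2 * bitlen B" by (simp add: power2_eq_square algebra_simps)
  finally show ?case by simp
next
  case (Add e f)
  then have "eval_cost (Add e f) s \<le> 2 * (esize e)\<^sup>2 * bitlen B + 2 * (esize f)\<^sup>2 * bitlen B
      + (esize e * bitlen B + esize f * bitlen B)"
    using bitlen_eval_le[OF assms, of e] bitlen_eval_le[OF assms, of f] by simp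
  also have "\<dots> \<le> 2 * (esize (Add e f))\<^sup>2 * bitlen B" by (simp add: power2_eq_square algebra_simps)
  finally show ?case .
next
  case (Sub e f)
  then have "eval_cost (Sub e f) s \<le> 2 * (esize e)\<^sup>2 * bitlen B + 2 * (esize f)\<^sup>2 * bitlen B
      + (esize e * bitlen B + esize f * bitlen B)"
    using bitlen_eval_le[OF assms, of e] bitlen_eval_le[OF assms, of f] by simp
  also have "\<dots> \<le> 2 * (esize (Sub e f))\<^sup>2 * bitlen B" by (simp add: power2_eq_square algebra_simps)
  finally show ?case .
next
  case (Mul e f)
  then have "eval_cost (Mul e f) s \<le> 2 * (esize e)\<^sup>2 * bitlen B + 2 * (esize f)\<^sup>2 * bitlen B
      + (esize e * bitlen B + esize f * bitlen B)"
    using bitlen_eval_le[OF assms, of e] bitlen_eval_le[OF assms, of f] by simp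
  also have "\<dots> \<le> 2 * (esize (Mul e f))\<^sup>2 * bitlen B" by (simp add: power2_eq_square algebra_simps)
  finally show ?case .
next
  case (Div e f)
  then have "eval_cost (Div e f) s \<le> 2 * (esize e)\<^sup>2 * bitlen B + 2 * (esize f)\<^sup>2 * bitlen B
      + (esize e * bitlen B + esize f * bitlen B)"
    using bitlen_eval_le[OF assms, of e] bitlen_eval_le[OF assms, of f] by simp
  also have "\<dots> \<le> 2 * (esize (Div e f))\<^sup>2 * bitlen B" by (simp add: power2_eq_square algebra_simps)
  finally show ?case .
qed

text \<open>The factor 3 is 2 for the evaluation and 1 for the bits of the result, which writes and
  tests charge in addition.\<close>

definition ecost :: "exp \<Rightarrow> nat" where
  "ecost e = 3 * (esize e)\<^sup>2"

lemma ecost_bound: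
  assumes "bounded_by B s"
  shows "eval_cost e s + bitlen (eval e s) \<le> ecost e * bitlen B"
proof -
  have "esize e * bitlen B \<le> (esize e)\<^sup>2 * bitlen B" by (simp add: power2_eq_square)
  moreover have "ecost e * bitlen B = 2 * (esize e)\<^sup>2 * bitlen B + (esize e)\<^sup>2 * bitlen B"
    by (simp add: ecost_def)
  ultimately show ?thesis
    using eval_cost_le[OF assms, of e] bitlen_eval_le[OF assms, of e] by linarith
qed

section \<open>Running time of commands and total correctness\<close>

text \<open>Time in units of the bit length of the largest number in memory, if no loop makes more than \<open>R\<close>
  iterations.\<close>
primrec cost :: "nat \<Rightarrow> com \<Rightarrow> nat" where
  "cost R Skip = 1"
| "cost R (Write a e f) = ecost e + ecost f"
| "cost R (Seq P Q) = cost R P + cost R Q"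
| "cost R (If e P Q) = ecost e + (cost R P + cost R Q)"
| "cost R (While e P) = Suc R * (ecost e + cost R P)"

text \<open>The exponent \<open>size P\<close> is a crude bound for the nesting depth of loops. For
  a fixed program the time is thus polynomial in \<open>R\<close>.\<close>

lemma cost_le_polynomial: "cost R P \<le> cost 0 P * Suc R ^ size P"
proof (induction P)
  case (Seq P Q)
  have "cost 0 P * Suc R ^ size P \<le> cost 0 P * Suc R ^ size (Seq P Q)"
    "cost 0 Q * Suc R ^ size Q \<le> cost 0 Q * Suc R ^ size (Seq P Q)"
    by (intro mult_le_mono2 power_increasing; simp)+
  then show ?case using Seq by (simp only: cost.simps distrib_right)
next
  case (If e P Q)
  have "cost 0 P * Suc R ^ size P \<le> cost 0 P * Suc R ^ size (If e P Q)"
    "cost 0 Q * Suc R ^ size Q \<le> cost 0 Q * Suc R ^ size (If e P Q)"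
    by (intro mult_le_mono2 power_increasing; simp)+
  moreover have "ecost e * 1 \<le> ecost e * Suc R ^ size (If e P Q)"
    by (intro mult_le_mono2 one_le_power) simp
  ultimately show ?case using If by (simp only: cost.simps distrib_right)
next
  case (While e P)
  have "ecost e * 1 \<le> ecost e * Suc R ^ size P" by (intro mult_le_mono2) simp
  then have "ecost e + cost R P \<le> (ecost e + cost 0 P) * Suc R ^ size P"
    using While by (simp only: distrib_right)
  then have "Suc R * (ecost e + cost R P) \<le> Suc R * ((ecost e + cost 0 P) * Suc R ^ size P)"
    by (rule mult_le_mono2)
  also have "\<dots> = (ecost e + cost 0 P) * Suc R ^ Suc (size P)" by (simp only: power_Suc mult_ac)
  finally show ?case by simp
qed simp_all

text \<open>Total correctness with a time bound. Boundedness of the memory is passed from command to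
  command, so that every cost is measured in \<open>bitlen B\<close>. The time \<open>T\<close> is
  separate from \<open>cost R P\<close> because the loop over the guesses may exceed
  \<open>R\<close> rounds.\<close>

definition ensures :: "nat \<Rightarrow> nat \<Rightarrow> com \<Rightarrow> state \<Rightarrow> (state \<Rightarrow> bool) \<Rightarrow> bool" where
  "ensures B T P s Q \<longleftrightarrow> (bounded_by B s \<longrightarrow>
     (\<exists>t s'. exec P s t s' \<and> t \<le> T * bitlen B \<and> bounded_by B s' \<and> Q s'))"

abbreviation spec :: "nat \<Rightarrow> nat \<Rightarrow> com \<Rightarrow> state \<Rightarrow> (state \<Rightarrow> bool) \<Rightarrow> bool" where
  "spec B R P \<equiv> ensures B (cost R P) P"

text \<open>The frame property is built into this consequence rule, so postconditions only describe
  arrays that are written.\<close>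

lemma ensures_conseq:
  assumes "ensures B T P s Q"
    and "\<And>s'. bounded_by B s' \<Longrightarrow> (\<And>a. a \<notin> writes P \<Longrightarrow> s' a = s a) \<Longrightarrow> Q s' \<Longrightarrow> Q' s'"
    and "T \<le> T'"
  shows "ensures B T' P s Q'"
proof -
  have "t \<le> T' * bitlen B" if "t \<le> T * bitlen B" for t
    using that \<open>T \<le> T'\<close> by (meson le_trans mult_le_mono1)
  then show ?thesis using assms(1,2) exec_frame unfolding ensures_def by blast
qed

lemma spec_conseq:
  assumes "spec B R P s Q"
    and "\<And>s'. bounded_by B s' \<Longrightarrow> (\<And>a. a \<notin> writes P \<Longrightarrow> s' a = s a) \<Longrightarrow> Q s' \<Longrightarrow> Q' s'"
  shows "spec B R P s Q'"
  by (rule ensures_conseq[OF assms(1)]) (use assms(2) in auto)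

lemma ensures_bounded: "(bounded_by B s \<Longrightarrow> ensures B T P s Q) \<Longrightarrow> ensures B T P s Q"
  by (auto simp: ensures_def)

lemma spec_Skip: "Q s \<Longrightarrow> spec B R Skip s Q"
  unfolding ensures_def
  using exec.Skip[of s] bitlen_pos[of B] by (intro impI exI[of _ 1] exI[of _ s]) auto

lemma spec_Write:
  assumes "bounded_by B s \<Longrightarrow> eval f s \<le> B" "Q (s(a := (s a)(eval e s := eval f s)))"
  shows "spec B R (Write a e f) s Q"
  unfolding ensures_def
proof (intro impI exI conjI)
  assume b: "bounded_by B s"
  show "exec (Write a e f) s (eval_cost e s + eval_cost f s + bitlen (eval e s) + bitlen (eval f s))
     (s(a := (s a)(eval e s := eval f s)))" by (rule exec.Write)
  show "eval_cost e s + eval_cost f s + bitlen (eval e s) + bitlen (eval f s)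
      \<le> cost R (Write a e f) * bitlen B"
    using ecost_bound[OF b, of e] ecost_bound[OF b, of f] by (simp add: distrib_right)
  show "bounded_by B (s(a := (s a)(eval e s := eval f s)))"
    using b assms(1) by (auto simp: bounded_by_def)
qed (rule assms(2))

lemma ensures_Seq:
  assumes "ensures B T P s (\<lambda>s'. ensures B T' P' s' Q)"
  shows "ensures B (T + T') (Seq P P') s Q"
  unfolding ensures_def
proof
  assume "bounded_by B s"
  then obtain t s' where 1: "exec P s t s'" "t \<le> T * bitlen B" "bounded_by B s'" "ensures B T' P' s' Q"
    using assms unfolding ensures_def by blast
  then obtain t' s'' where 2: "exec P' s' t' s''" "t' \<le> T' * bitlen B" "bounded_by B s''" "Q s''"
    unfolding ensures_def by blast
  have "exec (Seq P P') s (t + t') s''" using 1 2 by (blast intro: exec.Seq)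
  moreover have "t + t' \<le> (T + T') * bitlen B" using 1 2 by (simp add: distrib_right)
  ultimately show "\<exists>t s'. exec (Seq P P') s t s' \<and> t \<le> (T + T') * bitlen B \<and> bounded_by B s' \<and> Q s'"
    using 2 by blast
qed

lemma spec_Seq: "spec B R P s (\<lambda>s'. spec B R P' s' Q) \<Longrightarrow> spec B R (Seq P P') s Q"
  using ensures_Seq by simp

lemma spec_If:
  assumes "eval e s \<noteq> 0 \<Longrightarrow> spec B R P s Q" "eval e s = 0 \<Longrightarrow> spec B R P' s Q"
  shows "spec B R (If e P P') s Q"
  unfolding ensures_def
proof
  assume b: "bounded_by B s"
  show "\<exists>t s'. exec (If e P P') s t s' \<and> t \<le> cost R (If e P P') * bitlen B \<and> bounded_by B s' \<and> Q s'"
  proof (cases "eval e s = 0")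
    case True
    then obtain t s' where 1: "exec P' s t s'" "t \<le> cost R P' * bitlen B" "bounded_by B s'" "Q s'"
      using assms b unfolding ensures_def by blast
    then have "exec (If e P P') s (eval_cost e s + bitlen (eval e s) + t) s'"
      using True by (blast intro: exec.IfFalse)
    moreover have "eval_cost e s + bitlen (eval e s) + t \<le> cost R (If e P P') * bitlen B"
      using ecost_bound[OF b, of e] 1 by (simp add: distrib_right)
    ultimately show ?thesis using 1 by blast
  next
    case False
    then obtain t s' where 1: "exec P s t s'" "t \<le> cost R P * bitlen B" "bounded_by B s'" "Q s'"
      using assms b unfolding ensures_def by blast
    then have "exec (If e P P') s (eval_cost e s + bitlen (eval e s) + t) s'"
      using False by (blast intro: exec.IfTrue)
    moreover have "eval_cost e s + bitlen (eval e s) + t \<le> cost R (If e P P') * bitlen B"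
      using ecost_bound[OF b, of e] 1 by (simp add: distrib_right)
    ultimately show ?thesis using 1 by blast
  qed
qed

section \<open>Derived expressions and counting loops\<close>

abbreviation Var :: "nat \<Rightarrow> exp" where
  "Var a \<equiv> Read a (Const 0)"

abbreviation Set :: "nat \<Rightarrow> exp \<Rightarrow> com" where
  "Set a e \<equiv> Write a (Const 0) e"

definition Mod :: "exp \<Rightarrow> exp \<Rightarrow> exp" where
  "Mod e f = Sub e (Mul (Div e f) f)"

lemma eval_Mod [simp]: "eval (Mod e f) s = eval e s mod eval f s"
  by (simp add: Mod_def minus_div_mult_eq_mod)

definition For_step :: "nat \<Rightarrow> com \<Rightarrow> com" where
  "For_step i P = Seq P (Set i (Add (Var i) (Const 1)))"

text \<open>Subtraction is truncated, so the test is nonzero exactly while the counter is below the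
  bound.\<close>

definition For_loop :: "nat \<Rightarrow> exp \<Rightarrow> com \<Rightarrow> com" where
  "For_loop i N P = While (Sub N (Var i)) (For_step i P)"

definition For :: "nat \<Rightarrow> exp \<Rightarrow> com \<Rightarrow> com" where
  "For i N P = Seq (Set i (Const 0)) (For_loop i N P)"

lemma writes_For [simp]: "writes (For i N P) = insert i (writes P)"
  by (auto simp: For_def For_loop_def For_step_def)

text \<open>The bound \<open>N\<close> is evaluated anew in every round and therefore has to keep
  its value \<open>n\<close>. The invariant must be insensitive to the counter array, which
  \<open>For_step\<close> changes behind the body.\<close>

context
  fixes i n R B :: nat and P :: com and N :: exp and Inv :: "nat \<Rightarrow> state \<Rightarrow> bool" and s :: state
  assumes i: "i \<notin> writes P"
    and N: "\<And>j s'. j \<le> n \<Longrightarrow> Inv j s' \<Longrightarrow> (\<And>a. a \<notin> insert i (writes P) \<Longrightarrow> s' a = s a) \<Longrightarrow>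
      eval N s' = n"
    and upd: "\<And>j s' x. Inv j s' \<Longrightarrow> Inv j (s'(i := x))"
    and init: "Inv 0 s"
    and body: "\<And>j s'. j < n \<Longrightarrow> s' i 0 = j \<Longrightarrow> bounded_by B s' \<Longrightarrow>
      (\<And>a. a \<notin> insert i (writes P) \<Longrightarrow> s' a = s a) \<Longrightarrow> Inv j s' \<Longrightarrow> spec B R P s' (Inv (Suc j))"
begin

lemma ensures_For_loop:
  assumes nB: "n \<le> B"
    and j: "j \<le> n" "s1 i 0 = j" "Inv j s1" "bounded_by B s1"
      "\<And>a. a \<notin> insert i (writes P) \<Longrightarrow> s1 a = s a"
  shows "\<exists>t s'. exec (For_loop i N P) s1 t s' \<and>
    t \<le> (Suc (n - j) * (ecost (Sub N (Var i)) + cost R (For_step i P))) * bitlen B \<and>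
    bounded_by B s' \<and> Inv n s'"
  using j
proof (induction "n - j" arbitrary: j s1)
  case 0
  then have [simp]: "j = n" by simp
  have e: "eval (Sub N (Var i)) s1 = 0" using N[of j s1] 0 by simp
  have "exec (For_loop i N P) s1 (eval_cost (Sub N (Var i)) s1 + bitlen (eval (Sub N (Var i)) s1)) s1"
    unfolding For_loop_def by (rule exec.WhileFalse[OF e])
  moreover have "eval_cost (Sub N (Var i)) s1 + bitlen (eval (Sub N (Var i)) s1) \<le>
      (Suc (n - j) * (ecost (Sub N (Var i)) + cost R (For_step i P))) * bitlen B"
    using ecost_bound[OF 0(5), of "Sub N (Var i)"] by (simp add: distrib_right)
  ultimately show ?case using 0 by auto
next
  case (Suc m)
  let ?c = "Sub N (Var i)"
  have jn: "j < n" using Suc by simp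
  have e: "eval ?c s1 \<noteq> 0" using N[of j s1] Suc jn by simp
  have "spec B R (For_step i P) s1 (\<lambda>s'. Inv (Suc j) s' \<and> s' i 0 = Suc j \<and>
      (\<forall>a. a \<notin> insert i (writes P) \<longrightarrow> s' a = s a))"
    unfolding For_step_def
  proof (rule spec_Seq, rule spec_conseq[OF body[OF jn]])
    fix s' assume s': "bounded_by B s'" "\<And>a. a \<notin> writes P \<Longrightarrow> s' a = s1 a" "Inv (Suc j) s'"
    have "s' i 0 = j" using s'(2)[OF i] Suc by simp
    then show "spec B R (Set i (Add (Var i) (Const 1))) s'
      (\<lambda>s'. Inv (Suc j) s' \<and> s' i 0 = Suc j \<and> (\<forall>a. a \<notin> insert i (writes P) \<longrightarrow> s' a = s a))"
      using jn nB s' Suc.prems upd by (intro spec_Write) auto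
  qed (use Suc in auto)
  then obtain t s' where 1: "exec (For_step i P) s1 t s'" "t \<le> cost R (For_step i P) * bitlen B"
    "bounded_by B s'" "Inv (Suc j) s'" "s' i 0 = Suc j" "\<And>a. a \<notin> insert i (writes P) \<Longrightarrow> s' a = s a"
    using Suc.prems(4) unfolding ensures_def by blast
  have "m = n - Suc j" "Suc j \<le> n" using Suc.hyps(2) by auto
  from Suc.hyps(1)[OF this 1(5) 1(4) 1(3) 1(6)]
  obtain t' s'' where 2: "exec (For_loop i N P) s' t' s''"
    "t' \<le> (Suc m * (ecost ?c + cost R (For_step i P))) * bitlen B" "bounded_by B s''" "Inv n s''"
    using \<open>m = n - Suc j\<close> by auto
  have "exec (For_loop i N P) s1 (eval_cost ?c s1 + bitlen (eval ?c s1) + t + t') s''"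
    using 1 2 e unfolding For_loop_def by (blast intro: exec.WhileTrue)
  moreover have "eval_cost ?c s1 + bitlen (eval ?c s1) + t + t' \<le>
      (Suc (n - j) * (ecost ?c + cost R (For_step i P))) * bitlen B"
  proof -
    have "eval_cost ?c s1 + bitlen (eval ?c s1) \<le> ecost ?c * bitlen B"
      by (rule ecost_bound[OF Suc.prems(4)])
    then show ?thesis using 1(2) 2(2) by (simp add: Suc.hyps(2)[symmetric] distrib_right)
  qed
  ultimately show ?case using 2 by blast
qed

text \<open>The two constant terms pay for setting the counter to 0; the \<open>Suc\<close> in
  \<open>Suc n\<close> covers the last, failing test.\<close>

lemma ensures_For_exact:
  assumes nB: "n \<le> B"
  shows "ensures B (ecost (Const 0) + ecost (Const 0) +
    Suc n * (ecost (Sub N (Var i)) + cost R (For_step i P))) (For i N P) s (Inv n)"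
  unfolding For_def
proof (rule ensures_Seq)
  let ?T = "Suc n * (ecost (Sub N (Var i)) + cost R (For_step i P))"
  have "ensures B ?T (For_loop i N P) (s(i := (s i)(0 := 0))) (Inv n)"
    unfolding ensures_def
    using ensures_For_loop[OF nB, of 0 "s(i := (s i)(0 := 0))"] init upd by simp
  then have "spec B R (Set i (Const 0)) s (\<lambda>s'. ensures B ?T (For_loop i N P) s' (Inv n))"
    by (intro spec_Write) simp_all
  then show "ensures B (ecost (Const 0) + ecost (Const 0)) (Set i (Const 0)) s
     (\<lambda>s'. ensures B ?T (For_loop i N P) s' (Inv n))" by simp
qed

text \<open>The form for the loop over the guesses: \<open>n\<close> is bounded by \<open>B\<close>
  only, and its rounds are counted outside of \<open>cost R\<close>.\<close>

lemma ensures_For: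
  assumes "n \<le> B"
  shows "ensures B (Suc n * cost R (For i N P)) (For i N P) s (Inv n)"
proof (rule ensures_conseq[OF ensures_For_exact[OF assms]])
  have "ecost (Const 0) + ecost (Const 0) + (ecost (Sub N (Var i)) + cost R (For_step i P))
      \<le> cost R (For i N P)"
    by (simp add: For_def For_loop_def)
  then have "Suc n * (ecost (Const 0) + ecost (Const 0) + (ecost (Sub N (Var i)) + cost R (For_step i P)))
      \<le> Suc n * cost R (For i N P)"
    by (rule mult_le_mono2)
  then show "ecost (Const 0) + ecost (Const 0) +
      Suc n * (ecost (Sub N (Var i)) + cost R (For_step i P)) \<le> Suc n * cost R (For i N P)"
    by (simp add: distrib_left)
qed

lemma spec_For:
  assumes "n \<le> R" "R \<le> B"
  shows "spec B R (For i N P) s (Inv n)"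
proof (rule ensures_conseq[OF ensures_For_exact])
  show "ecost (Const 0) + ecost (Const 0) +
      Suc n * (ecost (Sub N (Var i)) + cost R (For_step i P)) \<le> cost R (For i N P)"
    using mult_le_mono1[of "Suc n" "Suc R" "ecost (Sub N (Var i)) + cost R (For_step i P)"] assms
    by (simp add: For_def For_loop_def)
qed (use assms in auto)

end

section \<open>Hashing and guess strings\<close>

text \<open>Arguments are meant to be less than \<open>T\<close>. The modulus is then so large compared with the arguments
  that it need not be prime: for \<open>0 < D < T\<close>, the multiples of \<open>D\<close> hit a window of length \<open>2 T\<close> around
  0 modulo \<open>M T\<close> with frequency \<open>O(1 / M)\<close>.\<close>
definition mhash :: "nat \<Rightarrow> nat \<Rightarrow> nat \<Rightarrow> nat \<Rightarrow> nat" where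
  "mhash M T a x = (a * x mod (M * T)) div T"

lemma mhash_less: "0 < M \<Longrightarrow> 0 < T \<Longrightarrow> mhash M T a x < M"
  by (simp add: mhash_def less_mult_imp_div_less)

lemma diff_less_of_div_eq:
  assumes "a div T = b div T" "0 < (T::nat)"
  shows "a < b + T"
proof -
  have "a = T * (a div T) + a mod T" "b = T * (b div T) + b mod T" by simp_all
  moreover have "a mod T < T" using assms by simp
  ultimately show ?thesis unfolding assms(1) by linarith
qed

text \<open>With \<open>W = M * T\<close> and \<open>D = x - y\<close>, a collision puts
  \<open>a * D\<close> at distance less than \<open>T\<close> from a multiple \<open>W * J\<close>
  with \<open>J \<le> D\<close>. For each of these \<open>D + 1\<close> values of \<open>J\<close>,
  the possible \<open>a\<close> lie in a window of at most \<open>2 * T div D + 1\<close> numbers.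
  The sum is at most \<open>5 * T\<close> because \<open>D < T\<close>.\<close>

lemma mhash_collision_count_aux:
  assumes "y < x" "x < T" "0 < M"
  shows "card {a. a < M * T \<and> mhash M T a x = mhash M T a y} \<le> 5 * T"
proof -
  define W where "W = M * T"
  define D where "D = x - y"
  have D: "0 < D" "D < T" and T: "0 < T" "T \<le> W" using assms by (auto simp: D_def W_def)
  define C where "C J = {a. W * J < a * D + T \<and> a * D < W * J + T}" for J
  have C: "finite (C J) \<and> card (C J) \<le> 2 * T div D + 1" for J
  proof (cases "C J = {}")
    case False
    define m where "m = (LEAST a. a \<in> C J)"
    have m: "m \<in> C J" using False unfolding m_def by (auto intro: LeastI)
    have "a \<in> {m..m + 2 * T div D}" if a: "a \<in> C J" for a
    proof -
      have "m \<le> a" unfolding m_def using a by (rule Least_le)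
      moreover have "(a - m) * D \<le> 2 * T"
        using a m unfolding C_def by (auto simp: diff_mult_distrib)
      then have "a - m \<le> 2 * T div D" using D by (simp add: less_eq_div_iff_mult_less_eq)
      ultimately show ?thesis by auto
    qed
    then have sub: "C J \<subseteq> {m..m + 2 * T div D}" by blast
    then show ?thesis using card_mono[OF _ sub] finite_subset[OF sub] by simp
  qed simp
  have sub: "{a. a < M * T \<and> mhash M T a x = mhash M T a y} \<subseteq> (\<Union>J\<in>{..D}. C J)"
  proof
    fix a assume "a \<in> {a. a < M * T \<and> mhash M T a x = mhash M T a y}"
    then have a: "a < W" and eq: "(a * x mod W) div T = (a * y mod W) div T"
      by (auto simp: W_def mhash_def)
    define p q where "p = a * x div W" and "q = a * y div W"
    define r r' where "r = a * x mod W" and "r' = a * y mod W"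
    have ax: "a * x = W * p + r" and ay: "a * y = W * q + r'" by (simp_all add: p_def q_def r_def r'_def)
    have rr: "r < r' + T" "r' < r + T"
      using diff_less_of_div_eq[OF eq] diff_less_of_div_eq[OF eq[symmetric]] T by (simp_all add: r_def r'_def)
    have qp: "q \<le> p" unfolding p_def q_def using assms by (intro div_le_mono mult_le_mono2) simp
    have aD: "a * D = a * x - a * y" by (simp add: D_def diff_mult_distrib2)
    have yx: "a * y \<le> a * x" using assms by simp
    have WJ: "W * (p - q) = W * p - W * q" "W * q \<le> W * p" using qp by (simp_all add: diff_mult_distrib2)
    have mem: "a \<in> C (p - q)" using rr aD yx WJ ax ay unfolding C_def by auto
    have "a * D \<le> W * D" using a by simp
    moreover have "W * (p - q) < a * D + T" using mem unfolding C_def by simp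
    ultimately have "W * (p - q) < W * Suc D" using T unfolding mult_Suc_right by linarith
    then have "p - q \<le> D" by (meson less_Suc_eq_le mult_less_cancel1)
    then show "a \<in> (\<Union>J\<in>{..D}. C J)" using mem by blast
  qed
  have "card {a. a < M * T \<and> mhash M T a x = mhash M T a y} \<le> card (\<Union>J\<in>{..D}. C J)"
    using C by (intro card_mono sub) auto
  also have "\<dots> \<le> (\<Sum>J\<in>{..D}. card (C J))" by (rule card_UN_le) simp
  also have "\<dots> \<le> (\<Sum>J\<in>{..D}. 2 * T div D + 1)" using C by (intro sum_mono) auto
  also have "\<dots> = D * (2 * T div D) + 2 * T div D + D + 1" by simp
  also have "\<dots> \<le> 2 * T + 2 * T + T"
  proof -
    have "D * (2 * T div D) \<le> 2 * T" "2 * T div D \<le> 2 * T" by simp_all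
    then show ?thesis using D by linarith
  qed
  finally show ?thesis by simp
qed

lemma mhash_collision_count:
  assumes "x < T" "y < T" "x \<noteq> y" "0 < M"
  shows "card {a. a < M * T \<and> mhash M T a x = mhash M T a y} \<le> 5 * T"
proof (cases "y < x")
  case True
  then show ?thesis using assms by (intro mhash_collision_count_aux)
next
  case False
  then have "card {a. a < M * T \<and> mhash M T a y = mhash M T a x} \<le> 5 * T"
    using assms by (intro mhash_collision_count_aux) auto
  then show ?thesis by (simp add: eq_commute)
qed

text \<open>Union bound: every pair excludes at most \<open>5 * T\<close> of the
  \<open>M * T\<close> multipliers.\<close>

lemma mhash_separates:
  assumes "finite P" "0 < T" "5 * card P < M"
    and P: "\<And>x y. (x, y) \<in> P \<Longrightarrow> x < T \<and> y < T \<and> x \<noteq> y"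
  shows "\<exists>a < M * T. \<forall>(x, y) \<in> P. mhash M T a x \<noteq> mhash M T a y"
proof (rule ccontr)
  assume no: "\<not> ?thesis"
  define C where "C p = {a. a < M * T \<and> mhash M T a (fst p) = mhash M T a (snd p)}" for p
  have "{..<M * T} \<subseteq> (\<Union>p\<in>P. C p)" using no by (fastforce simp: C_def)
  then have "M * T \<le> card (\<Union>p\<in>P. C p)"
    using card_mono[of "\<Union>p\<in>P. C p" "{..<M * T}"] assms(1) by (auto simp: C_def)
  also have "\<dots> \<le> (\<Sum>p\<in>P. card (C p))" by (rule card_UN_le[OF assms(1)])
  also have "\<dots> \<le> (\<Sum>p\<in>P. 5 * T)"
    using P assms(3) unfolding C_def by (intro sum_mono mhash_collision_count) auto
  also have "\<dots> = (5 * card P) * T" by simp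
  also have "\<dots> < M * T" using assms by simp
  finally show False by simp
qed

section \<open>Coding of sets and digit sequences by numbers\<close>

text \<open>The number \<open>x\<close> is read as a sequence of \<open>j\<close> bits: 0 moves to the next block of \<open>m\<close> cells, 1 marks a
  cell of the current block, whose offset is the next digit in base \<open>m\<close>. Coding an unordered set in this
  way saves a factor of about \<open>k\<close> for each marked cell compared with listing the cells.\<close>
primrec decode_marks :: "nat \<Rightarrow> nat \<Rightarrow> nat \<Rightarrow> nat \<Rightarrow> nat set" where
  "decode_marks m 0 x p = {}"
| "decode_marks m (Suc j) x p =
    (if x mod 2 = 0 then decode_marks m j (x div 2) (Suc p)
     else insert (p * m + x div 2 mod m) (decode_marks m j (x div 2 div m) p))"

text \<open>Induction on the number of bits. If the current block \<open>p\<close> meets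
  \<open>S\<close>, a 1 bit and an offset mark one element; otherwise a 0 bit moves on. An element
  costs one bit and a factor \<open>m\<close>, each of the \<open>b\<close> remaining blocks one
  bit.\<close>

lemma decode_marks_onto:
  assumes "S \<subseteq> {p * m..<(p + b) * m}" "b + card S \<le> j" "0 < m"
  shows "\<exists>x < 2 ^ j * m ^ card S. decode_marks m j x p = S"
  using assms
proof (induction j arbitrary: S p b)
  case 0
  then have "S = {}" using finite_subset[OF 0(1)] by auto
  then show ?case by auto
next
  case (Suc j)
  have fin: "finite S" using Suc.prems(1) finite_subset by blast
  show ?case
  proof (cases "\<exists>r < m. p * m + r \<in> S")
    case True
    then obtain r where r: "r < m" "p * m + r \<in> S" by blast
    define S' where "S' = S - {p * m + r}"
    have c: "card S = Suc (card S')" using card.remove[OF fin r(2)] by (simp add: S'_def)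
    have "S' \<subseteq> {p * m..<(p + b) * m}" "b + card S' \<le> j" using Suc.prems c by (auto simp: S'_def)
    from Suc.IH[OF this Suc.prems(3)] obtain x where x: "x < 2 ^ j * m ^ card S'" "decode_marks m j x p = S'"
      by blast
    \<comment> \<open>Lowest bit 1, then the offset \<open>r\<close> in base \<open>m\<close>, then
      the code \<open>x\<close> of the remaining elements.\<close>
    define e where "e = 1 + 2 * (r + m * x)"
    have e: "e mod 2 = 1" "e div 2 = r + m * x" "(r + m * x) mod m = r" "(r + m * x) div m = x"
      using r by (simp_all add: e_def)
    have "r + m * x < m * Suc x" using r by simp
    also have "\<dots> \<le> m * (2 ^ j * m ^ card S')" using x by (intro mult_le_mono2) simp
    finally have lt: "r + m * x < m * (2 ^ j * m ^ card S')" .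
    have "1 + 2 * y < 2 * y'" if "y < y'" for y y' :: nat using that by linarith
    from this[OF lt] have "e < 2 * (m * (2 ^ j * m ^ card S'))" unfolding e_def .
    then have "e < 2 ^ Suc j * m ^ card S" by (simp add: c mult_ac)
    moreover have "decode_marks m (Suc j) e p = S"
      using e x r by (simp add: S'_def insert_absorb)
    ultimately show ?thesis by blast
  next
    case False
    have sub: "S \<subseteq> {Suc p * m..<(Suc p + (b - 1)) * m}"
    proof
      fix y assume y: "y \<in> S"
      then have y1: "p * m \<le> y" "y < (p + b) * m" using Suc.prems(1) by auto
      have "\<not> y - p * m < m" using False y y1 by (metis le_add_diff_inverse)
      then have "Suc p * m \<le> y" using y1 by simp
      moreover from this have "b \<noteq> 0" using y1 by (metis add.right_neutral le_add2 mult_Suc not_less order_trans)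
      ultimately show "y \<in> {Suc p * m..<(Suc p + (b - 1)) * m}" using y1 by simp
    qed
    \<comment> \<open>The subtraction truncates: with no blocks left \<open>S\<close> is empty, so
      surplus bits can all be 0.\<close>
    have "b - 1 + card S \<le> j"
    proof (cases "b = 0")
      case True
      then have "S = {}" using Suc.prems(1) by auto
      then show ?thesis using True by simp
    qed (use Suc.prems in simp)
    from Suc.IH[OF sub this Suc.prems(3)] obtain x where
      x: "x < 2 ^ j * m ^ card S" "decode_marks m j x (Suc p) = S" by blast
    then have "2 * x < 2 ^ Suc j * m ^ card S" "decode_marks m (Suc j) (2 * x) p = S" by auto
    then show ?thesis by blast
  qed
qed

text \<open>The high part \<open>y\<close> stays free, so that several digit sequences can be
  stacked in one number while their bounds multiply.\<close>

lemma digits_exist: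
  assumes "\<And>i. i < k \<Longrightarrow> f i < (r::nat)"
  shows "\<exists>x < r ^ k * Suc y. (\<forall>i<k. x div r ^ i mod r = f i) \<and> x div r ^ k = y"
  using assms
proof (induction k arbitrary: f)
  case 0
  then show ?case by auto
next
  case (Suc k)
  obtain x where x: "x < r ^ k * Suc y" "\<And>i. i < k \<Longrightarrow> x div r ^ i mod r = f (Suc i)" "x div r ^ k = y"
    using Suc.IH[of "\<lambda>i. f (Suc i)"] Suc.prems by auto
  have f0: "f 0 < r" using Suc.prems by simp
  define e where "e = f 0 + r * x"
  have e: "e mod r = f 0" "e div r = x" using f0 by (simp_all add: e_def)
  have d: "e div r ^ Suc i = x div r ^ i" for i using e by (simp add: div_mult2_eq)
  have "e < r * Suc x" using f0 by (simp add: e_def)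
  also have "\<dots> \<le> r * (r ^ k * Suc y)" using x(1) by (intro mult_le_mono2) simp
  finally have "e < r ^ Suc k * Suc y" by (simp only: power_Suc mult.assoc)
  moreover have "e div r ^ i mod r = f i" if "i < Suc k" for i
    using that x(2) e d by (cases i) auto
  ultimately show ?case using d[of k] x(3) by blast
qed

text \<open>Successor of the largest \<open>i < k\<close> satisfying \<open>Q\<close>, and 0 (uncolored) if there is none.\<close>
primrec pick :: "(nat \<Rightarrow> bool) \<Rightarrow> nat \<Rightarrow> nat" where
  "pick Q 0 = 0"
| "pick Q (Suc i) = (if Q i then Suc i else pick Q i)"

lemma pick_le: "pick Q k \<le> k"
  by (induction k) auto

lemma pick_SucD: "pick Q k = Suc i \<Longrightarrow> Q i"
  by (induction k) (auto split: if_splits)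

lemma pick_cong: "(\<And>i. i < k \<Longrightarrow> Q i \<longleftrightarrow> Q' i) \<Longrightarrow> pick Q k = pick Q' k"
  by (induction k) auto

lemma pick_unique: "i < k \<Longrightarrow> (\<And>j. j < k \<Longrightarrow> Q j \<longleftrightarrow> j = i) \<Longrightarrow> pick Q k = Suc i"
  by (induction k) (auto simp: less_Suc_eq)

section \<open>Witnesses of partial Grundy colorings\<close>

definition grundy_check :: "nat \<Rightarrow> (nat \<Rightarrow> nat \<Rightarrow> bool) \<Rightarrow> nat \<Rightarrow> (nat \<Rightarrow> nat) \<Rightarrow> bool" where
  "grundy_check n adj k z \<longleftrightarrow>
     (\<forall>i \<in> {1..k}. \<exists>v<n. z v = i \<and> (\<forall>j \<in> {1..<i}. \<exists>u<n. adj u v \<and> z u = j))"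

text \<open>A proper partial coloring in which 0 means uncolored; the sets \<open>X\<^sub>i\<close>
  are its color classes, still without the bound on their size.\<close>

definition witness :: "nat \<Rightarrow> (nat \<Rightarrow> nat \<Rightarrow> bool) \<Rightarrow> nat \<Rightarrow> (nat \<Rightarrow> nat) \<Rightarrow> bool" where
  "witness n adj k z \<longleftrightarrow> (\<forall>v<n. z v \<le> k) \<and>
     (\<forall>u<n. \<forall>v<n. adj u v \<longrightarrow> z u \<noteq> 0 \<longrightarrow> z u \<noteq> z v) \<and> grundy_check n adj k z"

lemma grundy_check_iff:
  "grundy_check n adj k z \<longleftrightarrow>
     (\<forall>i<k. \<exists>v<n. z v = Suc i \<and> (\<forall>j<i. \<exists>u<n. adj u v \<and> z u = Suc j))"
proof -
  have *: "(\<forall>i\<in>{1..m}. Q i) \<longleftrightarrow> (\<forall>i<m. Q (Suc i))" "(\<forall>i\<in>{1..<Suc m}. Q i) \<longleftrightarrow> (\<forall>i<m. Q (Suc i))" for Q m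
    by (auto simp: Suc_le_eq gr0_conv_Suc)
  show ?thesis unfolding grundy_check_def * by (auto simp only: *)
qed

text \<open>The condition only asks for the existence of colored vertices, so coloring further
  vertices cannot destroy it.\<close>

lemma grundy_check_mono:
  assumes "grundy_check n adj k z" "\<And>v. v < n \<Longrightarrow> z v \<noteq> 0 \<Longrightarrow> z' v = z v"
  shows "grundy_check n adj k z'"
  unfolding grundy_check_def
proof
  fix i assume i: "i \<in> {1..k}"
  then obtain v where v: "v < n" "z v = i" "\<And>j. j \<in> {1..<i} \<Longrightarrow> \<exists>u<n. adj u v \<and> z u = j"
    using assms(1) unfolding grundy_check_def by blast
  have "\<exists>u<n. adj u v \<and> z' u = j" if j: "j \<in> {1..<i}" for j
    using v(3)[OF j] assms(2) j by fastforce
  then show "\<exists>v<n. z' v = i \<and> (\<forall>j \<in> {1..<i}. \<exists>u<n. adj u v \<and> z' u = j)"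
    using v(1,2) assms(2) i by auto
qed

lemma grundy_check_cong: "(\<And>v. v < n \<Longrightarrow> z v = z' v) \<Longrightarrow> grundy_check n adj k z \<longleftrightarrow> grundy_check n adj k z'"
  using grundy_check_mono[of n adj k z z'] grundy_check_mono[of n adj k z' z] by auto

section \<open>Witnesses and partial Grundy colorings\<close>

text \<open>Colour the remaining vertices one by one with the least colour that is missing in the
  neighbourhood; a vertex that opens a new colour sees all the old ones.\<close>
lemma witness_extend:
  assumes G: "verts G = {..<n}" "\<And>u v. adj u v \<longleftrightarrow> {u, v} \<in> edges G" "simple_graph G"
    and "witness n adj k z"
  shows "\<exists>k' \<ge> k. \<exists>c. partial_grundy_coloring G k' c"
  using assms(4)
proof (induction "card {v. v < n \<and> z v = 0}" arbitrary: z k)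
  case 0
  then have nz: "z v \<noteq> 0" if "v < n" for v using that by auto
  have "partial_grundy_coloring G k z"
    using 0(2) nz G(1,2) unfolding partial_grundy_coloring_def witness_def grundy_check_def
    by (fastforce simp: Suc_le_eq)
  then show ?case by blast
next
  case (Suc m)
  have sym: "adj u v \<Longrightarrow> adj v u" for u v using G(2) by (simp add: insert_commute)
  have irr: "\<not> adj u u" for u
    using G(2)[of u u] G(3) unfolding simple_graph_def by auto
  have w: "\<And>v. v < n \<Longrightarrow> z v \<le> k" "\<And>u v. u < n \<Longrightarrow> v < n \<Longrightarrow> adj u v \<Longrightarrow> z u \<noteq> 0 \<Longrightarrow> z u \<noteq> z v"
    "grundy_check n adj k z"
    using Suc.prems unfolding witness_def by blast+
  have "{v. v < n \<and> z v = 0} \<noteq> {}" using Suc.hyps(2) by (metis card.empty nat.distinct(1))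
  then obtain x where x: "x < n" "z x = 0" by blast
  define c where "c = (LEAST c. 0 < c \<and> (\<forall>u<n. adj u x \<longrightarrow> z u \<noteq> c))"
  \<comment> \<open>Color \<open>Suc k\<close> is free because \<open>z\<close> does not exceed
    \<open>k\<close>. Hence a least free color exists, and either it is an old color or it is
    \<open>Suc k\<close>.\<close>
  have "0 < Suc k \<and> (\<forall>u<n. adj u x \<longrightarrow> z u \<noteq> Suc k)" using w(1) by fastforce
  then have c: "0 < c \<and> (\<forall>u<n. adj u x \<longrightarrow> z u \<noteq> c)" "c \<le> Suc k"
    unfolding c_def by (rule LeastI, rule Least_le)
  have below: "\<exists>u<n. adj u x \<and> z u = j" if "j \<in> {1..<c}" for j
    using not_less_Least[of j "\<lambda>c. 0 < c \<and> (\<forall>u<n. adj u x \<longrightarrow> z u \<noteq> c)"] that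
    unfolding c_def[symmetric] by auto
  define z' where "z' = z(x := c)"
  have eq: "z' v = z v" if "z v \<noteq> 0" for v using that x by (auto simp: z'_def)
  have proper: "z' u \<noteq> z' v" if "u < n" "v < n" "adj u v" "z' u \<noteq> 0" for u v
    using that c(1) w(2)[of u v] w(2)[of v u] irr sym unfolding z'_def
    by (auto split: if_splits)
  have chk: "grundy_check n adj k z'" using grundy_check_mono[OF w(3)] eq by blast
  have "{v. v < n \<and> z v = 0} = insert x {v. v < n \<and> z' v = 0}" "x \<notin> {v. v < n \<and> z' v = 0}"
    using x c(1) by (auto simp: z'_def)
  then have m: "m = card {v. v < n \<and> z' v = 0}" using Suc.hyps(2) by simp
  show ?case
  proof (cases "c \<le> k")
    case True
    then have "witness n adj k z'" using w(1) proper chk by (auto simp: witness_def z'_def)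
    from Suc.hyps(1)[OF m this] show ?thesis .
  next
    case False
    then have ck: "c = Suc k" using c by simp
    have "grundy_check n adj (Suc k) z'"
      unfolding grundy_check_def
    proof
      fix i assume i: "i \<in> {1..Suc k}"
      show "\<exists>v<n. z' v = i \<and> (\<forall>j \<in> {1..<i}. \<exists>u<n. adj u v \<and> z' u = j)"
      proof (cases "i = Suc k")
        case True
        have "\<exists>u<n. adj u x \<and> z' u = j" if "j \<in> {1..<i}" for j
        proof -
          from that True ck have "j \<in> {1..<c}" by simp
          from below[OF this] obtain u where "u < n" "adj u x" "z u = j" by blast
          then show ?thesis using eq[of u] that by auto
        qed
        then show ?thesis using x True ck by (auto simp: z'_def)
      next
        case False
        then show ?thesis using chk i unfolding grundy_check_def by simp
      qed
    qed
    then have "witness n adj (Suc k) z'" using w(1) proper ck by (auto simp: witness_def z'_def le_SucI)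
    from Suc.hyps(1)[OF m this] show ?thesis using Suc_leD by blast
  qed
qed

text \<open>For each color \<open>i \<le> k\<close> keep one vertex \<open>f i\<close> and, for each
  smaller color \<open>j\<close>, one neighbor \<open>g i j\<close> of color \<open>j\<close>;
  uncolor all others.\<close>

lemma witness_shrink:
  assumes G: "verts G = {..<n}" "\<And>u v. adj u v \<longleftrightarrow> {u, v} \<in> edges G"
    and c: "partial_grundy_coloring G k' c" and "k \<le> k'"
  obtains z where "witness n adj k z" "\<And>i. i < k \<Longrightarrow> card {v. v < n \<and> z v = Suc i} \<le> k - i"
proof -
  have proper: "\<And>u v. u < n \<Longrightarrow> v < n \<Longrightarrow> adj u v \<Longrightarrow> c u \<noteq> c v"
    and "\<And>i. i \<in> {1..k'} \<Longrightarrow> \<exists>v<n. c v = i \<and> (\<forall>j \<in> {1..<i}. \<exists>u<n. adj u v \<and> c u = j)"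
    using c unfolding partial_grundy_coloring_def G by (auto simp: Bex_def)
  moreover have "{1..k} \<subseteq> {1..k'}" using \<open>k \<le> k'\<close> by auto
  ultimately have "\<forall>i. \<exists>v. i \<in> {1..k} \<longrightarrow> v < n \<and> c v = i \<and> (\<forall>j \<in> {1..<i}. \<exists>u<n. adj u v \<and> c u = j)"
    by blast
  then obtain f where f: "\<And>i. i \<in> {1..k} \<Longrightarrow> f i < n \<and> c (f i) = i \<and> (\<forall>j \<in> {1..<i}. \<exists>u<n. adj u (f i) \<and> c u = j)"
    by metis
  have "\<forall>i j. \<exists>u. i \<in> {1..k} \<longrightarrow> j \<in> {1..<i} \<longrightarrow> u < n \<and> adj u (f i) \<and> c u = j"
    using f by blast
  then obtain g where g: "\<And>i j. i \<in> {1..k} \<Longrightarrow> j \<in> {1..<i} \<Longrightarrow> g i j < n \<and> adj (g i j) (f i) \<and> c (g i j) = j"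
    by metis
  define W where "W = f ` {1..k} \<union> (\<Union>i\<in>{1..k}. g i ` {1..<i})"
  define z where "z v = (if v \<in> W then c v else 0)" for v
  have zW: "z v \<noteq> 0 \<Longrightarrow> v \<in> W \<and> z v = c v" for v by (auto simp: z_def split: if_splits)
  have zf: "z (f i) = i" if "i \<in> {1..k}" for i
    using f[OF that] that unfolding z_def W_def by simp
  have zg: "z (g i j) = j" if "i \<in> {1..k}" "j \<in> {1..<i}" for i j
  proof -
    have "g i j \<in> W" unfolding W_def using that by blast
    then show ?thesis using g[OF that] by (simp add: z_def)
  qed
  have W: "(\<exists>i\<in>{1..k}. v = f i) \<or> (\<exists>i\<in>{1..k}. \<exists>j\<in>{1..<i}. v = g i j)" if "v \<in> W" for v
    using that unfolding W_def by blast
  have le: "z v \<le> k" for v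
  proof (cases "v \<in> W")
    case True
    from W[OF this] show ?thesis using zf zg by auto
  qed (simp add: z_def)
  have "witness n adj k z"
    unfolding witness_def
  proof (intro conjI allI impI)
    fix u v assume "u < n" "v < n" "adj u v" "z u \<noteq> 0"
    then show "z u \<noteq> z v"
      using zW[of u] zW[of v] proper[of u v] by metis
  next
    show "grundy_check n adj k z"
      unfolding grundy_check_def using f g zf zg by blast
  qed (rule le)
  moreover have "card {v. v < n \<and> z v = Suc i} \<le> k - i" if i: "i < k" for i
  proof -
    \<comment> \<open>Color \<open>Suc i\<close> occurs at its own vertex and once for each of the
      \<open>k - Suc i\<close> larger colors.\<close>
    have sub: "{v. v < n \<and> z v = Suc i} \<subseteq> insert (f (Suc i)) ((\<lambda>i'. g i' (Suc i)) ` {Suc i<..k})"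
    proof
      fix v assume "v \<in> {v. v < n \<and> z v = Suc i}"
      then have "v \<in> W" "c v = Suc i" using zW[of v] by auto
      from W[OF this(1)] this(2) show "v \<in> insert (f (Suc i)) ((\<lambda>i'. g i' (Suc i)) ` {Suc i<..k})"
        using f g by auto
    qed
    have "card {v. v < n \<and> z v = Suc i} \<le> card (insert (f (Suc i)) ((\<lambda>i'. g i' (Suc i)) ` {Suc i<..k}))"
      by (rule card_mono[OF _ sub]) simp
    also have "\<dots> \<le> Suc (card ((\<lambda>i'. g i' (Suc i)) ` {Suc i<..k}))" by (rule card_insert_le_m1) auto
    also have "\<dots> \<le> Suc (card {Suc i<..k})" by (intro Suc_le_mono[THEN iffD2] card_image_le) simp
    also have "\<dots> = k - i" using i by simp
    finally show ?thesis .
  qed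
  ultimately show thesis by (rule that)
qed

section \<open>Making colorings proper along a rank order\<close>

text \<open>Uncoloring all vertices with an equally colored neighbor of larger rank makes any coloring proper.\<close>
definition unblocked :: "nat \<Rightarrow> (nat \<Rightarrow> nat \<Rightarrow> bool) \<Rightarrow> (nat \<Rightarrow> nat) \<Rightarrow> (nat \<Rightarrow> nat) \<Rightarrow> nat \<Rightarrow> nat" where
  "unblocked n adj rk c v = (if \<exists>w<n. adj v w \<and> rk v < rk w \<and> c w = c v then 0 else c v)"

lemma unblocked_cong:
  "(\<And>v. v < n \<Longrightarrow> c v = c' v) \<Longrightarrow> v < n \<Longrightarrow> unblocked n adj rk c v = unblocked n adj rk c' v"
  by (auto simp: unblocked_def)

text \<open>Ranks are distinct, so of two equally colored neighbors the one of smaller rank is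
  uncolored.\<close>

lemma witness_unblocked:
  assumes "\<And>u v. adj u v \<Longrightarrow> adj v u" "\<And>u. \<not> adj u u" "inj_on rk {..<n}"
    and "\<And>v. v < n \<Longrightarrow> c v \<le> k" "grundy_check n adj k (unblocked n adj rk c)"
  shows "witness n adj k (unblocked n adj rk c)"
  unfolding witness_def
proof (intro conjI allI impI)
  fix u v assume uv: "u < n" "v < n" "adj u v" "unblocked n adj rk c u \<noteq> 0"
  show "unblocked n adj rk c u \<noteq> unblocked n adj rk c v"
  proof
    assume eq: "unblocked n adj rk c u = unblocked n adj rk c v"
    then have "unblocked n adj rk c u = c u" "unblocked n adj rk c v = c v"
      using uv(4) by (auto simp: unblocked_def split: if_splits)
    then have cuv: "c u = c v" using eq by simp
    have "rk u \<noteq> rk v" using uv assms(2,3) by (metis inj_onD lessThan_iff)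
    then consider "rk u < rk v" | "rk v < rk u" by linarith
    then have "unblocked n adj rk c u = 0 \<or> unblocked n adj rk c v = 0"
    proof cases
      case 1
      then have "\<exists>w<n. adj u w \<and> rk u < rk w \<and> c w = c u" using uv cuv by auto
      then show ?thesis by (simp add: unblocked_def)
    next
      case 2
      then have "\<exists>w<n. adj v w \<and> rk v < rk w \<and> c w = c v" using uv cuv assms(1) by auto
      then show ?thesis by (simp add: unblocked_def)
    qed
    then show False using eq uv(4) by auto
  qed
qed (use assms in \<open>auto simp: unblocked_def\<close>)

text \<open>The vertices of the witness keep their colors: no neighbor of larger rank shares them,
  so none of these vertices is uncolored.\<close>

lemma grundy_check_unblocked:
  assumes w: "witness n adj k z"
    and c: "\<And>v. v < n \<Longrightarrow> z v \<noteq> 0 \<Longrightarrow> c v = z v"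
    and sep: "\<And>v w. v < n \<Longrightarrow> w < n \<Longrightarrow> z v \<noteq> 0 \<Longrightarrow> adj v w \<Longrightarrow> rk v < rk w \<Longrightarrow> c w \<noteq> z v"
  shows "grundy_check n adj k (unblocked n adj rk c)"
proof (rule grundy_check_mono)
  show "grundy_check n adj k z" using w by (simp add: witness_def)
  fix v assume "v < n" "z v \<noteq> 0"
  then have "\<not> (\<exists>w<n. adj v w \<and> rk v < rk w \<and> c w = c v)" "c v = z v" using c sep by auto
  then show "unblocked n adj rk c v = z v" unfolding unblocked_def by (simp only: if_False)
qed

text \<open>Degeneracy is applied to the subgraph of \<open>G - F\<close> induced by
  \<open>U\<close>; edges at \<open>v\<close> are turned into neighbors, which is what the program
  counts.\<close>

lemma degenerate_low_degree:
  fixes G :: "nat ugraph"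
  assumes "degenerate d (delete_edges G F)" "simple_graph G" "verts G = {..<n}" "U \<subseteq> {..<n}" "U \<noteq> {}"
  shows "\<exists>v \<in> U. card {w \<in> U. {v, w} \<in> edges G - F} \<le> d"
proof -
  define H where "H = \<lparr>verts = U, edges = {e \<in> edges G - F. e \<subseteq> U}\<rparr>"
  have U: "finite U" using finite_subset[OF assms(4)] by simp
  have "subgraph H (delete_edges G F)"
    using assms(2-4) U unfolding subgraph_def simple_graph_def H_def delete_edges_def by auto
  moreover have "verts H = U" by (simp add: H_def)
  ultimately obtain v where v: "v \<in> U" "degree H v \<le> d"
    using assms(1,5) unfolding degenerate_def by blast
  have "(\<lambda>w. {v, w}) ` {w \<in> U. {v, w} \<in> edges G - F} \<subseteq> {e \<in> edges H. v \<in> e}"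
    using v by (auto simp: H_def)
  moreover have "finite {e \<in> edges H. v \<in> e}"
    by (rule finite_subset[of _ "Pow U"]) (use U in \<open>auto simp: H_def\<close>)
  moreover have "inj_on (\<lambda>w. {v, w}) {w \<in> U. {v, w} \<in> edges G - F}"
    by (auto simp: inj_on_def doubleton_eq_iff)
  ultimately have "card {w \<in> U. {v, w} \<in> edges G - F} \<le> degree H v"
    unfolding degree_def by (metis (lifting) card_image card_mono)
  then show ?thesis using v by (meson le_trans)
qed

section \<open>Sides of a biclique\<close>

lemma biclique_edge_iff:
  assumes "edges A = {{u, v} | u v. u \<in> L \<and> v \<in> R}"
  shows "{u, v} \<in> edges A \<longleftrightarrow> u \<in> L \<and> v \<in> R \<or> u \<in> R \<and> v \<in> L"
  unfolding assms by (auto simp: doubleton_eq_iff)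

text \<open>A single edge represents the biclique: the neighborhoods of its endpoints
  \<open>s\<close> and \<open>r\<close> in \<open>A\<close> are the two sides. Every edge meets both
  sides, and vertices from different sides are adjacent.\<close>

lemma biclique_edges:
  assumes "biclique A" "{s, r} \<in> edges A"
  shows biclique_join: "{s, u} \<in> edges A \<Longrightarrow> {r, v} \<in> edges A \<Longrightarrow> {u, v} \<in> edges A"
    and biclique_cover_left: "{u, v} \<in> edges A \<Longrightarrow> {s, u} \<in> edges A \<or> {s, v} \<in> edges A"
    and biclique_cover_right: "{u, v} \<in> edges A \<Longrightarrow> {r, u} \<in> edges A \<or> {r, v} \<in> edges A"
proof -
  from assms(1) obtain L R where LR: "L \<inter> R = {}" "edges A = {{u, v} | u v. u \<in> L \<and> v \<in> R}"
    unfolding biclique_def by (elim exE conjE)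
  note iff = biclique_edge_iff[OF LR(2)]
  have sr: "s \<in> L \<and> r \<in> R \<or> s \<in> R \<and> r \<in> L" using assms(2) by (simp add: iff)
  show "{s, u} \<in> edges A \<Longrightarrow> {r, v} \<in> edges A \<Longrightarrow> {u, v} \<in> edges A"
    using sr LR(1) by (auto simp: iff)
  show "{u, v} \<in> edges A \<Longrightarrow> {s, u} \<in> edges A \<or> {s, v} \<in> edges A"
    using sr LR(1) by (auto simp: iff)
  show "{u, v} \<in> edges A \<Longrightarrow> {r, u} \<in> edges A \<or> {r, v} \<in> edges A"
    using sr LR(1) by (auto simp: iff)
qed

section \<open>Colorings encoded by guesses\<close>

text \<open>Each color is separated from at most \<open>k d + k\<^sup>2\<close> vertices, in at most \<open>2 d k\<^sup>3\<close> pairs; as each pair excludes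
  a fraction \<open>5 / M\<close> of the multipliers, range \<open>13 d k\<^sup>3\<close> suffices for one color and \<open>13 d k\<^sup>4\<close> for all.\<close>
definition block_size :: "nat \<Rightarrow> nat \<Rightarrow> nat" where
  "block_size d k = 13 * d * k * k"

definition inner_range :: "nat \<Rightarrow> nat \<Rightarrow> nat" where
  "inner_range d k = k * block_size d k"

definition outer_range :: "nat \<Rightarrow> nat \<Rightarrow> nat" where
  "outer_range d k = k * inner_range d k"

text \<open>Every color owns a segment of \<open>inner_range d k\<close> cells. The global hash
  first makes the arguments independent of \<open>n\<close>, so the \<open>k\<close> multipliers
  \<open>a i\<close> range over sets of size polynomial in \<open>d\<close> and \<open>k\<close>;
  only \<open>a0\<close> costs a factor \<open>n\<close>.\<close>

definition color_hash :: "nat \<Rightarrow> nat \<Rightarrow> nat \<Rightarrow> nat \<Rightarrow> (nat \<Rightarrow> nat) \<Rightarrow> nat \<Rightarrow> nat \<Rightarrow> nat" where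
  "color_hash n d k a0 a i v = i * inner_range d k +
     mhash (inner_range d k) (outer_range d k) (a i) (mhash (outer_range d k) n a0 v)"

text \<open>\<open>ep (2 * t)\<close> and \<open>ep (2 * t + 1)\<close> are the ends of an edge of
  biclique \<open>t\<close>. The bit \<open>g (t * k + i)\<close> selects one of them, and its
  neighbors, one side of the biclique, are closed to color \<open>i\<close>.\<close>

definition hashed_coloring :: "nat \<Rightarrow> nat \<Rightarrow> nat \<Rightarrow> nat \<Rightarrow> (nat \<Rightarrow> nat \<Rightarrow> nat \<Rightarrow> bool) \<Rightarrow> (nat \<Rightarrow> nat) \<Rightarrow>
    nat \<Rightarrow> (nat \<Rightarrow> nat) \<Rightarrow> (nat \<Rightarrow> nat) \<Rightarrow> nat set \<Rightarrow> nat \<Rightarrow> nat" where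
  "hashed_coloring n d k l A ep a0 a g S v =
     pick (\<lambda>i. color_hash n d k a0 a i v \<in> S \<and> (\<forall>t<l. \<not> A t (ep (2 * t + g (t * k + i))) v)) k"

text \<open>The fields of a guess from low to high: the global multiplier, \<open>k\<close>
  multipliers in base \<open>W1\<close>, \<open>l * k\<close> side bits, and the code of the marked
  cells.\<close>

definition decoded_coloring :: "nat \<Rightarrow> nat \<Rightarrow> nat \<Rightarrow> nat \<Rightarrow> (nat \<Rightarrow> nat \<Rightarrow> nat \<Rightarrow> bool) \<Rightarrow> (nat \<Rightarrow> nat) \<Rightarrow>
    nat \<Rightarrow> nat \<Rightarrow> nat" where
  "decoded_coloring n d k l A ep e =
     (let W0 = outer_range d k * n; W1 = inner_range d k * outer_range d k;
          e1 = e div W0; e2 = e1 div W1 ^ k; e3 = e2 div 2 ^ (l * k)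
      in hashed_coloring n d k l A ep (e mod W0) (\<lambda>i. e1 div W1 ^ i mod W1) (\<lambda>z. e2 div 2 ^ z mod 2)
           (decode_marks (block_size d k) (2 * k * k) e3 0))"

definition num_guesses :: "nat \<Rightarrow> nat \<Rightarrow> nat \<Rightarrow> nat \<Rightarrow> nat" where
  "num_guesses n d k l = (outer_range d k * n) * (inner_range d k * outer_range d k) ^ k * 2 ^ (l * k) *
     2 ^ (2 * k * k) * block_size d k ^ (k * Suc k div 2)"

lemma decoded_coloring_le: "decoded_coloring n d k l A ep e v \<le> k"
  by (simp add: decoded_coloring_def hashed_coloring_def Let_def pick_le)

text \<open>The guess is assembled from its highest field \<open>e3\<close> down to
  \<open>a0\<close>; the bound of each field multiplies the bound reached so far, which gives
  \<open>num_guesses\<close>.\<close>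

lemma decoded_coloring_onto:
  assumes "0 < n" "0 < d" "0 < k"
    and a0: "a0 < outer_range d k * n" and a: "\<And>i. i < k \<Longrightarrow> a i < inner_range d k * outer_range d k"
    and g: "\<And>z. g z < (2::nat)" and S: "S \<subseteq> {..<k * inner_range d k}" "card S \<le> k * Suc k div 2"
  obtains e where "e < num_guesses n d k l"
    "\<And>v. decoded_coloring n d k l A ep e v = hashed_coloring n d k l A ep a0 a g S v"
proof -
  define m where "m = block_size d k"
  define W0 where "W0 = outer_range d k * n"
  define W1 where "W1 = inner_range d k * outer_range d k"
  have m: "0 < m" using assms by (simp add: m_def block_size_def)
  \<comment> \<open>There are \<open>k * k\<close> blocks and at most \<open>k * k\<close> marks, so
    \<open>2 * k * k\<close> bits suffice.\<close>
  have qk: "k * Suc k div 2 \<le> k * k" using \<open>0 < k\<close> by (induction k) auto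
  have "S \<subseteq> {0 * m..<(0 + k * k) * m}" using S(1) by (auto simp: m_def inner_range_def mult.assoc)
  moreover have "k * k + card S \<le> 2 * k * k" using S(2) qk by linarith
  ultimately obtain e3 where e3: "e3 < 2 ^ (2 * k * k) * m ^ card S" "decode_marks m (2 * k * k) e3 0 = S"
    using decode_marks_onto m by blast
  have "m ^ card S \<le> m ^ (k * Suc k div 2)" using S(2) m by (intro power_increasing) auto
  then have b3: "Suc e3 \<le> 2 ^ (2 * k * k) * m ^ (k * Suc k div 2)"
    using e3(1) by (meson Suc_leI le_trans mult_le_mono2 order_less_le_trans)
  obtain e2 where e2: "e2 < 2 ^ (l * k) * Suc e3" "\<And>z. z < l * k \<Longrightarrow> e2 div 2 ^ z mod 2 = g z"
    "e2 div 2 ^ (l * k) = e3"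
    using digits_exist[of "l * k" g 2 e3] g by blast
  obtain e1 where e1: "e1 < W1 ^ k * Suc e2" "\<And>i. i < k \<Longrightarrow> e1 div W1 ^ i mod W1 = a i" "e1 div W1 ^ k = e2"
    using digits_exist[of k a W1 e2] a unfolding W1_def by blast
  define e where "e = a0 + W0 * e1"
  have "a0 < W0" using a0 by (simp add: W0_def)
  then have e: "e mod W0 = a0" "e div W0 = e1" by (simp_all add: e_def)
  have "e < W0 * Suc e1" using a0 by (simp add: e_def W0_def)
  also have "\<dots> \<le> W0 * (W1 ^ k * Suc e2)" using e1(1) by (intro mult_le_mono2) simp
  also have "\<dots> \<le> W0 * (W1 ^ k * (2 ^ (l * k) * Suc e3))" using e2(1) by (intro mult_le_mono2) simp
  also have "\<dots> \<le> W0 * (W1 ^ k * (2 ^ (l * k) * (2 ^ (2 * k * k) * m ^ (k * Suc k div 2))))"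
    using b3 by (intro mult_le_mono2)
  finally have "e < num_guesses n d k l" by (simp only: num_guesses_def W0_def W1_def m_def mult.assoc)
  moreover have "decoded_coloring n d k l A ep e v = hashed_coloring n d k l A ep a0 a g S v" for v
  proof -
    have ix: "t * k + i < l * k" if "t < l" "i < k" for t i
      using that by (metis add.commute mult_Suc Suc_leI mult_le_mono1 nat_add_left_cancel_less order_less_le_trans)
    have "decoded_coloring n d k l A ep e v = hashed_coloring n d k l A ep a0 (\<lambda>i. e1 div W1 ^ i mod W1)
       (\<lambda>z. e2 div 2 ^ z mod 2) S v"
      using e e1(3) e2(3) e3(2) by (simp add: decoded_coloring_def Let_def W0_def W1_def m_def)
    also have "\<dots> = hashed_coloring n d k l A ep a0 a g S v"
      unfolding hashed_coloring_def color_hash_def using e1(2) e2(2) ix by (intro pick_cong) auto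
    finally show ?thesis .
  qed
  ultimately show thesis by (rule that)
qed

lemma sum_diff_lessThan: "(\<Sum>i<k. k - i) = k * Suc k div (2::nat)"
proof -
  have "(\<Sum>i<k. k - i) = (\<Sum>i<k. Suc i)"
    by (rule sum.reindex_bij_witness[of _ "\<lambda>i. k - Suc i" "\<lambda>i. k - Suc i"]) auto
  also have "\<dots> = k * Suc k div 2" by (induction k) auto
  finally show ?thesis .
qed

text \<open>\<open>X i\<close> is the color class and \<open>Y i\<close> the set it has to be
  separated from: its later neighbors in \<open>H\<close> and the other classes. A later neighbor
  that still receives color \<open>i\<close> lies on open sides only, so its edge to
  \<open>X i\<close> is in no biclique; then it belongs to \<open>Y i\<close>, contradicting the
  separation.\<close>

lemma hashed_coloring_complete:
  assumes pos: "0 < n" "0 < d" "0 < k"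
    and H: "\<And>v w. v < n \<Longrightarrow> w < n \<Longrightarrow> H v w \<longleftrightarrow> adj v w \<and> (\<forall>t<l. \<not> A t v w)"
    and sub: "\<And>t u v. t < l \<Longrightarrow> A t u v \<Longrightarrow> adj u v"
    and join: "\<And>t u v. t < l \<Longrightarrow> A t (ep (2 * t)) u \<Longrightarrow> A t (ep (2 * t + 1)) v \<Longrightarrow> A t u v"
    and cover: "\<And>t b u v. t < l \<Longrightarrow> b < 2 \<Longrightarrow> A t u v \<Longrightarrow> A t (ep (2 * t + b)) u \<or> A t (ep (2 * t + b)) v"
    and deg: "\<And>v. v < n \<Longrightarrow> card {w. w < n \<and> H v w \<and> rk v < rk w} \<le> d"
    and wit: "witness n adj k z" and card_z: "\<And>i. i < k \<Longrightarrow> card {v. v < n \<and> z v = Suc i} \<le> k - i"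
  obtains a0 a g S where "a0 < outer_range d k * n" "\<And>i. i < k \<Longrightarrow> a i < inner_range d k * outer_range d k"
    "\<And>y. g y < (2::nat)" "S \<subseteq> {..<k * inner_range d k}" "card S \<le> k * Suc k div 2"
    "grundy_check n adj k (unblocked n adj rk (hashed_coloring n d k l A ep a0 a g S))"
proof -
  define M1 where "M1 = inner_range d k"
  define M0 where "M0 = outer_range d k"
  have Mpos: "0 < M1" "0 < M0" using pos by (auto simp: M1_def M0_def inner_range_def outer_range_def block_size_def)
  have zk: "\<And>v. v < n \<Longrightarrow> z v \<le> k"
    and proper: "\<And>u v. u < n \<Longrightarrow> v < n \<Longrightarrow> adj u v \<Longrightarrow> z u \<noteq> 0 \<Longrightarrow> z u \<noteq> z v"
    using wit by (auto simp: witness_def)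
  define X where "X i = {v. v < n \<and> z v = Suc i}" for i
  define N where "N i = (\<Union>v\<in>X i. {w. w < n \<and> H v w \<and> rk v < rk w})" for i
  define Y where "Y i = N i \<union> (\<Union>j\<in>{..<k} - {i}. X j)" for i
  have finX: "finite (X i)" for i by (simp add: X_def)
  have cX: "card (X i) \<le> k - i" if "i < k" for i using card_z[OF that] by (simp add: X_def)
  have cX': "card (X i) \<le> k" if "i < k" for i using cX[OF that] by simp
  have finY: "finite (Y i)" for i by (auto simp: Y_def N_def X_def)
  have cY: "card (Y i) \<le> k * d + k * k" if i: "i < k" for i
  proof -
    have "card (N i) \<le> (\<Sum>v\<in>X i. card {w. w < n \<and> H v w \<and> rk v < rk w})"
      unfolding N_def by (rule card_UN_le[OF finX])
    also have "\<dots> \<le> (\<Sum>v\<in>X i. d)" using deg by (intro sum_mono) (auto simp: X_def)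
    also have "\<dots> \<le> k * d" using cX'[OF i] by simp
    finally have 1: "card (N i) \<le> k * d" .
    have "card (\<Union>j\<in>{..<k} - {i}. X j) \<le> (\<Sum>j\<in>{..<k} - {i}. card (X j))" by (rule card_UN_le) simp
    also have "\<dots> \<le> (\<Sum>j\<in>{..<k} - {i}. k)" using cX' by (intro sum_mono) auto
    also have "\<dots> \<le> k * k" using card_mono[of "{..<k}" "{..<k} - {i}"] by simp
    finally show ?thesis using 1 card_Un_le[of "N i" "\<Union>j\<in>{..<k} - {i}. X j"] unfolding Y_def by linarith
  qed
  define P where "P i = X i \<times> Y i" for i
  have finP: "finite (P i)" for i using finX finY by (simp add: P_def)
  have cP: "card (P i) \<le> 2 * d * k * k * k" if i: "i < k" for i
  proof -
    have "card (P i) \<le> k * (k * d + k * k)"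
      unfolding P_def card_cartesian_product using cX'[OF i] cY[OF i] by (rule mult_le_mono)
    also have "\<dots> \<le> k * (k * (d * k) + k * (d * k))" using pos by (intro mult_le_mono2 add_mono) auto
    finally show ?thesis by (simp add: algebra_simps)
  qed
  \<comment> \<open>Hashing separates distinct numbers only: later neighbors differ from the class
    by properness of \<open>z\<close>, and the other classes by their color.\<close>
  have XY: "x < n \<and> y < n \<and> x \<noteq> y" if "(x, y) \<in> P i" for x y i
  proof -
    have x: "x < n" "z x = Suc i" "y \<in> Y i" using that by (auto simp: P_def X_def)
    then consider v where "v < n" "z v = Suc i" "y < n" "H v y" | j where "j \<noteq> i" "y < n" "z y = Suc j"
      by (auto simp: Y_def N_def X_def)
    then show ?thesis
    proof cases
      case 1
      then have "z v \<noteq> z y" using proper[of v y] H[of v y] by auto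
      then show ?thesis using x 1 by auto
    next
      case 2
      then show ?thesis using x by auto
    qed
  qed
  have dk: "0 < d * k * k * k" using pos by simp
  have "card (\<Union>i<k. P i) \<le> (\<Sum>i<k. card (P i))" by (rule card_UN_le) simp
  also have "\<dots> \<le> (\<Sum>i<k. 2 * d * k * k * k)" using cP by (intro sum_mono) auto
  finally have "card (\<Union>i<k. P i) \<le> k * (2 * d * k * k * k)" by simp
  moreover have "M0 = k * (13 * (d * k * k * k))"
    by (simp add: M0_def outer_range_def inner_range_def block_size_def)
  moreover have "5 * (k * (2 * d * k * k * k)) < k * (13 * (d * k * k * k))" using pos by simp
  \<comment> \<open>One multiplier serves all colors: at most \<open>2 * d * k ^ 4\<close> pairs are
    to be separated, and \<open>5 * 2 < 13\<close>.\<close>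
  ultimately have "5 * card (\<Union>i<k. P i) < M0" by linarith
  then obtain a0 where a0: "a0 < M0 * n" "\<forall>(x, y) \<in> (\<Union>i<k. P i). mhash M0 n a0 x \<noteq> mhash M0 n a0 y"
    using mhash_separates[of "\<Union>i<k. P i" n M0] finP XY pos by blast
  define h0 where "h0 = mhash M0 n a0"
  \<comment> \<open>The images under \<open>h0\<close> are still distinct, so a second hash for each
    color can separate them within the smaller range \<open>M1\<close>.\<close>
  have "\<exists>a < M1 * M0. \<forall>(x, y) \<in> map_prod h0 h0 ` P i. mhash M1 M0 a x \<noteq> mhash M1 M0 a y" if i: "i < k" for i
  proof (rule mhash_separates)
    have "card (map_prod h0 h0 ` P i) \<le> 2 * d * k * k * k" using card_image_le[OF finP, of "map_prod h0 h0" i] cP[OF i] by linarith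
    moreover have "M1 = 13 * (d * k * k * k)" by (simp add: M1_def inner_range_def block_size_def)
    ultimately show "5 * card (map_prod h0 h0 ` P i) < M1" using dk by linarith
    fix x y assume "(x, y) \<in> map_prod h0 h0 ` P i"
    then obtain x' y' where xy: "(x', y') \<in> P i" "x = h0 x'" "y = h0 y'" by auto
    then show "x < M0 \<and> y < M0 \<and> x \<noteq> y" using a0(2) i mhash_less[OF Mpos(2) pos(1)] by (auto simp: h0_def)
  qed (use finP Mpos in auto)
  then obtain a where a': "\<And>i. i < k \<Longrightarrow> a i < M1 * M0 \<and>
      (\<forall>(x, y) \<in> map_prod h0 h0 ` P i. mhash M1 M0 (a i) x \<noteq> mhash M1 M0 (a i) y)"
    by metis
  have a: "\<And>i. i < k \<Longrightarrow> a i < M1 * M0"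
    "\<And>i x y. i < k \<Longrightarrow> (x, y) \<in> P i \<Longrightarrow> mhash M1 M0 (a i) (h0 x) \<noteq> mhash M1 M0 (a i) (h0 y)"
    using a' by fastforce+
  define h where "h i v = mhash M1 M0 (a i) (h0 v)" for i v
  have hM: "h i v < M1" for i v using mhash_less[OF Mpos] by (simp add: h_def)
  define S where "S = (\<Union>i<k. (\<lambda>v. i * M1 + h i v) ` X i)"
  have ch: "color_hash n d k a0 a i v = i * M1 + h i v" for i v
    by (simp add: color_hash_def h_def h0_def M1_def M0_def)
  have Ssub: "S \<subseteq> {..<k * M1}"
  proof
    fix x assume "x \<in> S"
    then obtain i v where "i < k" "x = i * M1 + h i v" by (auto simp: S_def)
    moreover have "i * M1 + h i v < Suc i * M1" using hM by simp
    moreover have "Suc i * M1 \<le> k * M1" using \<open>i < k\<close> by (intro mult_le_mono1) simp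
    ultimately show "x \<in> {..<k * M1}" by simp
  qed
  have "card S \<le> (\<Sum>i<k. card ((\<lambda>v. i * M1 + h i v) ` X i))" unfolding S_def by (rule card_UN_le) simp
  also have "\<dots> \<le> (\<Sum>i<k. k - i)" 
    by (intro sum_mono order_trans[OF card_image_le[OF finX] cX]) simp
  finally have cS: "card S \<le> k * Suc k div 2" by (simp add: sum_diff_lessThan)
  \<comment> \<open>Division by \<open>M1\<close> recovers the segment, so marks seen by color
    \<open>i\<close> stem from \<open>X i\<close> itself.\<close>
  have memS: "\<exists>v\<in>X i. h i w = h i v" if w: "color_hash n d k a0 a i w \<in> S" for i w
  proof -
    obtain j v where j: "v \<in> X j" "i * M1 + h i w = j * M1 + h j v" using w unfolding ch S_def by auto
    have "(i * M1 + h i w) div M1 = i" "(j * M1 + h j v) div M1 = j" using hM Mpos by simp_all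
    then have "i = j" using j(2) by simp
    then show ?thesis using j by auto
  qed
  have notY: "w \<notin> Y i" if "i < k" "color_hash n d k a0 a i w \<in> S" for i w
    using memS[OF that(2)] a(2)[OF that(1), of _ w] unfolding P_def h_def by (metis mem_Sigma_iff)
  \<comment> \<open>If \<open>X i\<close> meets the neighborhood of the first endpoint, the
    neighborhood of the second one is closed, otherwise that of the first. \<open>X i\<close> cannot
    meet both, since \<open>join\<close> would yield an edge within \<open>X i\<close>.\<close>
  define g where "g y = (if \<exists>v \<in> X (y mod k). A (y div k) (ep (2 * (y div k))) v then 1 else 0 :: nat)" for y
  have g2: "g y < 2" for y by (simp add: g_def)
  have free: "\<not> A t (ep (2 * t + g (t * k + i))) v" if t: "t < l" and i: "i < k" and v: "v \<in> X i" for t i v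
  proof
    assume A: "A t (ep (2 * t + g (t * k + i))) v"
    have yd: "(t * k + i) mod k = i" "(t * k + i) div k = t" using i by simp_all
    show False
    proof (cases "\<exists>u \<in> X i. A t (ep (2 * t)) u")
      case True
      then obtain u where u: "u \<in> X i" "A t (ep (2 * t)) u" by blast
      have "g (t * k + i) = 1" using True unfolding g_def yd by simp
      then have "A t u v" using join[OF t u(2)] A by simp
      then show False using proper[of u v] sub[OF t] u v by (auto simp: X_def)
    next
      case False
      then have "g (t * k + i) = 0" unfolding g_def yd by simp
      then show False using False A v by auto
    qed
  qed
  let ?c = "hashed_coloring n d k l A ep a0 a g S"
  have "grundy_check n adj k (unblocked n adj rk ?c)"
  proof (rule grundy_check_unblocked[OF wit])
    fix v assume v: "v < n" "z v \<noteq> 0"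
    then obtain i where i: "z v = Suc i" "i < k" using zk[of v] by (cases "z v") auto
    have vX: "v \<in> X i" using v i by (simp add: X_def)
    have "color_hash n d k a0 a i v \<in> S" unfolding ch S_def using vX i by auto
    \<comment> \<open>Here the other classes in \<open>Y j\<close> matter: \<open>v\<close>
      qualifies for no second color, so \<open>pick\<close> has no choice.\<close>
    moreover have "v \<in> Y j" if "j < k" "j \<noteq> i" for j using vX i that by (auto simp: Y_def)
    ultimately show "?c v = z v"
      unfolding hashed_coloring_def i(1) using i notY[of _ v] free[OF _ i(2) vX]
      by (intro pick_unique) blast+
  next
    fix v w assume v: "v < n" "w < n" "z v \<noteq> 0" and vw: "adj v w" "rk v < rk w"
    obtain i where i: "z v = Suc i" "i < k" using v zk[of v] by (cases "z v") auto
    have vX: "v \<in> X i" using v i by (simp add: X_def)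
    show "?c w \<noteq> z v"
    proof
      assume "?c w = z v"
      then have q: "color_hash n d k a0 a i w \<in> S" "\<And>t. t < l \<Longrightarrow> \<not> A t (ep (2 * t + g (t * k + i))) w"
        using pick_SucD unfolding hashed_coloring_def i(1) by blast+
      \<comment> \<open>An edge of biclique \<open>t\<close> has an end on the closed side, but
        neither \<open>v\<close> nor \<open>w\<close> is there.\<close>
      have "\<not> A t v w" if t: "t < l" for t
        using cover[OF t g2[of "t * k + i"], of v w] q(2)[OF t] free[OF t i(2) vX] by blast
      then have "w \<in> N i" unfolding N_def using H[OF v(1,2)] v vw vX by blast
      then show False using notY[OF i(2) q(1)] by (simp add: Y_def)
    qed
  qed
  then show thesis using that[of a0 a g S] a0(1) a(1) g2 Ssub cS by (simp add: M1_def M0_def)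
qed

section \<open>Colorings given by lists of vertices\<close>

primrec listed_coloring :: "nat \<Rightarrow> (nat \<Rightarrow> nat) \<Rightarrow> nat \<Rightarrow> nat \<Rightarrow> nat" where
  "listed_coloring k f 0 = (\<lambda>_. 0)"
| "listed_coloring k f (Suc p) = (listed_coloring k f p)(f p := Suc (p div k))"

lemma listed_coloring_le: "p \<le> k * k \<Longrightarrow> listed_coloring k f p v \<le> k"
  by (induction p) (auto simp: Suc_le_eq less_mult_imp_div_less)

lemma listed_coloring_cong: "(\<And>q. q < p \<Longrightarrow> f q = g q) \<Longrightarrow> listed_coloring k f p = listed_coloring k g p"
  by (induction p) auto

text \<open>All slots naming \<open>v\<close> agree on its color, so the order of the updates is
  immaterial.\<close>

lemma listed_coloring_eq:
  "(\<And>q. q < p \<Longrightarrow> f q = v \<Longrightarrow> Suc (q div k) = c) \<Longrightarrow>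
    listed_coloring k f p v = (if v \<in> f ` {..<p} then c else 0)"
  by (induction p) (auto simp: lessThan_Suc)

text \<open>Every color owns \<open>k\<close> consecutive slots, and a class with fewer vertices
  repeats one of them. The decoded coloring equals the proper \<open>z\<close>, so nothing is
  uncolored.\<close>

lemma listed_coloring_complete:
  assumes "0 < n" "0 < k"
    and wit: "witness n adj k z" and card_z: "\<And>i. i < k \<Longrightarrow> card {v. v < n \<and> z v = Suc i} \<le> k - i"
  shows "\<exists>e < n ^ (k * k). grundy_check n adj k
    (unblocked n adj rk (listed_coloring k (\<lambda>p. e div n ^ p mod n) (k * k)))"
proof -
  define X where "X i = {v. v < n \<and> z v = Suc i}" for i
  have "\<exists>f. f ` {..<k} = X i" if i: "i < k" for i
  proof -
    have fin: "finite (X i)" by (simp add: X_def)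
    have "card (X i) \<le> k" using card_z[OF i] by (simp add: X_def)
    obtain h where h: "bij_betw h {0..<card (X i)} (X i)" using ex_bij_betw_nat_finite[OF fin] by blast
    \<comment> \<open>The class is nonempty, which supplies the filler \<open>v\<close> for the
      slots left over.\<close>
    have "Suc i \<in> {1..k}" using i by simp
    then obtain v where v: "v \<in> X i" using wit unfolding witness_def grundy_check_def X_def by blast
    have "(\<lambda>j. if j < card (X i) then h j else v) ` {..<k} = X i"
    proof
      show "(\<lambda>j. if j < card (X i) then h j else v) ` {..<k} \<subseteq> X i"
        using v h by (auto simp: bij_betw_def)
      show "X i \<subseteq> (\<lambda>j. if j < card (X i) then h j else v) ` {..<k}"
      proof
        fix x assume "x \<in> X i"
        then have "x \<in> h ` {0..<card (X i)}" using h by (simp add: bij_betw_def)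
        then obtain j where "j < card (X i)" "x = h j" by auto
        then show "x \<in> (\<lambda>j. if j < card (X i) then h j else v) ` {..<k}"
          using \<open>card (X i) \<le> k\<close> by (intro image_eqI[of _ _ j]) auto
      qed
    qed
    then show ?thesis by blast
  qed
  then obtain f where f: "\<And>i. i < k \<Longrightarrow> f i ` {..<k} = X i" by metis
  define F where "F p = f (p div k) (p mod k)" for p
  have FX: "F p \<in> X (p div k)" if "p < k * k" for p
    using f[of "p div k"] that \<open>0 < k\<close> by (auto simp: F_def less_mult_imp_div_less)
  then have "F p < n" if "p < k * k" for p using that by (auto simp: X_def)
  then obtain e where e: "e < n ^ (k * k) * Suc 0" "\<forall>p<k * k. e div n ^ p mod n = F p"
    using digits_exist[of "k * k" F n 0] by blast
  let ?c = "listed_coloring k (\<lambda>p. e div n ^ p mod n) (k * k)"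
  have c: "?c v = z v" if v: "v < n" for v
  proof -
    have "?c v = listed_coloring k F (k * k) v" using e(2) by (subst listed_coloring_cong[of _ _ F]) auto
    also have "\<dots> = (if v \<in> F ` {..<k * k} then z v else 0)"
      using FX by (intro listed_coloring_eq) (auto simp: X_def)
    also have "\<dots> = z v"
    proof (cases "z v")
      case (Suc i)
      have i: "i < k" using wit v Suc unfolding witness_def by force
      have "v \<in> X i" using v Suc by (simp add: X_def)
      then obtain j where j: "j < k" "v = f i j" using f[OF i] by auto
      have "i * k + j < Suc i * k" using j by simp
      also have "\<dots> \<le> k * k" using i by (intro mult_le_mono1) simp
      finally have "i * k + j < k * k" .
      moreover have "F (i * k + j) = v" using j by (simp add: F_def)
      ultimately show ?thesis by auto
    qed simp
    finally show ?thesis .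
  qed
  have "grundy_check n adj k (unblocked n adj rk ?c)"
  proof (rule grundy_check_unblocked[OF wit])
    fix v w assume "v < n" "w < n" "z v \<noteq> 0" "adj v w"
    then show "?c w \<noteq> z v" using wit c[of w] unfolding witness_def by metis
  qed (rule c)
  then show ?thesis using e(1) by auto
qed

section \<open>The program\<close>

text \<open>Array 0 holds \<open>k\<close>, \<open>d\<close>, \<open>l\<close>, \<open>n\<close>, followed from address 4 on by the adjacency matrices of the graph and of the
  bicliques. The arrays from 30 on are loop counters.\<close>
abbreviation (input) "eK \<equiv> Read 0 (Const 0)"
abbreviation (input) "eD \<equiv> Read 0 (Const 1)"
abbreviation (input) "eL \<equiv> Read 0 (Const 2)"
abbreviation (input) "eN \<equiv> Read 0 (Const 3)"
abbreviation (input) "eG p \<equiv> Read 0 (Add (Const 4) p)"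
abbreviation (input) "eA t p \<equiv> Read 0 (Add (Const 4) (Add (Mul (Mul eN eN) (Add t (Const 1))) p))"
abbreviation (input) "eBlock \<equiv> Mul (Mul (Mul (Const 13) eD) eK) eK"
abbreviation (input) "eInner \<equiv> Mul eK eBlock"
abbreviation (input) "eOuter \<equiv> Mul eK eInner"
abbreviation (input) "eW0 \<equiv> Mul eOuter eN"
abbreviation (input) "eW1 \<equiv> Mul eInner eOuter"

abbreviation (input) "vH \<equiv> 2 :: nat"
abbreviation (input) "vRank \<equiv> 3 :: nat"
abbreviation (input) "vEnd \<equiv> 4 :: nat"
abbreviation (input) "vCol \<equiv> 5 :: nat"
abbreviation (input) "vZ \<equiv> 6 :: nat"
abbreviation (input) "vMul \<equiv> 7 :: nat"
abbreviation (input) "vBit \<equiv> 8 :: nat"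
abbreviation (input) "vMark \<equiv> 9 :: nat"
abbreviation (input) "vX \<equiv> 10 :: nat"
abbreviation (input) "vE \<equiv> 11 :: nat"
abbreviation (input) "vMode \<equiv> 12 :: nat"
abbreviation (input) "vP \<equiv> 13 :: nat"
abbreviation (input) "vQ \<equiv> 14 :: nat"
abbreviation (input) "vBest \<equiv> 15 :: nat"
abbreviation (input) "vDeg \<equiv> 16 :: nat"
abbreviation (input) "vPos \<equiv> 17 :: nat"
abbreviation (input) "vY \<equiv> 18 :: nat"
abbreviation (input) "vOk \<equiv> 19 :: nat"
abbreviation (input) "vFound \<equiv> 20 :: nat"
abbreviation (input) "vAll \<equiv> 21 :: nat"
abbreviation (input) "vEx \<equiv> 22 :: nat"
abbreviation (input) "vHash \<equiv> 23 :: nat"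
abbreviation (input) "vA0 \<equiv> 24 :: nat"

section \<open>Difference graph, degeneracy order and representative edges\<close>

definition diff_entry :: com where
  "diff_entry = For 31 eL (Write vH (Var 30) (Sub (Read vH (Var 30)) (eA (Var 31) (Var 30))))"

definition diff_prog :: com where
  "diff_prog = For 30 (Mul eN eN) (Seq (Write vH (Var 30) (eG (Var 30))) diff_entry)"

definition degree_prog :: com where
  "degree_prog = For 33 eN (If (Read vRank (Var 33)) Skip
     (Set vDeg (Add (Var vDeg) (Read vH (Add (Mul (Var 32) eN) (Var 33))))))"

definition best_prog :: com where
  "best_prog = For 32 eN (If (Read vRank (Var 32)) Skip
     (Seq (Set vDeg (Const 0)) (Seq degree_prog (If (Sub (Var vDeg) eD) Skip (Set vBest (Var 32))))))"

text \<open>Each round removes a vertex with at most \<open>d\<close> remaining neighbors. Ranks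
  start at 1 because 0 marks the vertices that are still present.\<close>

definition rank_prog :: com where
  "rank_prog = For 34 eN (Seq best_prog (Write vRank (Var vBest) (Add (Var 34) (Const 1))))"

text \<open>Any edge may represent the biclique; the scan keeps the last one and splits its matrix
  position into row and column.\<close>

definition edge_entry :: com where
  "edge_entry = For 36 (Mul eN eN) (If (eA (Var 35) (Var 36))
     (Seq (Write vEnd (Mul (Const 2) (Var 35)) (Div (Var 36) eN))
          (Write vEnd (Add (Mul (Const 2) (Var 35)) (Const 1)) (Mod (Var 36) eN))) Skip)"

definition edge_prog :: com where
  "edge_prog = For 35 eL edge_entry"

section \<open>Choice of the mode and number of guesses\<close>

definition pow_prog :: "nat \<Rightarrow> exp \<Rightarrow> exp \<Rightarrow> com" where
  "pow_prog x N r = For 37 N (Set x (Mul (Var x) r))"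

text \<open>By truncation, \<open>2 ^ l + 1 - n ^ (2 * k)\<close> is nonzero iff
  \<open>n ^ (2 * k) \<le> 2 ^ l\<close>; in that case the classes are listed directly.\<close>

definition limit_prog :: com where
  "limit_prog = Seq (Set vP (Const 1)) (Seq (pow_prog vP eL (Const 2))
    (Seq (Set vQ (Const 1)) (Seq (pow_prog vQ (Mul (Const 2) eK) eN)
    (If (Sub (Add (Var vP) (Const 1)) (Var vQ))
      (Seq (Set vMode (Const 1)) (Seq (Set vE (Const 1)) (pow_prog vE (Mul eK eK) eN)))
      (Seq (Set vMode (Const 0)) (Seq (Set vE eW0) (Seq (pow_prog vE eK eW1)
        (Seq (pow_prog vE (Mul eL eK) (Const 2)) (Seq (pow_prog vE (Mul (Mul (Const 2) eK) eK) (Const 2))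
        (pow_prog vE (Div (Mul eK (Add eK (Const 1))) (Const 2)) eBlock))))))))))"

section \<open>Decoding of a guess\<close>

definition digits_prog :: "nat \<Rightarrow> exp \<Rightarrow> exp \<Rightarrow> com" where
  "digits_prog a N r = For 38 N (Seq (Write a (Var 38) (Mod (Var vX) r)) (Set vX (Div (Var vX) r)))"

definition clear_prog :: "nat \<Rightarrow> exp \<Rightarrow> com" where
  "clear_prog a N = For 38 N (Write a (Var 38) (Const 0))"

definition mark_prog :: com where
  "mark_prog = For 38 (Mul (Mul (Const 2) eK) eK) (If (Mod (Var vX) (Const 2))
     (Seq (Set vX (Div (Var vX) (Const 2)))
       (Seq (Write vMark (Add (Mul (Var vPos) eBlock) (Mod (Var vX) eBlock)) (Const 1))
            (Set vX (Div (Var vX) eBlock))))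
     (Seq (Set vX (Div (Var vX) (Const 2))) (Set vPos (Add (Var vPos) (Const 1)))))"

definition forbid_prog :: com where
  "forbid_prog = For 41 eL (If (eA (Var 41)
       (Add (Mul (Read vEnd (Add (Mul (Const 2) (Var 41)) (Read vBit (Add (Mul (Var 41) eK) (Var 40))))) eN) (Var 39)))
     (Set vY (Const 0)) Skip)"

text \<open>Colors are tried upwards and overwrite each other, so the largest admissible one
  remains, as in \<open>pick\<close>.\<close>

definition pick_prog :: com where
  "pick_prog = For 40 eK (Seq
     (Set vY (Read vMark (Add (Mul (Var 40) eInner) (Div (Mod (Mul (Read vMul (Var 40)) (Var vHash)) eW1) eOuter))))
     (Seq forbid_prog (If (Var vY) (Write vCol (Var 39) (Add (Var 40) (Const 1))) Skip)))"

definition hashed_prog :: com where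
  "hashed_prog = For 39 eN (Seq (Write vCol (Var 39) (Const 0))
     (Seq (Set vHash (Div (Mod (Mul (Var vA0) (Var 39)) eW0) eN)) pick_prog))"

definition decode_prog :: com where
  "decode_prog = Seq (Set vA0 (Mod (Var vX) eW0)) (Seq (Set vX (Div (Var vX) eW0))
     (Seq (digits_prog vMul eK eW1) (Seq (digits_prog vBit (Mul eL eK) (Const 2))
     (Seq (clear_prog vMark (Mul eK eInner)) (Seq (Set vPos (Const 0)) (Seq mark_prog hashed_prog))))))"

definition listed_prog :: com where
  "listed_prog = Seq (clear_prog vCol eN) (For 38 (Mul eK eK)
     (Seq (Write vCol (Mod (Var vX) eN) (Add (Div (Var 38) eK) (Const 1))) (Set vX (Div (Var vX) eN))))"

section \<open>Uncoloring and the Grundy condition\<close>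

definition Eq :: "exp \<Rightarrow> exp \<Rightarrow> exp" where
  "Eq e f = Sub (Const 1) (Add (Sub e f) (Sub f e))"

lemma eval_Eq [simp]: "eval (Eq e f) s = (if eval e s = eval f s then 1 else 0)"
  by (simp add: Eq_def)

text \<open>\<open>Mul\<close> acts as conjunction, and the truncated difference of the ranks tests
  for a strictly larger rank.\<close>

definition blocked_prog :: com where
  "blocked_prog = For 43 eN (If (Mul (eG (Add (Mul (Var 42) eN) (Var 43)))
       (Mul (Sub (Read vRank (Var 43)) (Read vRank (Var 42))) (Eq (Read vCol (Var 43)) (Read vCol (Var 42)))))
     (Write vZ (Var 42) (Const 0)) Skip)"

text \<open>Conflicts are read off \<open>vCol\<close> and resolved in \<open>vZ\<close>, so all
  vertices are uncolored simultaneously.\<close>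

definition filter_prog :: com where
  "filter_prog = For 42 eN (Seq (Write vZ (Var 42) (Read vCol (Var 42))) blocked_prog)"

definition neighbor_prog :: com where
  "neighbor_prog = For 47 eN (If (Mul (eG (Add (Mul (Var 47) eN) (Var 45)))
       (Eq (Read vZ (Var 47)) (Add (Var 46) (Const 1)))) (Set vEx (Const 1)) Skip)"

definition dominates_prog :: com where
  "dominates_prog = For 46 (Var 44) (Seq (Set vEx (Const 0)) (Seq neighbor_prog (If (Var vEx) Skip (Set vAll (Const 0)))))"

definition grundy_vertex_prog :: com where
  "grundy_vertex_prog = For 45 eN (If (Eq (Read vZ (Var 45)) (Add (Var 44) (Const 1)))
     (Seq (Set vAll (Const 1)) (Seq dominates_prog (If (Var vAll) (Set vFound (Const 1)) Skip))) Skip)"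

definition check_prog :: com where
  "check_prog = Seq (Set vOk (Const 1)) (For 44 eK (Seq (Set vFound (Const 0))
     (Seq grundy_vertex_prog (If (Var vFound) Skip (Set vOk (Const 0))))))"

definition guess_prog :: com where
  "guess_prog = Seq (Set vX (Var 48)) (Seq (If (Var vMode) listed_prog decode_prog)
     (Seq filter_prog (Seq check_prog (If (Var vOk) (Set 1 (Const 1)) Skip))))"

definition setup_prog :: com where
  "setup_prog = Seq diff_prog (Seq rank_prog (Seq edge_prog limit_prog))"

definition grundy_prog :: com where
  "grundy_prog = Seq setup_prog (For 48 (Var vE) guess_prog)"

lemmas prog_defs = diff_entry_def diff_prog_def degree_prog_def best_prog_def rank_prog_def edge_entry_def
  edge_prog_def pow_prog_def limit_prog_def digits_prog_def clear_prog_def mark_prog_def forbid_prog_def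
  pick_prog_def hashed_prog_def decode_prog_def listed_prog_def blocked_prog_def filter_prog_def
  neighbor_prog_def dominates_prog_def grundy_vertex_prog_def check_prog_def guess_prog_def setup_prog_def

section \<open>Correctness of the program\<close>

text \<open>\<open>R\<close> bounds the length of every loop except that over the guesses,
  \<open>B\<close> all numbers in memory. Both are products of positive factors, so most of the
  single bounds follow by divisibility.\<close>

locale machine =
  fixes I :: "nat \<Rightarrow> nat" and k d l n R B :: nat
  assumes I: "I 0 = k" "I (Suc 0) = d" "I 2 = l" "I 3 = n"
    and pos: "0 < k" "0 < d" "0 < l" "2 \<le> n"
    and R_def: "R = 13 * d * (k * k * k * k) * (n * n) * l"
    and B_def: "B = R * 2 ^ l * n ^ (2 * k) * n ^ (k * k) * num_guesses n d k l"
    and bit: "\<And>p. p < n * n \<Longrightarrow> I (4 + p) \<le> 1"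
begin

definition "mG p = I (4 + p)"
definition "mA t p = I (4 + (n * n * (t + 1) + p))"
definition "mH p = (if mG p \<noteq> 0 \<and> (\<forall>t<l. mA t p = 0) then 1 else 0 :: nat)"

lemma mH_cases: "mH p = 0 \<or> mH p = 1"
  by (simp add: mH_def)

lemma dvd_R_le:
  assumes "x dvd R"
  shows "x \<le> R"
  using assms pos by (intro dvd_imp_le) (auto simp: R_def)

lemma R_bounds: "n * n \<le> R" "n \<le> R" "l \<le> R" "k \<le> R" "k * k \<le> R" "2 * k \<le> R" "2 * k * k \<le> R" "l * k \<le> R"
  "k * inner_range d k \<le> R" "k * Suc k div 2 \<le> R" "13 \<le> R" "outer_range d k * n \<le> R" "d \<le> R"
proof -
  show "n * n \<le> R" "n \<le> R" "l \<le> R" "13 \<le> R" "d \<le> R" "k \<le> R" "k * k \<le> R" "l * k \<le> R"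
    "k * inner_range d k \<le> R" "outer_range d k * n \<le> R"
    by (rule dvd_R_le, simp add: R_def inner_range_def outer_range_def block_size_def mult_ac dvd_mult)+
  have "13 * (k * k) \<le> R" by (rule dvd_R_le) (simp add: R_def mult_ac dvd_mult)
  then show kk: "2 * k * k \<le> R" by simp
  have "k \<le> k * k" using pos by simp
  then show "2 * k \<le> R" using kk by linarith
  have "k * Suc k div 2 \<le> k * Suc k" by simp
  also have "\<dots> \<le> 2 * k * k" using pos by simp
  finally show "k * Suc k div 2 \<le> R" using kk by simp
qed

lemma num_guesses_pos: "0 < num_guesses n d k l"
  using pos by (simp add: num_guesses_def inner_range_def outer_range_def block_size_def)

lemma dvd_B_le:
  assumes "x dvd B"
  shows "x \<le> B"
  using assms pos num_guesses_pos R_bounds(11) by (intro dvd_imp_le) (auto simp: B_def)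

lemma B_bounds: "R \<le> B" "2 ^ l \<le> B" "n ^ (2 * k) \<le> B" "n ^ (k * k) \<le> B" "num_guesses n d k l \<le> B"
  by (rule dvd_B_le, simp add: B_def)+

lemma le_B: "x \<le> R \<Longrightarrow> x \<le> B"
  using B_bounds by simp

lemma one_le_B [simp]: "Suc 0 \<le> B"
  using le_B[OF R_bounds(11)] by simp

lemma bounded_le: "bounded_by B s \<Longrightarrow> s a i \<le> B"
  by (simp add: bounded_by_def)

section \<open>Correctness of the setup phase\<close>

lemma spec_diff_entry:
  assumes "s 0 = I" "s 30 0 = p" "s vH p = mG p" "p < n * n"
  shows "spec B R diff_entry s (\<lambda>s'. s' vH = (s vH)(p := mH p))"
proof -
  have mG: "mG p \<le> 1" using bit[OF assms(4)] by (simp add: mG_def)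
  define y where "y j = (if mG p \<noteq> 0 \<and> (\<forall>t<j. mA t p = 0) then 1 else 0 :: nat)" for j
  have "spec B R diff_entry s (\<lambda>s'. s' vH = (s vH)(p := y l))"
    unfolding diff_entry_def
  proof (rule spec_For[where Inv = "\<lambda>j s'. s' vH = (s vH)(p := y j)"], goal_cases)
    \<comment> \<open>In applications of \<open>spec_For\<close> the fifth goal is the loop body:
      its facts are the range of \<open>j\<close>, the counter value, boundedness, the frame and the
      invariant.\<close>
    case (5 j s')
    have [simp]: "s' 0 = I" "s' 30 0 = p" using 5(4) assms by simp_all
    \<comment> \<open>By truncation the entry drops to 0 at the first biclique containing the edge
      and stays there, even if bicliques overlap.\<close>
    have "y j - mA j p = y (Suc j)" by (auto simp: y_def less_Suc_eq)
    moreover have "y (Suc j) \<le> B" by (simp add: y_def)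
    ultimately show ?case using 5(1,2,5) by (intro spec_Write) (simp_all add: I mA_def)
  qed (use assms I R_bounds B_bounds mG in \<open>auto simp: y_def fun_eq_iff\<close>)
  then show ?thesis by (simp add: y_def mH_def)
qed

lemma spec_diff:
  assumes "s 0 = I"
  shows "spec B R diff_prog s (\<lambda>s'. \<forall>p<n * n. s' vH p = mH p)"
  unfolding diff_prog_def
proof (rule spec_For[where Inv = "\<lambda>j s'. \<forall>p<j. s' vH p = mH p"], goal_cases)
  case (5 j s')
  have [simp]: "s' 0 = I" using 5(4) assms by (simp add: prog_defs)
  have "I (4 + j) \<le> B" using bit[OF 5(1)] one_le_B by linarith
  then show ?case
    by (intro spec_Seq spec_Write spec_conseq[OF spec_diff_entry[of _ j]])
      (use 5(1,2,5) in \<open>auto simp: mG_def less_Suc_eq\<close>)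
qed (use assms I R_bounds B_bounds in \<open>auto simp: prog_defs\<close>)

lemma card_less_Suc_if: "card {w. w < Suc j \<and> Q w} = card {w. w < j \<and> Q w} + (if Q j then 1 else 0)"
proof -
  have "{w. w < Suc j \<and> Q w} = (if Q j then insert j {w. w < j \<and> Q w} else {w. w < j \<and> Q w})"
    by (auto simp: less_Suc_eq)
  then show ?thesis by simp
qed

lemma spec_degree:
  assumes "s 0 = I" "s 32 0 = v" "v < n" "s vDeg 0 = 0" "\<And>p. p < n * n \<Longrightarrow> s vH p = mH p"
  shows "spec B R degree_prog s (\<lambda>s'. s' vDeg 0 = card {w. w < n \<and> s vRank w = 0 \<and> mH (v * n + w) \<noteq> 0})"
  unfolding degree_prog_def
proof (rule spec_For[where
      Inv = "\<lambda>j s'. s' vDeg 0 = card {w. w < j \<and> s vRank w = 0 \<and> mH (v * n + w) \<noteq> 0}"], goal_cases)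
  case (5 j s')
  have [simp]: "s' 0 = I" "s' 32 0 = v" "s' vRank = s vRank" "s' vH = s vH" using 5(4) assms by simp_all
  have "v * n + j < Suc v * n" using 5(1) by simp
  also have "\<dots> \<le> n * n" using assms(3) by (intro mult_le_mono1) simp
  finally have H: "s vH (v * n + j) = mH (v * n + j)" using assms(5) by blast
  have le: "card {w. w < Suc j \<and> s vRank w = 0 \<and> mH (v * n + w) \<noteq> 0} \<le> Suc j"
    by (rule order_trans[OF card_mono[of "{..<Suc j}"]]) auto
  have "Suc j \<le> B" using 5(1) R_bounds(2) le_B by simp
  with le have "card {w. w < Suc j \<and> s vRank w = 0 \<and> mH (v * n + w) \<noteq> 0} \<le> B" by simp
  then show ?case
    by (intro spec_If spec_Write spec_Skip)
      (use 5(1,2,5) H mH_cases[of "v * n + j"] in \<open>auto simp: I card_less_Suc_if\<close>)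
qed (use assms I R_bounds B_bounds in auto)

definition "low rk v \<longleftrightarrow> v < n \<and> rk v = 0 \<and> card {w. w < n \<and> rk w = 0 \<and> mH (v * n + w) \<noteq> 0} \<le> d"

lemma spec_best:
  assumes "s 0 = I" "\<And>p. p < n * n \<Longrightarrow> s vH p = mH p"
  shows "spec B R best_prog s (\<lambda>s'. (\<exists>v. low (s vRank) v) \<longrightarrow> low (s vRank) (s' vBest 0))"
proof -
  have "spec B R best_prog s (\<lambda>s'. (\<exists>v<n. low (s vRank) v) \<longrightarrow> low (s vRank) (s' vBest 0))"
    unfolding best_prog_def
  proof (rule spec_For[where
        Inv = "\<lambda>j s'. (\<exists>v<j. low (s vRank) v) \<longrightarrow> low (s vRank) (s' vBest 0)"], goal_cases)
    case (5 j s')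
    have [simp]: "s' 0 = I" "s' vRank = s vRank" "s' vH = s vH" using 5(4) assms by (simp_all add: prog_defs)
    have jB: "j \<le> B" using 5(1) R_bounds(2) le_B by simp
    show ?case
    proof (rule spec_If, goal_cases)
      case 1
      then have "\<not> low (s vRank) j" using 5(2) by (simp add: low_def)
      then show ?case using 5(1,2,5) by (intro spec_Skip) (auto simp: less_Suc_eq)
    next
      case 2
      show ?case
      proof (rule spec_Seq, rule spec_Write, simp, rule spec_Seq, rule spec_conseq[OF spec_degree[of _ j]], goal_cases)
        case (6 s'')
        have [simp]: "s'' 0 = I" "s'' 32 0 = j" "s'' vBest = s' vBest"
          using 6(2) 5(2) by (simp_all add: prog_defs)
        have "low (s vRank) j \<longleftrightarrow> s'' vDeg 0 \<le> d" using 6(3) 2 5(1,2) by (simp add: low_def)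
        then show ?case using jB 5(5) by (intro spec_If spec_Write spec_Skip) (auto simp: I less_Suc_eq)
      qed (use 5(1,2,5) assms in auto)
    qed
  qed (use assms I R_bounds B_bounds in \<open>auto simp: prog_defs\<close>)
  then show ?thesis by (rule spec_conseq) (auto simp: low_def)
qed

text \<open>The invariant after \<open>r\<close> rounds. Unranked vertices count as later than all
  ranked ones; at \<open>r = n\<close> this is a degeneracy order of the difference graph.\<close>

definition "ranking r rk \<longleftrightarrow> card {v. v < n \<and> rk v = 0} = n - r \<and> (\<forall>v<n. rk v \<le> r) \<and>
  inj_on rk {v. v < n \<and> rk v \<noteq> 0} \<and>
  (\<forall>v<n. rk v \<noteq> 0 \<longrightarrow> card {w. w < n \<and> mH (v * n + w) \<noteq> 0 \<and> (rk w = 0 \<or> rk v < rk w)} \<le> d)"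

text \<open>No rank exceeds \<open>r\<close> so far, so after the new vertex come only the unranked
  ones, and these are counted by \<open>low\<close>. For older vertices \<open>v\<close> already
  counted as later, so their sets do not grow.\<close>

lemma ranking_step:
  assumes "ranking r rk" "low rk v" "r < n"
  shows "ranking (Suc r) (rk(v := Suc r))"
  unfolding ranking_def
proof (intro conjI allI impI)
  have v: "v < n" "rk v = 0" "card {w. w < n \<and> rk w = 0 \<and> mH (v * n + w) \<noteq> 0} \<le> d"
    using assms(2) by (auto simp: low_def)
  have r: "card {v. v < n \<and> rk v = 0} = n - r" "\<And>v. v < n \<Longrightarrow> rk v \<le> r" "inj_on rk {v. v < n \<and> rk v \<noteq> 0}"
    "\<And>v. v < n \<Longrightarrow> rk v \<noteq> 0 \<Longrightarrow> card {w. w < n \<and> mH (v * n + w) \<noteq> 0 \<and> (rk w = 0 \<or> rk v < rk w)} \<le> d"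
    using assms(1) by (auto simp: ranking_def)
  let ?rk = "rk(v := Suc r)"
  have "{u. u < n \<and> ?rk u = 0} = {u. u < n \<and> rk u = 0} - {v}" by auto
  then show "card {u. u < n \<and> ?rk u = 0} = n - Suc r" using r(1) v by simp
  show "?rk u \<le> Suc r" if "u < n" for u using r(2)[OF that] by simp
  show "inj_on ?rk {u. u < n \<and> ?rk u \<noteq> 0}"
  proof (rule inj_onI)
    fix x y assume xy: "x \<in> {u. u < n \<and> ?rk u \<noteq> 0}" "y \<in> {u. u < n \<and> ?rk u \<noteq> 0}" "?rk x = ?rk y"
    then show "x = y" using r(2)[of x] r(2)[of y] inj_onD[OF r(3), of x y] by (auto split: if_splits)
  qed
  fix u assume u: "u < n" "?rk u \<noteq> 0"
  show "card {w. w < n \<and> mH (u * n + w) \<noteq> 0 \<and> (?rk w = 0 \<or> ?rk u < ?rk w)} \<le> d"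
  proof (cases "u = v")
    case True
    have "\<not> Suc r < rk w" if "w < n" for w using r(2)[OF that] by simp
    then have "{w. w < n \<and> mH (u * n + w) \<noteq> 0 \<and> (?rk w = 0 \<or> ?rk u < ?rk w)}
        \<subseteq> {w. w < n \<and> rk w = 0 \<and> mH (v * n + w) \<noteq> 0}"
      using True by (auto split: if_splits)
    then have "card {w. w < n \<and> mH (u * n + w) \<noteq> 0 \<and> (?rk w = 0 \<or> ?rk u < ?rk w)}
        \<le> card {w. w < n \<and> rk w = 0 \<and> mH (v * n + w) \<noteq> 0}"
      by (intro card_mono) auto
    then show ?thesis using v(3) by linarith
  next
    case False
    have "{w. w < n \<and> mH (u * n + w) \<noteq> 0 \<and> (?rk w = 0 \<or> ?rk u < ?rk w)}
        \<subseteq> {w. w < n \<and> mH (u * n + w) \<noteq> 0 \<and> (rk w = 0 \<or> rk u < rk w)}"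
      using False v(2) by auto
    then have "card {w. w < n \<and> mH (u * n + w) \<noteq> 0 \<and> (?rk w = 0 \<or> ?rk u < ?rk w)}
        \<le> card {w. w < n \<and> mH (u * n + w) \<noteq> 0 \<and> (rk w = 0 \<or> rk u < rk w)}"
      by (intro card_mono) auto
    then show ?thesis using r(4)[OF u(1)] u(2) False by simp
  qed
qed

lemma spec_rank:
  assumes "s 0 = I" "\<And>p. p < n * n \<Longrightarrow> s vH p = mH p" "\<And>v. s vRank v = 0"
    and degenerate: "\<And>U. U \<subseteq> {..<n} \<Longrightarrow> U \<noteq> {} \<Longrightarrow> \<exists>v\<in>U. card {w \<in> U. mH (v * n + w) \<noteq> 0} \<le> d"
  shows "spec B R rank_prog s (\<lambda>s'. ranking n (s' vRank))"
  unfolding rank_prog_def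
proof (rule spec_For[where Inv = "\<lambda>j s'. ranking j (s' vRank)"], goal_cases)
  case (5 j s')
  have [simp]: "s' 0 = I" "s' vH = s vH" using 5(4) assms by (simp_all add: prog_defs)
  define U where "U = {v. v < n \<and> s' vRank v = 0}"
  have "card U = n - j" using 5(5) by (simp add: ranking_def U_def)
  then have "U \<noteq> {}" using 5(1) by auto
  moreover have "U \<subseteq> {..<n}" by (auto simp: U_def)
  ultimately obtain v where "v \<in> U" "card {w \<in> U. mH (v * n + w) \<noteq> 0} \<le> d" using degenerate by blast
  then have ex: "\<exists>v. low (s' vRank) v" by (auto simp: low_def U_def conj_ac)
  have jB: "Suc j \<le> B" using 5(1) R_bounds(2) le_B by simp
  show ?case
  proof (rule spec_Seq, rule spec_conseq[OF spec_best], goal_cases)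
    case (3 s'')
    have [simp]: "s'' vRank = s' vRank" "s'' 34 = s' 34" using 3(2) by (simp_all add: prog_defs)
    show ?case using ranking_step[OF 5(5) _ 5(1)] 3(3) ex 5(2) jB by (intro spec_Write) auto
  qed (use assms in auto)
qed (use assms I R_bounds B_bounds in \<open>auto simp: prog_defs ranking_def\<close>)


definition "edge_at ep t \<longleftrightarrow> (\<exists>p<n * n. mA t p \<noteq> 0 \<and> ep (2 * t) = p div n \<and> ep (2 * t + 1) = p mod n)"

text \<open>The second conjunct protects the endpoints recorded for earlier bicliques.\<close>

lemma spec_edge_entry:
  assumes "s 0 = I" "s 35 0 = t" "\<exists>p<n * n. mA t p \<noteq> 0"
  shows "spec B R edge_entry s (\<lambda>s'. edge_at (s' vEnd) t \<and> (\<forall>j. j < 2 * t \<longrightarrow> s' vEnd j = s vEnd j))"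
proof -
  have "spec B R edge_entry s (\<lambda>s'. ((\<exists>p<n * n. mA t p \<noteq> 0) \<longrightarrow> edge_at (s' vEnd) t) \<and>
      (\<forall>j. j < 2 * t \<longrightarrow> s' vEnd j = s vEnd j))"
    unfolding edge_entry_def
  proof (rule spec_For[where Inv = "\<lambda>q s'. ((\<exists>p<q. mA t p \<noteq> 0) \<longrightarrow> edge_at (s' vEnd) t) \<and>
      (\<forall>j. j < 2 * t \<longrightarrow> s' vEnd j = s vEnd j)"], goal_cases)
    case (5 j s')
    have [simp]: "s' 0 = I" "s' 35 0 = t" using 5(4) assms by simp_all
    have jB: "j div n \<le> B" "j mod n \<le> B"
      using 5(1) R_bounds(1) le_B by (meson div_le_dividend mod_less_eq_dividend le_trans less_imp_le)+
    show ?case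
      by (intro spec_If spec_Seq spec_Write spec_Skip)
        (use 5(1,2,5) jB in \<open>auto simp: I mA_def edge_at_def less_Suc_eq\<close>)
  qed (use assms I R_bounds B_bounds in auto)
  then show ?thesis by (rule spec_conseq) (use assms(3) in auto)
qed

lemma spec_edge:
  assumes "s 0 = I" "\<And>t. t < l \<Longrightarrow> \<exists>p<n * n. mA t p \<noteq> 0"
  shows "spec B R edge_prog s (\<lambda>s'. \<forall>t<l. edge_at (s' vEnd) t)"
  unfolding edge_prog_def
proof (rule spec_For[where Inv = "\<lambda>j s'. \<forall>t<j. edge_at (s' vEnd) t"], goal_cases)
  case (5 j s')
  have [simp]: "s' 0 = I" using 5(4) assms by (simp add: prog_defs)
  show ?case
    by (rule spec_conseq[OF spec_edge_entry[of _ j]])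
      (use 5(1,2,5) assms(2) in \<open>auto simp: edge_at_def less_Suc_eq\<close>)
qed (use assms I R_bounds B_bounds in \<open>auto simp: prog_defs\<close>)

lemma spec_pow:
  assumes "s 0 = I" "\<And>s'. s' 0 = I \<Longrightarrow> eval N s' = m" "\<And>s'. s' 0 = I \<Longrightarrow> eval r s' = b"
    and "x \<noteq> 0" "x \<noteq> 37" "m \<le> R" "0 < b" "s x 0 * b ^ m \<le> B"
  shows "spec B R (pow_prog x N r) s (\<lambda>s'. s' x 0 = s x 0 * b ^ m)"
  unfolding pow_prog_def
proof (rule spec_For[where Inv = "\<lambda>j s'. s' x 0 = s x 0 * b ^ j"], goal_cases)
  case (5 j s')
  have [simp]: "s' 0 = I" using 5(4) assms by simp
  have "s x 0 * b ^ Suc j \<le> s x 0 * b ^ m" using 5(1) assms(7) by (intro mult_le_mono2 power_increasing) auto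
  then have "s x 0 * b ^ Suc j \<le> B" using assms(8) by (rule le_trans)
  then show ?case using 5(5) assms(3)[of s'] by (intro spec_Write) (auto simp: mult_ac)
qed (use assms I R_bounds B_bounds in auto)

definition "direct \<longleftrightarrow> n ^ (2 * k) \<le> 2 ^ l"

definition "guesses = (if direct then n ^ (k * k) else num_guesses n d k l)"

lemma spec_limit:
  assumes "s 0 = I"
  shows "spec B R limit_prog s (\<lambda>s'. (s' vMode 0 \<noteq> 0 \<longleftrightarrow> direct) \<and> s' vE 0 = guesses)"
proof -
  have W: "eval eBlock s' = block_size d k" "eval eW0 s' = outer_range d k * n"
    "eval eW1 s' = inner_range d k * outer_range d k" if "s' 0 = I" for s'
    using that by (simp_all add: I block_size_def inner_range_def outer_range_def)
  have posW: "0 < block_size d k" "0 < outer_range d k * n" "0 < inner_range d k * outer_range d k"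
    using pos by (simp_all add: block_size_def inner_range_def outer_range_def)
  \<comment> \<open>The values of \<open>vE\<close> after each factor. They increase to
    \<open>num_guesses\<close>, so each of them stays below \<open>B\<close>.\<close>
  define f0 where "f0 = outer_range d k * n"
  define f1 where "f1 = f0 * (inner_range d k * outer_range d k) ^ k"
  define f2 where "f2 = f1 * 2 ^ (l * k)"
  define f3 where "f3 = f2 * 2 ^ (2 * k * k)"
  define f4 where "f4 = f3 * block_size d k ^ (k * Suc k div 2)"
  have f4: "f4 = num_guesses n d k l" by (simp add: f4_def f3_def f2_def f1_def f0_def num_guesses_def)
  have "f3 \<le> f4" "f2 \<le> f3" "f1 \<le> f2" "f0 \<le> f1"
    using posW by (simp_all add: f4_def f3_def f2_def f1_def Suc_le_eq)
  then have fB: "f4 \<le> B" "f3 \<le> B" "f2 \<le> B" "f1 \<le> B" "f0 \<le> B" using B_bounds(5) f4 by linarith+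
  show ?thesis
    unfolding limit_prog_def
  proof (rule spec_Seq, rule spec_Write, simp, rule spec_Seq,
      rule spec_conseq[OF spec_pow[where m = l and b = 2]], goal_cases)
    case (9 s1)
    then have s1: "s1 0 = I" "s1 vP 0 = 2 ^ l" using assms by (simp_all add: prog_defs)
    show ?case
    proof (rule spec_Seq, rule spec_Write, simp, rule spec_Seq,
        rule spec_conseq[OF spec_pow[where m = "2 * k" and b = n]], goal_cases)
      case (9 s2)
      then have s2: "s2 0 = I" "s2 vP 0 = 2 ^ l" "s2 vQ 0 = n ^ (2 * k)" using s1 by (simp_all add: prog_defs)
      show ?case
      proof (rule spec_If, goal_cases)
        case 1
        then have direct using s2 by (simp add: direct_def)
        show ?case
        proof (rule spec_Seq, rule spec_Write, simp, rule spec_Seq, rule spec_Write, simp,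
            rule spec_conseq[OF spec_pow[where m = "k * k" and b = n]], goal_cases)
          case (9 s3)
          then show ?case using \<open>direct\<close> by (simp add: guesses_def prog_defs)
        qed (use s2 I pos R_bounds B_bounds in auto)
      next
        case 2
        then have "\<not> direct" using s2 by (simp add: direct_def)
        show ?case
        proof (rule spec_Seq, rule spec_Write, simp, rule spec_Seq, rule spec_Write, goal_cases)
          case 1
          show ?case using s2 W(2)[of s2] fB(5) by (simp add: f0_def)
        next
          case 2
          show ?case
          proof (rule spec_Seq, rule spec_conseq[OF spec_pow[where m = k and b = "inner_range d k * outer_range d k"]], goal_cases)
            case (9 s3)
            then have s3: "s3 0 = I" "s3 vMode 0 = 0" "s3 vE 0 = f1"
              using s2 W(2)[of s2] by (simp_all add: prog_defs f1_def f0_def)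
            show ?case
            proof (rule spec_Seq, rule spec_conseq[OF spec_pow[where m = "l * k" and b = 2]], goal_cases)
              case (9 s4)
              then have s4: "s4 0 = I" "s4 vMode 0 = 0" "s4 vE 0 = f2" using s3 by (simp_all add: prog_defs f2_def)
              show ?case
              proof (rule spec_Seq, rule spec_conseq[OF spec_pow[where m = "2 * k * k" and b = 2]], goal_cases)
                case (9 s5)
                then have s5: "s5 0 = I" "s5 vMode 0 = 0" "s5 vE 0 = f3" using s4 by (simp_all add: prog_defs f3_def)
                show ?case
                proof (rule spec_conseq[OF spec_pow[where m = "k * Suc k div 2" and b = "block_size d k"]], goal_cases)
                  case (9 s6)
                  then show ?case using s5 \<open>\<not> direct\<close> by (simp add: prog_defs guesses_def f4[symmetric] f4_def)
                qed (use s5 posW R_bounds fB in \<open>auto simp: I block_size_def f4_def\<close>)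
              qed (use s4 R_bounds fB in \<open>auto simp: I f3_def\<close>)
            qed (use s3 R_bounds fB in \<open>auto simp: I f2_def\<close>)
          qed (use s2 W(2)[of s2] posW R_bounds fB in
              \<open>auto simp: I inner_range_def outer_range_def block_size_def f1_def f0_def\<close>)
        qed
      qed
    qed (use s1 I pos R_bounds B_bounds in auto)
  qed (use assms I pos R_bounds B_bounds in auto)
qed


section \<open>Correctness of the decoding\<close>

lemma eval_sizes:
  assumes "s 0 = I"
  shows "eval eK s = k" "eval eL s = l" "eval eN s = n" "eval eBlock s = block_size d k"
    "eval eInner s = inner_range d k" "eval eOuter s = outer_range d k"
    "eval eW0 s = outer_range d k * n" "eval eW1 s = inner_range d k * outer_range d k"
  using assms by (simp_all add: I block_size_def inner_range_def outer_range_def)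

lemma sizes_pos: "0 < block_size d k" "0 < inner_range d k" "0 < outer_range d k" "0 < n"
  using pos by (simp_all add: block_size_def inner_range_def outer_range_def)

lemma spec_digits:
  assumes "s 0 = I" "\<And>s'. s' 0 = I \<Longrightarrow> eval N s' = m" "\<And>s'. s' 0 = I \<Longrightarrow> eval r s' = b"
    and "a \<noteq> 0" "a \<noteq> 38" "a \<noteq> vX" "m \<le> R"
  shows "spec B R (digits_prog a N r) s
    (\<lambda>s'. (\<forall>i<m. s' a i = s vX 0 div b ^ i mod b) \<and> s' vX 0 = s vX 0 div b ^ m)"
  unfolding digits_prog_def
proof (rule spec_For[where
      Inv = "\<lambda>j s'. (\<forall>i<j. s' a i = s vX 0 div b ^ i mod b) \<and> s' vX 0 = s vX 0 div b ^ j"], goal_cases)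
  case (5 j s')
  have [simp]: "s' 0 = I" using 5(4) assms by simp
  have [simp]: "eval r s' = b" using assms(3) by simp
  have [simp]: "eval r (s'(a := x)) = b" for x using assms(3)[of "s'(a := x)"] assms(4) by simp
  have x: "s' vX 0 mod b \<le> B" "s' vX 0 div b \<le> B"
    using bounded_le[OF 5(3), of vX 0] by (meson div_le_dividend mod_less_eq_dividend le_trans)+
  show ?case
    by (intro spec_Seq spec_Write)
      (use 5(1,2,5) x assms(4-6) in \<open>auto simp: less_Suc_eq div_mult2_eq[symmetric] mult.commute\<close>)
qed (use assms I R_bounds B_bounds in auto)

lemma spec_clear:
  assumes "s 0 = I" "\<And>s'. s' 0 = I \<Longrightarrow> eval N s' = m" "a \<noteq> 0" "a \<noteq> 38" "m \<le> R"
  shows "spec B R (clear_prog a N) s (\<lambda>s'. \<forall>i<m. s' a i = 0)"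
  unfolding clear_prog_def
proof (rule spec_For[where Inv = "\<lambda>j s'. \<forall>i<j. s' a i = 0"], goal_cases)
  case (5 j s')
  show ?case by (intro spec_Write) (use 5(1,2,5) assms(3,4) in \<open>auto simp: less_Suc_eq\<close>)
qed (use assms I R_bounds B_bounds in auto)

lemma spec_mark:
  assumes "s 0 = I" "s vPos 0 = 0" "\<And>q. q < k * inner_range d k \<Longrightarrow> s vMark q = 0"
  shows "spec B R mark_prog s (\<lambda>s'. \<forall>q < k * inner_range d k.
    s' vMark q \<noteq> 0 \<longleftrightarrow> q \<in> decode_marks (block_size d k) (2 * k * k) (s vX 0) 0)"
proof -
  define m where "m = block_size d k"
  define J where "J = 2 * k * k"
  define M where "M = decode_marks m J (s vX 0) 0"
  \<comment> \<open>The cells marked so far together with those still coded in the rest of the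
    number always make up \<open>M\<close>.\<close>
  define Inv where "Inv j s' \<longleftrightarrow> s' vPos 0 \<le> j \<and> (\<forall>q < k * inner_range d k.
    s' vMark q \<noteq> 0 \<or> q \<in> decode_marks m (J - j) (s' vX 0) (s' vPos 0) \<longleftrightarrow> q \<in> M)" for j and s' :: state
  have "spec B R mark_prog s (Inv J)"
    unfolding mark_prog_def
  proof (rule spec_For[where Inv = Inv], goal_cases)
    case (5 j s')
    have [simp]: "s' 0 = I" using 5(4) assms by simp
    have m: "13 * d * k * k = m" by (simp add: m_def block_size_def)
    have x: "s' vX 0 div y \<le> B" for y
      using bounded_le[OF 5(3), of vX 0] by (meson div_le_dividend le_trans)
    have x': "s' vX 0 div 2 div y \<le> B" for y
      using x[of 2] by (meson div_le_dividend le_trans)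
    have J: "J - j = Suc (J - Suc j)" using 5(1) by simp
    have "Suc j \<le> B" using 5(1) R_bounds(7) le_B by (simp add: J_def)
    then have pos: "Suc (s' vPos 0) \<le> B" using 5(5) by (simp add: Inv_def)
    show ?case
      by (intro spec_If spec_Seq spec_Write)
        (use 5(5) x x' pos in \<open>auto simp: Inv_def J I m\<close>)
  qed (use assms I R_bounds B_bounds in \<open>auto simp: J_def Inv_def M_def\<close>)
  then show ?thesis by (rule spec_conseq) (auto simp: Inv_def M_def J_def m_def)
qed

lemma spec_forbid:
  assumes "s 0 = I" "s 39 0 = v" "s 40 0 = i"
  shows "spec B R forbid_prog s (\<lambda>s'. s' vY 0 \<noteq> 0 \<longleftrightarrow>
    s vY 0 \<noteq> 0 \<and> (\<forall>t<l. mA t (s vEnd (2 * t + s vBit (t * k + i)) * n + v) = 0))"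
  unfolding forbid_prog_def
proof (rule spec_For[where Inv = "\<lambda>j s'. s' vY 0 \<noteq> 0 \<longleftrightarrow>
    s vY 0 \<noteq> 0 \<and> (\<forall>t<j. mA t (s vEnd (2 * t + s vBit (t * k + i)) * n + v) = 0)"], goal_cases)
  case (5 j s')
  have [simp]: "s' 0 = I" "s' 39 0 = v" "s' 40 0 = i" "s' vEnd = s vEnd" "s' vBit = s vBit"
    using 5(4) assms by simp_all
  show ?case
    by (intro spec_If spec_Write spec_Skip) (use 5(1,2,5) in \<open>auto simp: I mA_def less_Suc_eq\<close>)
qed (use assms I R_bounds B_bounds in auto)

lemma spec_pick:
  assumes "s 0 = I" "s 39 0 = v" "s vCol v = 0"
  shows "spec B R pick_prog s (\<lambda>s'. s' vCol = (s vCol)(v := pick (\<lambda>i.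
    s vMark (i * inner_range d k + mhash (inner_range d k) (outer_range d k) (s vMul i) (s vHash 0)) \<noteq> 0 \<and>
    (\<forall>t<l. mA t (s vEnd (2 * t + s vBit (t * k + i)) * n + v) = 0)) k))"
proof -
  define Q where "Q = (\<lambda>i.
    s vMark (i * inner_range d k + mhash (inner_range d k) (outer_range d k) (s vMul i) (s vHash 0)) \<noteq> 0 \<and>
    (\<forall>t<l. mA t (s vEnd (2 * t + s vBit (t * k + i)) * n + v) = 0))"
  have "spec B R pick_prog s (\<lambda>s'. s' vCol = (s vCol)(v := pick Q k))"
    unfolding pick_prog_def
  proof (rule spec_For[where Inv = "\<lambda>j s'. s' vCol = (s vCol)(v := pick Q j)"], goal_cases)
    case (5 j s')
    have [simp]: "s' 0 = I" "s' 39 0 = v" "s' vEnd = s vEnd" "s' vBit = s vBit" "s' vMark = s vMark"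
      "s' vMul = s vMul" "s' vHash = s vHash"
      using 5(4) assms by (simp_all add: prog_defs)
    have jB: "Suc j \<le> B" using 5(1) R_bounds(4) le_B by simp
    let ?y = "s vMark (j * inner_range d k + mhash (inner_range d k) (outer_range d k) (s vMul j) (s vHash 0))"
    let ?e = "Read vMark (Add (Mul (Var 40) eInner) (Div (Mod (Mul (Read vMul (Var 40)) (Var vHash)) eW1) eOuter))"
    have ev: "eval ?e s' = ?y"
      using 5(2) by (simp add: I mhash_def inner_range_def outer_range_def block_size_def)
    have yB: "?y \<le> B" using bounded_le[OF 5(3), of vMark] by simp
    show ?case
    proof (rule spec_Seq, rule spec_Write, unfold ev, rule yB, rule spec_Seq,
        rule spec_conseq[OF spec_forbid[of _ v j]], goal_cases)
      case (4 s'')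
      have [simp]: "s'' 39 0 = v" "s'' 40 0 = j" "s'' vCol = s' vCol" using 4(2) 5(2) by (simp_all add: prog_defs)
      have "s'' vY 0 \<noteq> 0 \<longleftrightarrow> Q j" using 4(3) by (simp add: Q_def)
      then show ?case using jB 5(5) by (intro spec_If spec_Write spec_Skip) auto
    qed (use 5(2) in auto)
  qed (use assms I R_bounds B_bounds in \<open>auto simp: prog_defs fun_eq_iff\<close>)
  then show ?thesis by (simp only: Q_def)
qed

lemma spec_hashed:
  assumes "s 0 = I"
  shows "spec B R hashed_prog s (\<lambda>s'. \<forall>v<n. s' vCol v = pick (\<lambda>i.
    s vMark (color_hash n d k (s vA0 0) (s vMul) i v) \<noteq> 0 \<and>
    (\<forall>t<l. mA t (s vEnd (2 * t + s vBit (t * k + i)) * n + v) = 0)) k)"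
  unfolding hashed_prog_def
proof (rule spec_For[where Inv = "\<lambda>j s'. \<forall>v<j. s' vCol v = pick (\<lambda>i.
    s vMark (color_hash n d k (s vA0 0) (s vMul) i v) \<noteq> 0 \<and>
    (\<forall>t<l. mA t (s vEnd (2 * t + s vBit (t * k + i)) * n + v) = 0)) k"], goal_cases)
  case (5 j s')
  have [simp]: "s' 0 = I" "s' vEnd = s vEnd" "s' vBit = s vBit" "s' vMark = s vMark"
      "s' vMul = s vMul" "s' vA0 = s vA0"
    using 5(4) assms by (simp_all add: prog_defs)
  let ?e = "Div (Mod (Mul (Var vA0) (Var 39)) eW0) eN"
  have ev: "eval ?e (s'(vCol := f)) = mhash (outer_range d k) n (s vA0 0) j" for f
  proof -
    have "(s'(vCol := f)) 0 = I" by simp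
    from eval_sizes[where s = "s'(vCol := f)", OF this] show ?thesis
      using 5(2) by (simp only: eval.simps(2,3,5,6) eval_Mod mhash_def) simp
  qed
  have hB: "mhash (outer_range d k) n (s vA0 0) j \<le> B"
  proof -
    have "mhash (outer_range d k) n (s vA0 0) j < outer_range d k" using sizes_pos by (intro mhash_less)
    also have "\<dots> \<le> outer_range d k * n" using sizes_pos by simp
    finally show ?thesis using R_bounds(12) le_B by simp
  qed
  show ?case
  proof (rule spec_Seq, rule spec_Write, simp, rule spec_Seq, rule spec_Write, unfold ev, rule hB,
      rule spec_conseq[OF spec_pick[of _ j]], goal_cases)
    case (4 s'')
    show ?case
    proof (intro allI impI)
      fix v assume "v < Suc j"
      then consider "v < j" | "v = j" by linarith
      then show "s'' vCol v = pick (\<lambda>i. s vMark (color_hash n d k (s vA0 0) (s vMul) i v) \<noteq> 0 \<and>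
          (\<forall>t<l. mA t (s vEnd (2 * t + s vBit (t * k + i)) * n + v) = 0)) k"
      proof cases
        case 1
        then show ?thesis using 4(3) 5(2,5) by simp
      next
        case 2
        then show ?thesis unfolding 4(3) color_hash_def by simp
      qed
    qed
  qed (use 5(2) in auto)
qed (use assms I R_bounds B_bounds in \<open>auto simp: prog_defs\<close>)

abbreviation "adjG u v \<equiv> mG (u * n + v) \<noteq> 0"

abbreviation "adjA t u v \<equiv> mA t (u * n + v) \<noteq> 0"

lemma spec_decode:
  assumes "s 0 = I"
  shows "spec B R decode_prog s
    (\<lambda>s'. \<forall>v<n. s' vCol v = decoded_coloring n d k l adjA (s vEnd) (s vX 0) v)"
proof -
  define W0 where "W0 = outer_range d k * n"
  define W1 where "W1 = inner_range d k * outer_range d k"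
  define e1 where "e1 = s vX 0 div W0"
  define e2 where "e2 = e1 div W1 ^ k"
  define e3 where "e3 = e2 div 2 ^ (l * k)"
  have x: "s vX 0 mod W0 \<le> B" "e1 \<le> B" if "bounded_by B s"
    using bounded_le[OF that, of vX 0] unfolding e1_def
    by (meson div_le_dividend mod_less_eq_dividend le_trans)+
  have ev: "eval (Mod (Var vX) eW0) s' = s' vX 0 mod W0" "eval (Div (Var vX) eW0) s' = s' vX 0 div W0"
    if "s' 0 = I" for s'
    using eval_sizes(7)[where s = s', OF that] by (simp_all only: eval_Mod W0_def eval.simps(2,6)) simp_all
  show ?thesis
    unfolding decode_prog_def
  proof (rule ensures_bounded, rule spec_Seq, rule spec_Write, unfold ev[of s, OF assms], rule x, assumption,
      rule spec_Seq, rule spec_Write, goal_cases)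
    case 1
    then show ?case using x ev assms by (simp add: e1_def)
  next
    case 2
    let ?s = "s(vA0 := (s vA0)(0 := s vX 0 mod W0), vX := (s vX)(0 := e1))"
    have upd: "(s(vA0 := (s vA0)(eval (Const 0) s := s vX 0 mod W0)))
       (vX := ((s(vA0 := (s vA0)(eval (Const 0) s := s vX 0 mod W0))) vX)
         (eval (Const 0) (s(vA0 := (s vA0)(eval (Const 0) s := s vX 0 mod W0))) :=
           eval (Div (Var vX) eW0) (s(vA0 := (s vA0)(eval (Const 0) s := s vX 0 mod W0))))) = ?s"
      using ev assms by (simp add: e1_def)
    show ?case
      unfolding upd
    proof (rule spec_Seq, rule spec_conseq[OF spec_digits[where m = k and b = W1]], goal_cases)
      case (8 s1)
      then have s1: "s1 0 = I" "s1 vEnd = s vEnd" "s1 vA0 0 = s vX 0 mod W0" "s1 vX 0 = e2"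
        "\<And>i. i < k \<Longrightarrow> s1 vMul i = e1 div W1 ^ i mod W1"
        using assms by (simp_all add: prog_defs e2_def)
      show ?case
      proof (rule spec_Seq, rule spec_conseq[OF spec_digits[where m = "l * k" and b = 2]], goal_cases)
        case (8 s2)
        then have s2: "s2 0 = I" "s2 vEnd = s vEnd" "s2 vA0 0 = s vX 0 mod W0" "s2 vX 0 = e3"
          "\<And>i. i < k \<Longrightarrow> s2 vMul i = e1 div W1 ^ i mod W1"
          "\<And>z. z < l * k \<Longrightarrow> s2 vBit z = e2 div 2 ^ z mod 2"
          using s1 by (simp_all add: prog_defs e3_def)
        show ?case
        proof (rule spec_Seq, rule spec_conseq[OF spec_clear[where m = "k * inner_range d k"]], goal_cases)
          case (6 s3)
          then have s3: "s3 0 = I" "s3 vEnd = s vEnd" "s3 vA0 0 = s vX 0 mod W0" "s3 vX 0 = e3"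
            "\<And>i. i < k \<Longrightarrow> s3 vMul i = e1 div W1 ^ i mod W1"
            "\<And>z. z < l * k \<Longrightarrow> s3 vBit z = e2 div 2 ^ z mod 2"
            "\<And>q. q < k * inner_range d k \<Longrightarrow> s3 vMark q = 0"
            using s2 by (simp_all add: prog_defs)
          show ?case
          proof (rule spec_Seq, rule spec_Write, simp, rule spec_Seq, rule spec_conseq[OF spec_mark], goal_cases)
            case (4 s4)
            then have s4: "s4 0 = I" "s4 vEnd = s vEnd" "s4 vA0 0 = s vX 0 mod W0"
              "\<And>i. i < k \<Longrightarrow> s4 vMul i = e1 div W1 ^ i mod W1"
              "\<And>z. z < l * k \<Longrightarrow> s4 vBit z = e2 div 2 ^ z mod 2"
              "\<And>q. q < k * inner_range d k \<Longrightarrow>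
                s4 vMark q \<noteq> 0 \<longleftrightarrow> q \<in> decode_marks (block_size d k) (2 * k * k) e3 0"
              using s3 by (simp_all add: prog_defs)
            show ?case
            proof (rule spec_conseq[OF spec_hashed[where s = s4, OF s4(1)]], intro allI impI)
              fix s5 v
              assume v: "v < n" and s5: "\<forall>v<n. s5 vCol v = pick (\<lambda>i.
                s4 vMark (color_hash n d k (s4 vA0 0) (s4 vMul) i v) \<noteq> 0 \<and>
                (\<forall>t<l. mA t (s4 vEnd (2 * t + s4 vBit (t * k + i)) * n + v) = 0)) k"
              let ?a = "\<lambda>i. e1 div W1 ^ i mod W1"
              have ix: "t * k + i < l * k" if "t < l" "i < k" for t i
              proof -
                have "t * k + i < Suc t * k" using that by simp
                also have "\<dots> \<le> l * k" using that by (intro mult_le_mono1) simp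
                finally show ?thesis .
              qed
              have ch: "color_hash n d k (s vX 0 mod W0) (s4 vMul) i v = color_hash n d k (s vX 0 mod W0) ?a i v"
                if "i < k" for i
                using s4(4)[OF that] by (simp add: color_hash_def)
              \<comment> \<open>\<open>vMark\<close> is known on the cleared cells only, so the
                cells that are looked up must lie among them.\<close>
              have chl: "color_hash n d k a0 a i v < k * inner_range d k" if "i < k" for a0 a i
              proof -
                have "color_hash n d k a0 a i v < Suc i * inner_range d k"
                  using mhash_less sizes_pos by (simp add: color_hash_def)
                also have "\<dots> \<le> k * inner_range d k" using that by (intro mult_le_mono1) simp
                finally show ?thesis .
              qed
              have "s5 vCol v = pick (\<lambda>i. color_hash n d k (s vX 0 mod W0) ?a i v
                  \<in> decode_marks (block_size d k) (2 * k * k) e3 0 \<and>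
                (\<forall>t<l. \<not> adjA t (s vEnd (2 * t + e2 div 2 ^ (t * k + i) mod 2)) v)) k"
                unfolding s5[rule_format, OF v] using s4(2,3,5,6) ch chl ix by (intro pick_cong) auto
              then show "s5 vCol v = decoded_coloring n d k l adjA (s vEnd) (s vX 0) v"
                by (simp add: decoded_coloring_def hashed_coloring_def Let_def W0_def W1_def e1_def e2_def e3_def)
            qed
          qed (use s3 in auto)
        qed (use s2 R_bounds in \<open>auto simp: I inner_range_def block_size_def\<close>)
      qed (use s1 R_bounds in \<open>auto simp: I\<close>)
    qed (use assms R_bounds in \<open>auto simp: I W1_def inner_range_def outer_range_def block_size_def\<close>)
  qed
qed

lemma spec_listed:
  assumes "s 0 = I"
  shows "spec B R listed_prog s
    (\<lambda>s'. \<forall>v<n. s' vCol v = listed_coloring k (\<lambda>p. s vX 0 div n ^ p mod n) (k * k) v)"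
  unfolding listed_prog_def
proof (rule spec_Seq, rule spec_conseq[OF spec_clear[where m = n]], goal_cases)
  case (6 s1)
  then have s1: "s1 0 = I" "s1 vX = s vX" "\<And>v. v < n \<Longrightarrow> s1 vCol v = 0"
    using assms by (simp_all add: prog_defs)
  let ?f = "\<lambda>p. s vX 0 div n ^ p mod n"
  have "spec B R (For 38 (Mul eK eK) (Seq (Write vCol (Mod (Var vX) eN) (Add (Div (Var 38) eK) (Const 1)))
      (Set vX (Div (Var vX) eN)))) s1
    (\<lambda>s'. (\<forall>v<n. s' vCol v = listed_coloring k ?f (k * k) v) \<and> s' vX 0 = s vX 0 div n ^ (k * k))"
  proof (rule spec_For[where Inv = "\<lambda>j s'. (\<forall>v<n. s' vCol v = listed_coloring k ?f j v) \<and>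
      s' vX 0 = s vX 0 div n ^ j"], goal_cases)
    case (5 j s')
    have [simp]: "s' 0 = I" using 5(4) s1 by simp
    have "j div k < k" using 5(1) by (simp add: less_mult_imp_div_less)
    then have c: "Suc (j div k) \<le> B" using R_bounds(4) le_B by simp
    have x: "s' vX 0 div n \<le> B" using bounded_le[OF 5(3), of vX 0] by (meson div_le_dividend le_trans)
    show ?case
      by (intro spec_Seq spec_Write)
        (use 5(2,5) c x in \<open>auto simp: I div_mult2_eq[symmetric] mult.commute\<close>)
  qed (use s1 I R_bounds B_bounds in auto)
  then show ?case by (rule spec_conseq) simp
qed (use assms I R_bounds in auto)

section \<open>Correctness of the uncoloring and of the test\<close>

lemma spec_blocked:
  assumes "s 0 = I" "s 42 0 = v"
  shows "spec B R blocked_prog s (\<lambda>s'. s' vZ = (s vZ)(v :=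
    if \<exists>w<n. adjG v w \<and> s vRank v < s vRank w \<and> s vCol w = s vCol v then 0 else s vZ v))"
proof -
  define Q where "Q = (\<lambda>w. adjG v w \<and> s vRank v < s vRank w \<and> s vCol w = s vCol v)"
  have "spec B R blocked_prog s (\<lambda>s'. s' vZ = (s vZ)(v := if \<exists>w<n. Q w then 0 else s vZ v))"
    unfolding blocked_prog_def
  proof (rule spec_For[where Inv = "\<lambda>j s'. s' vZ = (s vZ)(v := if \<exists>w<j. Q w then 0 else s vZ v)"], goal_cases)
    case (5 j s')
    have [simp]: "s' 0 = I" "s' 42 0 = v" "s' vRank = s vRank" "s' vCol = s vCol" using 5(4) assms by simp_all
    show ?case
    proof (rule spec_If, goal_cases)
      case 1
      then have "Q j" using 5(2) by (auto simp: I mG_def Q_def split: if_splits)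
      then show ?case using 5(5) by (intro spec_Write) (auto simp: less_Suc_eq)
    next
      case 2
      then have "\<not> Q j" using 5(2) by (auto simp: I mG_def Q_def split: if_splits)
      then have "(\<exists>w<Suc j. Q w) \<longleftrightarrow> (\<exists>w<j. Q w)" by (auto simp: less_Suc_eq)
      then show ?case using 5(5) by (intro spec_Skip) simp
    qed
  qed (use assms I R_bounds B_bounds in auto)
  then show ?thesis by (simp only: Q_def)
qed

lemma spec_filter:
  assumes "s 0 = I"
  shows "spec B R filter_prog s (\<lambda>s'. \<forall>v<n. s' vZ v = unblocked n adjG (s vRank) (s vCol) v)"
  unfolding filter_prog_def
proof (rule spec_For[where
      Inv = "\<lambda>j s'. \<forall>v<j. s' vZ v = unblocked n adjG (s vRank) (s vCol) v"], goal_cases)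
  case (5 j s')
  have [simp]: "s' 0 = I" "s' vRank = s vRank" "s' vCol = s vCol" using 5(4) assms by (simp_all add: prog_defs)
  have cB: "s vCol j \<le> B" using bounded_le[OF 5(3), of vCol j] by simp
  show ?case
  proof (rule spec_Seq, rule spec_Write, goal_cases)
    case 1
    then show ?case using cB 5(2) by simp
  next
    case 2
    show ?case
      by (rule spec_conseq[OF spec_blocked[of _ j]])
        (use 5(2,5) in \<open>auto simp: unblocked_def less_Suc_eq\<close>)
  qed
qed (use assms I R_bounds B_bounds in \<open>auto simp: prog_defs\<close>)

lemma spec_neighbor:
  assumes "s 0 = I" "s 45 0 = v" "s 46 0 = j"
  shows "spec B R neighbor_prog s (\<lambda>s'. s' vEx 0 \<noteq> 0 \<longleftrightarrow> s vEx 0 \<noteq> 0 \<or> (\<exists>u<n. adjG u v \<and> s vZ u = Suc j))"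
  unfolding neighbor_prog_def
proof (rule spec_For[where
      Inv = "\<lambda>i s'. s' vEx 0 \<noteq> 0 \<longleftrightarrow> s vEx 0 \<noteq> 0 \<or> (\<exists>u<i. adjG u v \<and> s vZ u = Suc j)"], goal_cases)
  case (5 i s')
  have [simp]: "s' 0 = I" "s' 45 0 = v" "s' 46 0 = j" "s' vZ = s vZ" using 5(4) assms by simp_all
  show ?case
    by (intro spec_If spec_Write spec_Skip)
      (use 5(1,2,5) in \<open>auto simp: I mG_def less_Suc_eq split: if_splits\<close>)
qed (use assms I R_bounds B_bounds in auto)

definition "dominating z i v \<longleftrightarrow> (\<forall>j<i. \<exists>u<n. adjG u v \<and> z u = Suc j)"

lemma spec_dominates:
  assumes "s 0 = I" "s 45 0 = v" "s 44 0 = i" "i \<le> R"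
  shows "spec B R dominates_prog s (\<lambda>s'. s' vAll 0 \<noteq> 0 \<longleftrightarrow>
    s vAll 0 \<noteq> 0 \<and> dominating (s vZ) i v)"
  unfolding dominates_prog_def dominating_def
proof (rule spec_For[where Inv = "\<lambda>i s'. s' vAll 0 \<noteq> 0 \<longleftrightarrow>
    s vAll 0 \<noteq> 0 \<and> (\<forall>j<i. \<exists>u<n. adjG u v \<and> s vZ u = Suc j)"], goal_cases)
  case (5 j s')
  have [simp]: "s' 0 = I" "s' 45 0 = v" "s' vZ = s vZ" using 5(4) assms by (simp_all add: prog_defs)
  show ?case
  proof (rule spec_Seq, rule spec_Write, simp, rule spec_Seq, rule spec_conseq[OF spec_neighbor[of _ v j]], goal_cases)
    case (4 s'')
    then have [simp]: "s'' vAll = s' vAll" by (simp add: prog_defs)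
    show ?case
      by (intro spec_If spec_Write spec_Skip) (use 4(3) 5(5) in \<open>auto simp: less_Suc_eq\<close>)
  qed (use 5(2) in auto)
qed (use assms I R_bounds B_bounds in \<open>auto simp: prog_defs\<close>)

lemma spec_grundy_vertex:
  assumes "s 0 = I" "s 44 0 = i" "i \<le> R"
  shows "spec B R grundy_vertex_prog s (\<lambda>s'. s' vFound 0 \<noteq> 0 \<longleftrightarrow> s vFound 0 \<noteq> 0 \<or>
    (\<exists>v<n. s vZ v = Suc i \<and> dominating (s vZ) i v))"
  unfolding grundy_vertex_prog_def
proof (rule spec_For[where Inv = "\<lambda>m s'. s' vFound 0 \<noteq> 0 \<longleftrightarrow> s vFound 0 \<noteq> 0 \<or>
    (\<exists>v<m. s vZ v = Suc i \<and> dominating (s vZ) i v)"], goal_cases)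
  case (5 m s')
  have [simp]: "s' 0 = I" "s' 44 0 = i" "s' vZ = s vZ" using 5(4) assms by (simp_all add: prog_defs)
  show ?case
  proof (rule spec_If, goal_cases)
    case 1
    then have z: "s vZ m = Suc i" using 5(2) by (simp split: if_splits)
    show ?case
    proof (rule spec_Seq, rule spec_Write, simp, rule spec_Seq, rule spec_conseq[OF spec_dominates[of _ m i]], goal_cases)
      case (5 s'')
      then have [simp]: "s'' vFound = s' vFound" by (simp add: prog_defs)
      have "s'' vAll 0 \<noteq> 0 \<longleftrightarrow> dominating (s vZ) i m" using 5(3) by simp
      then show ?case
        using \<open>(s' vFound 0 \<noteq> 0) = _\<close> z by (intro spec_If spec_Write spec_Skip) (auto simp: less_Suc_eq)
    qed (use 5(2) assms(3) in auto)
  next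
    case 2
    then have "s vZ m \<noteq> Suc i" using 5(2) by (simp split: if_splits)
    then show ?case using 5(5) by (intro spec_Skip) (auto simp: less_Suc_eq)
  qed
qed (use assms I R_bounds B_bounds in \<open>auto simp: prog_defs\<close>)

lemma spec_check:
  assumes "s 0 = I"
  shows "spec B R check_prog s (\<lambda>s'. s' vOk 0 \<noteq> 0 \<longleftrightarrow> grundy_check n adjG k (s vZ))"
  unfolding check_prog_def grundy_check_iff dominating_def[symmetric]
proof (rule spec_Seq, rule spec_Write, simp, rule spec_For[where Inv = "\<lambda>m s'. s' vOk 0 \<noteq> 0 \<longleftrightarrow>
    (\<forall>i<m. \<exists>v<n. s vZ v = Suc i \<and> dominating (s vZ) i v)"], goal_cases)
  case (5 m s')
  have [simp]: "s' 0 = I" "s' vZ = s vZ" using 5(4) assms by (simp_all add: prog_defs)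
  have mR: "m \<le> R" using 5(1) R_bounds(4) by simp
  show ?case
  proof (rule spec_Seq, rule spec_Write, simp, rule spec_Seq, rule spec_conseq[OF spec_grundy_vertex[of _ m]], goal_cases)
    case (4 s'')
    then have [simp]: "s'' vOk = s' vOk" by (simp add: prog_defs)
    have "s'' vFound 0 \<noteq> 0 \<longleftrightarrow> (\<exists>v<n. s vZ v = Suc m \<and> dominating (s vZ) m v)"
      using 4(3) by simp
    then show ?case using 5(5) by (intro spec_If spec_Write spec_Skip) (auto simp: less_Suc_eq)
  qed (use 5(2) mR in auto)
qed (use assms I R_bounds B_bounds in \<open>auto simp: prog_defs\<close>)

definition "guessed_coloring ep e = (if direct then listed_coloring k (\<lambda>p. e div n ^ p mod n) (k * k)
  else decoded_coloring n d k l adjA ep e)"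

definition "success rk ep e \<longleftrightarrow> grundy_check n adjG k (unblocked n adjG rk (guessed_coloring ep e))"

text \<open>The answer cell is never reset, so it accumulates the disjunction over all
  guesses.\<close>

lemma spec_guess:
  assumes "s 0 = I" "s vMode 0 \<noteq> 0 \<longleftrightarrow> direct"
  shows "spec B R guess_prog s
    (\<lambda>s'. s' 1 0 \<noteq> 0 \<longleftrightarrow> s 1 0 \<noteq> 0 \<or> success (s vRank) (s vEnd) (s 48 0))"
  unfolding guess_prog_def
proof (rule spec_Seq, rule spec_Write, goal_cases)
  case 1
  then show ?case by (simp add: bounded_le)
next
  case 2
  let ?s = "s(vX := (s vX)(eval (Const 0) s := eval (Var 48) s))"
  have "spec B R (If (Var vMode) listed_prog decode_prog) ?s
      (\<lambda>s'. \<forall>v<n. s' vCol v = guessed_coloring (s vEnd) (s 48 0) v)"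
    by (intro spec_If spec_conseq[OF spec_listed] spec_conseq[OF spec_decode])
      (use assms in \<open>simp_all add: guessed_coloring_def\<close>)
  then show ?case
  proof (rule spec_Seq[OF spec_conseq], goal_cases)
    case (1 s1)
    have s1: "s1 0 = I" "s1 vRank = s vRank" "s1 1 = s 1" using 1(2) assms by (simp_all add: prog_defs)
    show ?case
    proof (rule spec_Seq, rule spec_conseq[OF spec_filter[where s = s1, OF s1(1)]], goal_cases)
      case (1 s2)
      have s2: "s2 0 = I" "s2 1 = s 1" using 1(2) s1 by (simp_all add: prog_defs)
      have "s2 vZ v = unblocked n adjG (s vRank) (guessed_coloring (s vEnd) (s 48 0)) v" if "v < n" for v
        using 1(3) that s1(2) unblocked_cong[of n "s1 vCol" "guessed_coloring (s vEnd) (s 48 0)" v]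
          \<open>\<forall>v<n. s1 vCol v = _ v\<close> by simp
      then have suc: "grundy_check n adjG k (s2 vZ) \<longleftrightarrow> success (s vRank) (s vEnd) (s 48 0)"
        unfolding success_def by (rule grundy_check_cong)
      show ?case
      proof (rule spec_Seq, rule spec_conseq[OF spec_check[where s = s2, OF s2(1)]], goal_cases)
        case (1 s3)
        have "s3 1 = s 1" using 1(2) s2 by (simp add: prog_defs)
        then show ?case using 1(3) suc by (intro spec_If spec_Write spec_Skip) auto
      qed
    qed
  qed
qed


section \<open>The complete run\<close>

lemma guesses_le_B: "guesses \<le> B"
  using B_bounds by (simp add: guesses_def)

lemma guesses_pos: "0 < guesses"
  using pos num_guesses_pos by (simp add: guesses_def)

lemma spec_setup:
  assumes "s 0 = I" "\<And>v. s vRank v = 0"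
    and degenerate: "\<And>U. U \<subseteq> {..<n} \<Longrightarrow> U \<noteq> {} \<Longrightarrow> \<exists>v\<in>U. card {w \<in> U. mH (v * n + w) \<noteq> 0} \<le> d"
    and edge: "\<And>t. t < l \<Longrightarrow> \<exists>p<n * n. mA t p \<noteq> 0"
  shows "spec B R setup_prog s (\<lambda>s'. ranking n (s' vRank) \<and> (\<forall>t<l. edge_at (s' vEnd) t) \<and>
    (s' vMode 0 \<noteq> 0 \<longleftrightarrow> direct) \<and> s' vE 0 = guesses)"
  unfolding setup_prog_def
proof (rule spec_Seq, rule spec_conseq[OF spec_diff[where s = s, OF assms(1)]], goal_cases)
  case (1 s1)
  have s1: "s1 0 = I" "s1 vRank = s vRank" using 1(2) assms(1) by (simp_all add: prog_defs)
  show ?case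
  proof (rule spec_Seq, rule spec_conseq[OF spec_rank[where s = s1]], goal_cases)
    case (5 s2)
    have s2: "s2 0 = I" using 5(2) s1 by (simp add: prog_defs)
    show ?case
    proof (rule spec_Seq, rule spec_conseq[OF spec_edge[where s = s2, OF s2 edge]], goal_cases)
      case (2 s3)
      have s3: "s3 0 = I" "s3 vRank = s2 vRank" using 2(2) s2 by (simp_all add: prog_defs)
      show ?case
      proof (rule spec_conseq[OF spec_limit[where s = s3, OF s3(1)]], goal_cases)
        case (1 s4)
        have "s4 vRank = s3 vRank" "s4 vEnd = s3 vEnd" using 1(2) by (simp_all add: prog_defs)
        then show ?case using 1(3) 2(3) 5(3) s3(2) by simp
      qed
    qed
  qed (use s1 1(3) assms(2) degenerate in simp_all)
qed

text \<open>Only the loop over the guesses contributes the factor \<open>Suc guesses\<close>. Ranks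
  and endpoints are known through their specifications, hence the existential \<open>rk\<close> and
  \<open>ep\<close>.\<close>

lemma grundy_prog_run:
  assumes "bounded_by B s" "s 0 = I" "\<And>v. s vRank v = 0" "s 1 0 = 0"
    and degenerate: "\<And>U. U \<subseteq> {..<n} \<Longrightarrow> U \<noteq> {} \<Longrightarrow> \<exists>v\<in>U. card {w \<in> U. mH (v * n + w) \<noteq> 0} \<le> d"
    and edge: "\<And>t. t < l \<Longrightarrow> \<exists>p<n * n. mA t p \<noteq> 0"
  shows "\<exists>t s' rk ep. exec grundy_prog s t s' \<and> t \<le> Suc guesses * cost R grundy_prog * bitlen B \<and>
    ranking n rk \<and> (\<forall>t<l. edge_at ep t) \<and> (s' 1 0 \<noteq> 0 \<longleftrightarrow> (\<exists>e<guesses. success rk ep e))"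
proof -
  let ?Q = "\<lambda>s'. \<exists>rk ep. ranking n rk \<and> (\<forall>t<l. edge_at ep t) \<and> (s' 1 0 \<noteq> 0 \<longleftrightarrow> (\<exists>e<guesses. success rk ep e))"
  let ?L = "For 48 (Var vE) guess_prog"
  have run: "ensures B (cost R setup_prog + Suc guesses * cost R ?L) grundy_prog s ?Q"
    unfolding grundy_prog_def
  proof (rule ensures_Seq, rule spec_conseq[OF spec_setup[where s = s]], goal_cases)
    case (5 s1)
    have s1: "s1 0 = I" "s1 1 = s 1" using 5(2) assms(2) by (simp_all add: prog_defs)
    note init = 5(3)
    show ?case
    proof (rule ensures_conseq[OF ensures_For[where n = guesses and R = R and
          Inv = "\<lambda>j s'. s' 1 0 \<noteq> 0 \<longleftrightarrow> (\<exists>e<j. success (s1 vRank) (s1 vEnd) e)"]], goal_cases)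
      case (5 j s')
      have [simp]: "s' 0 = I" "s' vRank = s1 vRank" "s' vEnd = s1 vEnd" "s' vMode = s1 vMode"
        using 5(4) s1 by (simp_all add: prog_defs)
      show ?case
        by (rule spec_conseq[OF spec_guess[where s = s']])
          (use init 5(2,5) in \<open>auto simp: less_Suc_eq\<close>)
    next
      case (7 s')
      then show ?case using init by blast
    qed (use s1 init assms(4) guesses_le_B in \<open>auto simp: prog_defs\<close>)
  qed (use assms(2,3) degenerate edge in auto)
  have "cost R setup_prog + Suc guesses * cost R ?L \<le> Suc guesses * cost R grundy_prog"
    by (simp add: grundy_prog_def distrib_left)
  then have "ensures B (Suc guesses * cost R grundy_prog) grundy_prog s ?Q"
    by (rule ensures_conseq[OF run, rotated])
  then show ?thesis using assms(1) unfolding ensures_def by blast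
qed

text \<open>After splitting the power of \<open>inner_range d k * outer_range d k\<close>,
  \<open>B\<close> is a product of ten factors, each at most \<open>R ^ R\<close>; and
  \<open>R < 2 ^ R\<close>.\<close>

lemma bitlen_B: "bitlen B \<le> 10 * R * R"
proof -
  have R2: "2 \<le> R" using R_bounds(11) by simp
  have mult_le: "y \<le> R" if "x * y \<le> R" "0 < x" for x y :: nat
    using that by (metis le_trans mult.commute mult_le_mono1 mult_1 Suc_leI One_nat_def)
  have inner: "inner_range d k \<le> R" using R_bounds(9) pos(1) by (rule mult_le)
  then have block: "block_size d k \<le> R" unfolding inner_range_def using pos(1) by (rule mult_le)
  have outer: "outer_range d k \<le> R" using R_bounds(9) by (simp add: outer_range_def)
  have pw: "x ^ i \<le> R ^ R" if "x \<le> R" "i \<le> R" for x i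
  proof -
    have "x ^ i \<le> R ^ i" using that by (intro power_mono) auto
    also have "\<dots> \<le> R ^ R" using that R2 by (intro power_increasing) auto
    finally show ?thesis .
  qed
  have "(inner_range d k * outer_range d k) ^ k = inner_range d k ^ k * outer_range d k ^ k"
    by (rule power_mult_distrib)
  also have "\<dots> \<le> R ^ R * R ^ R" using R_bounds(4) inner outer by (intro mult_le_mono pw)
  finally have W1: "(inner_range d k * outer_range d k) ^ k \<le> R ^ R * R ^ R" .
  have "num_guesses n d k l \<le> R ^ R * (R ^ R * R ^ R) * R ^ R * R ^ R * R ^ R"
    unfolding num_guesses_def
    by (intro mult_le_mono W1 pw R_bounds block R2) (use pw[of "outer_range d k * n" 1] R_bounds in auto)
  then have "B \<le> R ^ R * R ^ R * R ^ R * R ^ R * (R ^ R * (R ^ R * R ^ R) * R ^ R * R ^ R * R ^ R)"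
    unfolding B_def
    by (intro mult_le_mono pw R_bounds R2) (use pw[of R 1] R_bounds in auto)
  also have "\<dots> = (R ^ R) ^ 10" by (simp add: eval_nat_numeral mult_ac)
  also have "\<dots> = R ^ (10 * R)" by (simp add: power_mult[symmetric] mult.commute)
  also have "\<dots> < (2 ^ R) ^ (10 * R)" using R2 by (intro power_strict_mono) auto
  also have "\<dots> = 2 ^ (10 * R * R)" by (simp add: power_mult[symmetric] mult_ac)
  finally show ?thesis using R2 by (intro bitlen_le) auto
qed

end

section \<open>Bounding the running time\<close>

lemma self_le_two_power: "(x::nat) \<le> 2 ^ x"
  by simp

lemma power_le_two_power:
  assumes "c \<le> 2 ^ j" "j * e \<le> m"
  shows "(c::nat) ^ e \<le> 2 ^ m"
proof -
  have "c ^ e \<le> (2 ^ j) ^ e" using assms(1) by (rule power_mono) simp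
  also have "\<dots> = 2 ^ (j * e)" by (simp add: power_mult)
  also have "\<dots> \<le> 2 ^ m" using assms(2) by (intro power_increasing) auto
  finally show ?thesis .
qed

text \<open>Powers of 13 and \<open>d\<close>, and powers of \<open>k\<close> with exponent
  \<open>O(k)\<close>, disappear in \<open>2 ^ (34 * (k * k * d))\<close>, where 34 = 9 + 17 + 2 + 6
  collects four fields. Only the offsets of the marks leave a factor
  \<open>k ^ (k * k)\<close>.\<close>

lemma num_guesses_le:
  assumes "0 < k" "0 < d"
  shows "num_guesses n d k l \<le> 2 ^ (34 * (k * k * d)) * 2 ^ (l * k) * k ^ (k * k) * n"
proof -
  define X where "X = k * k * d"
  have X: "1 \<le> X" "d \<le> X" "k \<le> X" "k * k \<le> X" "d * k \<le> X" "d * (k * k) = X"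
    using assms by (auto simp: X_def mult_ac)
  have kk: "k \<le> k * k" using assms by simp
  have p13: "(13::nat) ^ i \<le> 2 ^ m" if "m \<ge> 4 * i" for i m
    using that by (rule power_le_two_power[rotated]) simp
  have pself: "x ^ i \<le> 2 ^ m" if "m \<ge> x * i" for x i m :: nat
    using that by (rule power_le_two_power[rotated]) simp
  define q where "q = k * Suc k div 2"
  have q2: "2 * q = k * k + k" unfolding q_def by (subst dvd_mult_div_cancel) auto
  have qk: "q \<le> k * k" using q2 kk by linarith
  have k4: "k ^ 4 = k * (k * (k * k))" and k7: "k ^ 7 = k * (k * (k * (k * (k * (k * k)))))"
    by (simp_all add: eval_nat_numeral)
  have "outer_range d k = 13 ^ 1 * d ^ 1 * k ^ 4"
    by (simp only: outer_range_def inner_range_def block_size_def k4 power_one_right mult_ac)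
  also have "\<dots> \<le> 2 ^ (4 * X) * 2 ^ X * 2 ^ (4 * X)"
    by (rule mult_le_mono[OF mult_le_mono[OF p13 pself] pself]) (use X in auto)
  also have "\<dots> = 2 ^ (9 * X)" by (simp add: power_add[symmetric])
  finally have 1: "outer_range d k \<le> 2 ^ (9 * X)" .
  have "(inner_range d k * outer_range d k) ^ k = (13 ^ 2 * d ^ 2 * k ^ 7) ^ k"
    by (simp only: outer_range_def inner_range_def block_size_def k7 power2_eq_square mult_ac)
  also have "\<dots> = 13 ^ (2 * k) * d ^ (2 * k) * k ^ (7 * k)" by (simp only: power_mult_distrib power_mult[symmetric])
  also have "\<dots> \<le> 2 ^ (8 * X) * 2 ^ (2 * X) * 2 ^ (7 * X)"
    by (rule mult_le_mono[OF mult_le_mono[OF p13 pself] pself]) (use X in auto)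
  also have "\<dots> = 2 ^ (17 * X)" by (simp add: power_add[symmetric])
  finally have 2: "(inner_range d k * outer_range d k) ^ k \<le> 2 ^ (17 * X)" .
  have 3: "(2::nat) ^ (2 * k * k) \<le> 2 ^ (2 * X)" using X by (intro power_increasing) auto
  \<comment> \<open>The factor \<open>k * k\<close> in a block doubles the exponent
    \<open>q\<close>, and \<open>k ^ (2 * q) = k ^ (k * k) * k ^ k\<close>.\<close>
  have "block_size d k ^ q = 13 ^ q * d ^ q * k ^ (2 * q)"
    unfolding block_size_def power_mult_distrib mult_2 power_add by (simp only: mult_ac)
  also have "\<dots> = 13 ^ q * d ^ q * k ^ k * k ^ (k * k)" by (simp add: q2 power_add)
  also have "\<dots> \<le> 2 ^ (4 * X) * 2 ^ X * 2 ^ X * k ^ (k * k)"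
  proof -
    have "d * q \<le> X" using mult_le_mono2[OF qk, of d] X by simp
    then show ?thesis
      by (intro mult_le_mono1, intro mult_le_mono[OF mult_le_mono[OF p13 pself] pself]) (use X qk in auto)
  qed
  also have "\<dots> = 2 ^ (6 * X) * k ^ (k * k)" by (simp add: power_add[symmetric])
  finally have 4: "block_size d k ^ q \<le> 2 ^ (6 * X) * k ^ (k * k)" .
  have "num_guesses n d k l \<le> (2 ^ (9 * X) * n) * 2 ^ (17 * X) * 2 ^ (l * k) * 2 ^ (2 * X) * (2 ^ (6 * X) * k ^ (k * k))"
    unfolding num_guesses_def q_def[symmetric] by (intro mult_le_mono 1 2 3 4 order_refl)
  also have "\<dots> = 2 ^ (9 * X + 17 * X + 2 * X + 6 * X) * 2 ^ (l * k) * k ^ (k * k) * n"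
    by (simp only: power_add mult_ac)
  also have "9 * X + 17 * X + 2 * X + 6 * X = 34 * (k * k * d)" by (simp add: X_def)
  finally show ?thesis .
qed

text \<open>Raise \<open>y \<le> 2 powr y\<close> at \<open>y = l / m\<close> to the power
  \<open>m\<close>. A fixed power of \<open>l\<close> thus costs a constant and one factor
  \<open>2 ^ l\<close>.\<close>

lemma power_le_self_power_mult_two_power: "(l::nat) ^ m \<le> m ^ m * 2 ^ l"
proof (cases "m = 0")
  case False
  have "real l = real m * (real l / real m)" using False by simp
  also have "\<dots> \<le> real m * 2 powr (real l / real m)"
  proof (intro mult_left_mono)
    have "real l / real m \<le> of_nat (nat \<lfloor>real l / real m\<rfloor>) + 1" by linarith
    also have "\<dots> \<le> 2 ^ nat \<lfloor>real l / real m\<rfloor>"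
      using less_exp[of "nat \<lfloor>real l / real m\<rfloor>"] by (metis Suc_leI add.commute of_nat_Suc of_nat_le_iff of_nat_numeral of_nat_power)
    also have "\<dots> = 2 powr of_nat (nat \<lfloor>real l / real m\<rfloor>)" by (rule powr_realpow[symmetric]) simp
    also have "\<dots> \<le> 2 powr (real l / real m)" by (intro powr_mono) auto
    finally show "real l / real m \<le> 2 powr (real l / real m)" .
  qed simp
  finally have "real l ^ m \<le> (real m * 2 powr (real l / real m)) ^ m" by (intro power_mono) auto
  also have "\<dots> = real m ^ m * 2 ^ l"
    using False by (simp add: power_mult_distrib powr_power powr_realpow)
  finally have "real (l ^ m) \<le> real (m ^ m * 2 ^ l)" by (simp only: of_nat_mult of_nat_power of_nat_numeral)
  then show ?thesis by (simp only: of_nat_le_iff)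
qed simp

text \<open>The critical factor is \<open>l ^ e\<close>, as \<open>l\<close> has no bound in terms
  of the other parameters; \<open>main\<close> absorbs it in both modes.\<close>

lemma guesses_polynomial_le:
  fixes C e :: nat
  obtains a b where "\<And>n d k l. 0 < k \<Longrightarrow> 0 < d \<Longrightarrow> 0 < l \<Longrightarrow> 2 \<le> n \<Longrightarrow>
    (if n ^ (2 * k) \<le> 2 ^ l then n ^ (k * k) else num_guesses n d k l) *
      (C * (13 * d * (k * k * k * k) * (n * n) * l) ^ e)
    \<le> 2 ^ (a * (k * k * d)) * (2 ^ (l * k) * k ^ (k * k)) * n ^ b"
proof -
  define K where "K = Suc C * (13 ^ e * (2 ^ e * (Suc (2 * e) ^ (2 * e))))"
  show thesis
  \<comment> \<open>The power of 2 gets \<open>34 + e\<close> from \<open>main\<close>,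
    \<open>e\<close> from \<open>d ^ e\<close> and \<open>4 * e\<close> from
    \<open>k ^ (4 * e)\<close>. The power of \<open>n\<close> gets \<open>e + 1\<close> from
    \<open>main\<close> and \<open>2 * e\<close> from \<open>R\<close>; constants enter by
    \<open>K \<le> 2 ^ K \<le> n ^ K\<close>.\<close>
  proof (rule that[of "34 + 6 * e" "3 * e + 1 + K"])
    fix n d k l :: nat
    assume p: "0 < k" "0 < d" "0 < l" "2 \<le> n"
    define X where "X = k * k * d"
    define R where "R = 13 * d * (k * k * k * k) * (n * n) * l"
    have X: "1 \<le> X" "d \<le> X" "k \<le> X" using p by (auto simp: X_def mult_ac)
    have R: "R ^ e = 13 ^ e * d ^ e * k ^ (4 * e) * n ^ (2 * e) * l ^ e"
    proof -
      have "R = 13 * d * k ^ 4 * n ^ 2 * l"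
        by (simp add: R_def power2_eq_square power4_eq_xxxx mult_ac)
      then show ?thesis by (simp only: power_mult_distrib power_mult[symmetric])
    qed
    have de: "d ^ e \<le> 2 ^ (e * X)"
      by (rule power_le_two_power[OF self_le_two_power]) (use X in \<open>simp add: mult.commute\<close>)
    have ke: "k ^ (4 * e) \<le> 2 ^ (4 * e * X)" "k ^ e \<le> 2 ^ (e * X)"
      by (rule power_le_two_power[OF self_le_two_power], use X in \<open>simp add: mult.commute\<close>)+
    have main: "(if n ^ (2 * k) \<le> 2 ^ l then n ^ (k * k) else num_guesses n d k l) * l ^ e
       \<le> (2 ^ e * (Suc (2 * e) ^ (2 * e))) * (2 ^ ((34 + e) * X) * (2 ^ (l * k) * k ^ (k * k)) * n ^ (e + 1))"
    proof (cases "n ^ (2 * k) \<le> 2 ^ l")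
      case True
      \<comment> \<open>Squaring turns \<open>n ^ (k * k)\<close> into
        \<open>(n ^ (2 * k)) ^ k \<le> 2 ^ (l * k)\<close>, which leaves another
        \<open>2 ^ (l * k)\<close> to pay for \<open>l ^ (2 * e)\<close>.\<close>
      have "(n ^ (k * k) * l ^ e)\<^sup>2 = (n ^ (2 * k)) ^ k * l ^ (2 * e)"
        by (simp add: power_mult_distrib power_mult[symmetric] mult_ac)
      also have "\<dots> \<le> (2 ^ l) ^ k * (Suc (2 * e) ^ (2 * e) * 2 ^ l)"
      proof (intro mult_le_mono)
        show "(n ^ (2 * k)) ^ k \<le> (2 ^ l) ^ k" using True by (intro power_mono) auto
        have "l ^ (2 * e) \<le> (2 * e) ^ (2 * e) * 2 ^ l" by (rule power_le_self_power_mult_two_power)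
        also have "\<dots> \<le> Suc (2 * e) ^ (2 * e) * 2 ^ l" by (intro mult_le_mono1 power_mono) auto
        finally show "l ^ (2 * e) \<le> Suc (2 * e) ^ (2 * e) * 2 ^ l" .
      qed
      also have "\<dots> \<le> 2 ^ (l * k) * (Suc (2 * e) ^ (2 * e) * 2 ^ (l * k))"
        using p by (intro mult_le_mono order_refl power_increasing) (auto simp: power_mult)
      also have "\<dots> \<le> (Suc (2 * e) ^ (2 * e) * 2 ^ (l * k))\<^sup>2"
        by (simp add: power2_eq_square Suc_le_eq)
      finally have "n ^ (k * k) * l ^ e \<le> Suc (2 * e) ^ (2 * e) * 2 ^ (l * k)"
        by (rule power2_le_imp_le) simp
      also have "\<dots> = 1 * Suc (2 * e) ^ (2 * e) * (1 * (2 ^ (l * k) * 1) * 1)" by simp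
      also have "\<dots> \<le> (2 ^ e * (Suc (2 * e) ^ (2 * e))) * (2 ^ ((34 + e) * X) * (2 ^ (l * k) * k ^ (k * k)) * n ^ (e + 1))"
        by (intro mult_le_mono order_refl one_le_power) (use p in auto)
      finally show ?thesis using True by simp
    next
      case False
      \<comment> \<open>Now \<open>l\<close> is at most \<open>2 * k * n\<close>, so its powers are
        harmless.\<close>
      have "(2::nat) ^ l < n ^ (2 * k)" using False by simp
      also have "\<dots> \<le> 2 ^ (n * (2 * k))" by (rule power_le_two_power[OF self_le_two_power]) simp
      finally have "l \<le> 2 * k * n" by (simp add: mult_ac)
      then have "l ^ e \<le> (2 * k * n) ^ e" by (rule power_mono) simp
      also have "\<dots> = 2 ^ e * k ^ e * n ^ e" by (simp add: power_mult_distrib)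
      also have "\<dots> \<le> 2 ^ e * 2 ^ (e * X) * n ^ e" using ke(2) by (intro mult_le_mono) auto
      finally have le: "l ^ e \<le> 2 ^ e * 2 ^ (e * X) * n ^ e" .
      have "num_guesses n d k l * l ^ e \<le>
          (2 ^ (34 * X) * 2 ^ (l * k) * k ^ (k * k) * n) * (2 ^ e * 2 ^ (e * X) * n ^ e)"
        unfolding X_def by (intro mult_le_mono num_guesses_le p le[unfolded X_def])
      also have "\<dots> = 2 ^ e * (2 ^ ((34 + e) * X) * (2 ^ (l * k) * k ^ (k * k)) * n ^ (e + 1))"
        unfolding power_add distrib_right power_one_right by (simp only: mult_ac)
      also have "\<dots> \<le> (2 ^ e * (Suc (2 * e) ^ (2 * e))) * (2 ^ ((34 + e) * X) * (2 ^ (l * k) * k ^ (k * k)) * n ^ (e + 1))"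
        by (intro mult_le_mono1) simp
      finally show ?thesis using False by simp
    qed
    let ?g = "if n ^ (2 * k) \<le> 2 ^ l then n ^ (k * k) else num_guesses n d k l"
    let ?m = "2 ^ e * (Suc (2 * e) ^ (2 * e))"
    have K: "C * (13 ^ e * ?m) \<le> n ^ K"
    proof -
      have "C * (13 ^ e * ?m) \<le> K" by (simp add: K_def)
      also have "\<dots> \<le> 2 ^ K" by (rule self_le_two_power)
      also have "\<dots> \<le> n ^ K" using p by (intro power_mono) auto
      finally show ?thesis .
    qed
    have "?g * (C * R ^ e) = (C * 13 ^ e) * (d ^ e * k ^ (4 * e)) * n ^ (2 * e) * (?g * l ^ e)"
      by (simp only: R mult_ac)
    also have "\<dots> \<le> (C * 13 ^ e) * (2 ^ (e * X) * 2 ^ (4 * e * X)) * n ^ (2 * e) *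
        (?m * (2 ^ ((34 + e) * X) * (2 ^ (l * k) * k ^ (k * k)) * n ^ (e + 1)))"
      by (intro mult_le_mono order_refl de ke main)
    also have "\<dots> = (C * (13 ^ e * ?m)) * (2 ^ (e * X + 4 * e * X + (34 + e) * X) * (2 ^ (l * k) * k ^ (k * k)) *
        n ^ (2 * e + (e + 1)))"
      by (simp only: power_add mult_ac)
    also have "\<dots> \<le> n ^ K * (2 ^ (e * X + 4 * e * X + (34 + e) * X) * (2 ^ (l * k) * k ^ (k * k)) *
        n ^ (2 * e + (e + 1)))"
      by (rule mult_le_mono1[OF K])
    also have "\<dots> = 2 ^ (e * X + 4 * e * X + (34 + e) * X) * (2 ^ (l * k) * k ^ (k * k)) * n ^ (2 * e + (e + 1) + K)"
      by (simp only: power_add mult_ac)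
    also have "e * X + 4 * e * X + (34 + e) * X = (34 + 6 * e) * (k * k * d)"
      by (simp add: X_def algebra_simps)
    also have "2 * e + (e + 1) + K = 3 * e + 1 + K" by simp
    finally show "?g * (C * (13 * d * (k * k * k * k) * (n * n) * l) ^ e)
      \<le> 2 ^ ((34 + 6 * e) * (k * k * d)) * (2 ^ (l * k) * k ^ (k * k)) * n ^ (3 * e + 1 + K)"
      by (simp only: R_def)
  qed
qed

section \<open>Instances\<close>

lemma length_concat_uniform:
  "(\<And>xs. xs \<in> set xss \<Longrightarrow> length xs = c) \<Longrightarrow> length (concat xss) = length xss * c"
  by (induction xss) auto

lemma nth_concat_uniform:
  "(\<And>xs. xs \<in> set xss \<Longrightarrow> length xs = c) \<Longrightarrow> i < length xss \<Longrightarrow> j < c \<Longrightarrow>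
    concat xss ! (i * c + j) = xss ! i ! j"
proof (induction xss arbitrary: i)
  case (Cons xs xss)
  then show ?case by (cases i) (auto simp: nth_append)
qed simp

lemma length_adjacency_matrix: "length (adjacency_matrix n G) = n * n"
  unfolding adjacency_matrix_def by (subst length_concat_uniform[where c = n]) auto

lemma nth_adjacency_matrix:
  assumes "u < n" "v < n"
  shows "adjacency_matrix n G ! (u * n + v) = (if {u, v} \<in> edges G then 1 else 0)"
  unfolding adjacency_matrix_def using assms by (subst nth_concat_uniform[where c = n]) auto

lemma div_mod_index:
  assumes "p < n * (n::nat)"
  shows "p div n < n" "p mod n < n" "p div n * n + p mod n = p"
proof -
  have "0 < n" using assms by (cases n) auto
  then show "p div n < n" "p mod n < n" "p div n * n + p mod n = p"
    using assms by (simp_all add: less_mult_imp_div_less)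
qed

lemma index_less: "u < n \<Longrightarrow> v < n \<Longrightarrow> u * n + v < n * (n::nat)"
proof -
  assume "u < n" "v < n"
  then have "u * n + v < Suc u * n" by simp
  also have "\<dots> \<le> n * n" using \<open>u < n\<close> by (intro mult_le_mono1) simp
  finally show ?thesis .
qed

lemma spgc_encode_graph:
  assumes "p < num_vertices x * num_vertices x"
  shows "initial (spgc_encode x) 0 (4 + p) = adjacency_matrix (num_vertices x) (graph x) ! p"
  using assms by (simp add: initial_def spgc_encode_def nth_append length_adjacency_matrix)

text \<open>The matrix of the graph comes first, whence the shift to \<open>t + 1\<close>.\<close>

lemma spgc_encode_biclique:
  assumes "t < length (bicliques x)" "p < num_vertices x * num_vertices x"
  shows "initial (spgc_encode x) 0 (4 + (num_vertices x * num_vertices x * (t + 1) + p)) =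
    adjacency_matrix (num_vertices x) (bicliques x ! t) ! p"
proof -
  let ?n = "num_vertices x"
  let ?C = "map (adjacency_matrix ?n) (bicliques x)"
  have len: "length (concat ?C) = length (bicliques x) * (?n * ?n)"
    by (subst length_concat_uniform[where c = "?n * ?n"]) (auto simp: length_adjacency_matrix)
  have "t * (?n * ?n) + p < Suc t * (?n * ?n)" using assms(2) by simp
  also have "\<dots> \<le> length (bicliques x) * (?n * ?n)" using assms(1) by (intro mult_le_mono1) simp
  finally have lt: "t * (?n * ?n) + p < length (bicliques x) * (?n * ?n)" .
  have idx: "4 + (?n * ?n * (t + 1) + p) = 4 + (?n * ?n + (t * (?n * ?n) + p))" by (simp add: algebra_simps)
  have "initial (spgc_encode x) 0 (4 + (?n * ?n + (t * (?n * ?n) + p))) = concat ?C ! (t * (?n * ?n) + p)"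
    using lt len by (simp add: initial_def spgc_encode_def nth_append length_adjacency_matrix)
  also have "\<dots> = ?C ! t ! p"
    using assms by (intro nth_concat_uniform) (auto simp: length_adjacency_matrix)
  finally show ?thesis using assms(1) unfolding idx by simp
qed

lemma initial_bounded:
  assumes "2 \<le> M" "\<And>y. y \<in> set xs \<Longrightarrow> y \<le> M"
  shows "bounded_by M (initial xs)"
  using assms by (auto simp: bounded_by_def initial_def)

lemma set_adjacency_matrix: "y \<in> set (adjacency_matrix n G) \<Longrightarrow> y \<le> 1"
  by (auto simp: adjacency_matrix_def split: if_splits)

text \<open>Matrix entries and edge sets agree for vertices below \<open>n\<close> only, so
  relations are exchanged just at the arguments that occur.\<close>

lemma decoded_coloring_cong:
  assumes "\<And>t b. t < l \<Longrightarrow> b < 2 \<Longrightarrow> A t (ep (2 * t + b)) v \<longleftrightarrow> A' t (ep (2 * t + b)) v"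
  shows "decoded_coloring n d k l A ep e v = decoded_coloring n d k l A' ep e v"
  using assms by (auto simp: decoded_coloring_def hashed_coloring_def Let_def intro!: pick_cong)

lemma grundy_check_mono_adj:
  assumes "grundy_check n adj k z" "\<And>u v. u < n \<Longrightarrow> v < n \<Longrightarrow> adj u v \<Longrightarrow> adj' u v"
  shows "grundy_check n adj' k z"
  unfolding grundy_check_iff
proof (intro allI impI)
  fix i assume "i < k"
  then obtain v where v: "v < n" "z v = Suc i" "\<forall>j<i. \<exists>u<n. adj u v \<and> z u = Suc j"
    using assms(1) unfolding grundy_check_iff by blast
  then have "\<forall>j<i. \<exists>u<n. adj' u v \<and> z u = Suc j" using assms(2) by blast
  then show "\<exists>v<n. z v = Suc i \<and> (\<forall>j<i. \<exists>u<n. adj' u v \<and> z u = Suc j)" using v by blast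
qed

lemma grundy_check_unblocked_cong:
  assumes adj: "\<And>u v. u < n \<Longrightarrow> v < n \<Longrightarrow> adj u v \<longleftrightarrow> adj' u v" and c: "\<And>v. v < n \<Longrightarrow> c v = c' v"
  shows "grundy_check n adj k (unblocked n adj rk c) \<longleftrightarrow> grundy_check n adj' k (unblocked n adj' rk c')"
proof -
  have u: "unblocked n adj rk c v = unblocked n adj' rk c' v" if v: "v < n" for v
  proof -
    have "(\<exists>w<n. adj v w \<and> rk v < rk w \<and> c w = c v) \<longleftrightarrow> (\<exists>w<n. adj' v w \<and> rk v < rk w \<and> c' w = c' v)"
      using adj[OF v] c v by auto
    then show ?thesis unfolding unblocked_def using c[OF v] by (simp only:)
  qed
  have "grundy_check n adj k z \<longleftrightarrow> grundy_check n adj' k z" for z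
    using grundy_check_mono_adj[of n adj k z adj'] grundy_check_mono_adj[of n adj' k z adj] adj by blast
  then show ?thesis using grundy_check_cong[OF u, where adj = adj' and k = k] by simp
qed

lemma biclique_edge_exists:
  assumes "biclique A" "subgraph A G" "verts G = {..<n}"
  obtains u v where "u < n" "v < n" "u \<noteq> v" "{u, v} \<in> edges A"
proof -
  from assms(1) obtain L R where LR: "L \<noteq> {}" "R \<noteq> {}" "L \<inter> R = {}" "verts A = L \<union> R"
    "edges A = {{u, v} | u v. u \<in> L \<and> v \<in> R}"
    unfolding biclique_def by (elim exE conjE)
  then obtain u v where uv: "u \<in> L" "v \<in> R" by blast
  have "{u, v} \<in> edges A" unfolding LR(5) using uv by blast
  moreover have "u < n" "v < n" using uv LR(4) assms(2,3) unfolding subgraph_def by auto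
  moreover have "u \<noteq> v" using uv LR(3) by blast
  ultimately show thesis using that by blast
qed

section \<open>A fixed valid instance\<close>

locale spgc_instance =
  fixes x :: spgc_input
  assumes valid: "spgc_valid x"
begin

abbreviation "k \<equiv> colors x"
abbreviation "d \<equiv> degeneracy x"
abbreviation "l \<equiv> length (bicliques x)"
abbreviation "n \<equiv> num_vertices x"
abbreviation "adjE u v \<equiv> {u, v} \<in> edges (graph x)"
abbreviation "adjB t u v \<equiv> {u, v} \<in> edges (bicliques x ! t)"
abbreviation "R \<equiv> 13 * d * (k * k * k * k) * (n * n) * l"
abbreviation "B \<equiv> R * 2 ^ l * n ^ (2 * k) * n ^ (k * k) * num_guesses n d k l"

lemma G: "simple_graph (graph x)" "verts (graph x) = {..<n}"
  and pos: "0 < k" "0 < d" "0 < l"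
  and degen: "degenerate d (delete_edges (graph x) (\<Union>A \<in> set (bicliques x). edges A))"
  using valid by (auto simp: spgc_valid_def)

lemma bicl: "t < l \<Longrightarrow> subgraph (bicliques x ! t) (graph x) \<and> biclique (bicliques x ! t)"
  using valid nth_mem[of t "bicliques x"] unfolding spgc_valid_def by blast

lemma bicl_edge:
  assumes "t < l"
  obtains u v where "u < n" "v < n" "u \<noteq> v" "adjB t u v"
  using biclique_edge_exists[of "bicliques x ! t" "graph x" n] bicl[OF assms] G(2) by blast

lemma n2: "2 \<le> n"
proof -
  obtain u v where "u < n" "v < n" "u \<noteq> v" using bicl_edge[OF pos(3)] by blast
  then show ?thesis by linarith
qed

sublocale machine "initial (spgc_encode x) 0" k d l n R B
proof
  show "initial (spgc_encode x) 0 (4 + p) \<le> 1" if "p < n * n" for p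
    unfolding spgc_encode_graph[OF that] using that set_adjacency_matrix[of _ n "graph x"]
    by (metis length_adjacency_matrix nth_mem)
qed (use pos n2 in \<open>simp_all add: initial_def spgc_encode_def\<close>)

lemma adjG: "u < n \<Longrightarrow> v < n \<Longrightarrow> adjG u v \<longleftrightarrow> adjE u v"
  unfolding mG_def by (simp add: spgc_encode_graph[OF index_less] nth_adjacency_matrix)

lemma adjA: "t < l \<Longrightarrow> u < n \<Longrightarrow> v < n \<Longrightarrow> adjA t u v \<longleftrightarrow> adjB t u v"
  unfolding mA_def using spgc_encode_biclique[OF _ index_less] by (simp add: nth_adjacency_matrix)

lemma mH_iff:
  assumes "u < n" "v < n"
  shows "mH (u * n + v) \<noteq> 0 \<longleftrightarrow> adjE u v \<and> (\<forall>t<l. \<not> adjB t u v)"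
proof -
  have "mH (u * n + v) \<noteq> 0 \<longleftrightarrow> adjG u v \<and> (\<forall>t<l. \<not> adjA t u v)" by (simp add: mH_def)
  then show ?thesis using adjG[OF assms] adjA[OF _ assms] by blast
qed

lemma adjE_sym: "adjE u v \<Longrightarrow> adjE v u"
  by (simp add: insert_commute)

lemma adjE_irrefl: "\<not> adjE u u"
  using G(1) by (auto simp: simple_graph_def)

lemma low_degree:
  assumes "U \<subseteq> {..<n}" "U \<noteq> {}"
  shows "\<exists>v\<in>U. card {w \<in> U. mH (v * n + w) \<noteq> 0} \<le> d"
proof -
  obtain v where v: "v \<in> U"
    "card {w \<in> U. {v, w} \<in> edges (graph x) - (\<Union>A \<in> set (bicliques x). edges A)} \<le> d"
    using degenerate_low_degree[OF degen G assms] by blast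
  have "{w \<in> U. mH (v * n + w) \<noteq> 0} = {w \<in> U. {v, w} \<in> edges (graph x) - (\<Union>A \<in> set (bicliques x). edges A)}"
  proof (intro Collect_cong conj_cong refl)
    fix w assume "w \<in> U"
    then have "mH (v * n + w) \<noteq> 0 \<longleftrightarrow> adjE v w \<and> (\<forall>t<l. \<not> adjB t v w)" using v assms by (intro mH_iff) auto
    also have "\<dots> \<longleftrightarrow> {v, w} \<in> edges (graph x) - (\<Union>A \<in> set (bicliques x). edges A)"
      by (simp add: all_set_conv_all_nth)
    finally show "mH (v * n + w) \<noteq> 0 \<longleftrightarrow> {v, w} \<in> edges (graph x) - (\<Union>A \<in> set (bicliques x). edges A)" .
  qed
  with v(2) have "card {w \<in> U. mH (v * n + w) \<noteq> 0} \<le> d" by (simp only:)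
  then show ?thesis using v(1) by blast
qed

lemma edge_exists:
  assumes "t < l"
  shows "\<exists>p<n * n. mA t p \<noteq> 0"
proof -
  obtain u v where uv: "u < n" "v < n" "adjB t u v" using bicl_edge[OF assms] by blast
  then have "mA t (u * n + v) \<noteq> 0" using adjA[OF assms] by simp
  then show ?thesis using index_less[OF uv(1,2)] by blast
qed

lemma initial_bounded_B: "bounded_by B (initial (spgc_encode x))"
proof (rule initial_bounded)
  show "2 \<le> B" by (rule le_trans[OF _ le_B[OF R_bounds(11)]]) simp
  fix y assume "y \<in> set (spgc_encode x)"
  then consider "y \<in> {k, d, l, n}" | G where "y \<in> set (adjacency_matrix n G)"
    by (auto simp: spgc_encode_def)
  then show "y \<le> B"
  proof cases
    case 1
    then show ?thesis using le_B R_bounds(2,3,4,13) by blast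
  next
    case 2
    then show ?thesis using set_adjacency_matrix[OF 2] one_le_B by linarith
  qed
qed

section \<open>Successful guesses and yes-instances\<close>

context
  fixes rk ep
  assumes rk: "ranking n rk" and ep: "\<And>t. t < l \<Longrightarrow> edge_at ep t"
begin

text \<open>After \<open>n\<close> rounds, \<open>n - n = 0\<close> vertices have rank 0.\<close>

lemma rk_nonzero: "v < n \<Longrightarrow> rk v \<noteq> 0"
  using rk by (auto simp: ranking_def)

lemma rk_inj: "inj_on rk {..<n}"
proof -
  have "{v. v < n \<and> rk v \<noteq> 0} = {..<n}" using rk_nonzero by auto
  then show ?thesis using rk by (simp add: ranking_def)
qed

lemma rk_degree: "v < n \<Longrightarrow> card {w. w < n \<and> mH (v * n + w) \<noteq> 0 \<and> rk v < rk w} \<le> d"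
proof -
  assume v: "v < n"
  have "{w. w < n \<and> mH (v * n + w) \<noteq> 0 \<and> rk v < rk w} =
      {w. w < n \<and> mH (v * n + w) \<noteq> 0 \<and> (rk w = 0 \<or> rk v < rk w)}"
    using rk_nonzero by blast
  then show ?thesis using rk v rk_nonzero[OF v] by (simp add: ranking_def)
qed

lemma ep_edge:
  assumes "t < l"
  shows "ep (2 * t) < n" "ep (2 * t + 1) < n" "adjB t (ep (2 * t)) (ep (2 * t + 1))"
proof -
  obtain p where p: "p < n * n" "mA t p \<noteq> 0" "ep (2 * t) = p div n" "ep (2 * t + 1) = p mod n"
    using ep[OF assms] by (auto simp: edge_at_def)
  show 1: "ep (2 * t) < n" "ep (2 * t + 1) < n" using p div_mod_index[OF p(1)] by simp_all
  have "adjA t (ep (2 * t)) (ep (2 * t + 1))" using p div_mod_index(3)[OF p(1)] by simp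
  then show "adjB t (ep (2 * t)) (ep (2 * t + 1))" using adjA[OF assms 1] by simp
qed

definition "guessedE e = (if direct then listed_coloring k (\<lambda>p. e div n ^ p mod n) (k * k)
  else decoded_coloring n d k l adjB ep e)"

lemma success_iff: "success rk ep e \<longleftrightarrow> grundy_check n adjE k (unblocked n adjE rk (guessedE e))"
  unfolding success_def
proof (rule grundy_check_unblocked_cong)
  fix v assume v: "v < n"
  have "adjA t (ep (2 * t + b)) v \<longleftrightarrow> adjB t (ep (2 * t + b)) v" if "t < l" "b < 2" for t b
    using adjA[OF that(1) _ v] ep_edge[OF that(1)] less_2_cases[OF that(2)] by auto
  then show "guessed_coloring ep e v = guessedE e v"
    using decoded_coloring_cong[of l adjA ep v adjB] by (simp add: guessed_coloring_def guessedE_def)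
qed (rule adjG)

lemma success_sound:
  assumes "success rk ep e"
  shows "spgc_yes x"
proof -
  have "witness n adjE k (unblocked n adjE rk (guessedE e))"
  proof (rule witness_unblocked[OF adjE_sym adjE_irrefl rk_inj])
    show "guessedE e v \<le> k" for v
      by (simp add: guessedE_def listed_coloring_le decoded_coloring_le)
    show "grundy_check n adjE k (unblocked n adjE rk (guessedE e))" using assms success_iff by simp
  qed
  then show ?thesis unfolding spgc_yes_def using witness_extend[OF G(2) refl G(1)] by blast
qed

lemma success_complete:
  assumes "spgc_yes x"
  shows "\<exists>e<guesses. success rk ep e"
proof -
  obtain k' c where "k \<le> k'" "partial_grundy_coloring (graph x) k' c"
    using assms unfolding spgc_yes_def by blast
  then obtain z where z: "witness n adjE k z" "\<And>i. i < k \<Longrightarrow> card {v. v < n \<and> z v = Suc i} \<le> k - i"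
    using witness_shrink[OF G(2) refl] by blast
  have n: "0 < n" using n2 by simp
  show ?thesis
  proof (cases direct)
    case True
    then show ?thesis
      using listed_coloring_complete[OF n pos(1) z] unfolding success_iff guessedE_def guesses_def by auto
  next
    case False
    have cover: "adjB t (ep (2 * t + b)) u \<or> adjB t (ep (2 * t + b)) v" if t: "t < l" "b < 2" "adjB t u v" for t b u v
      using biclique_edges(2,3)[of "bicliques x ! t", OF _ ep_edge(3)[OF t(1)] t(3)] bicl[OF t(1)] less_2_cases[OF t(2)]
      by auto
    obtain a0 a g S where *: "a0 < outer_range d k * n" "\<And>i. i < k \<Longrightarrow> a i < inner_range d k * outer_range d k"
      "\<And>y. g y < (2::nat)" "S \<subseteq> {..<k * inner_range d k}" "card S \<le> k * Suc k div 2"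
      "grundy_check n adjE k (unblocked n adjE rk (hashed_coloring n d k l adjB ep a0 a g S))"
    proof (rule hashed_coloring_complete[OF n pos(2,1) mH_iff, where ep = ep and rk = rk and z = z])
      show "adjE u v" if "t < l" "adjB t u v" for t u v
        using bicl[OF that(1)] that(2) by (auto simp: subgraph_def)
      show "adjB t u v" if "t < l" "adjB t (ep (2 * t)) u" "adjB t (ep (2 * t + 1)) v" for t u v
        using biclique_join[OF _ ep_edge(3)[OF that(1)] that(2,3)] bicl[OF that(1)] by blast
    qed (use cover rk_degree z in blast)+
    obtain e where e: "e < num_guesses n d k l"
      "\<And>v. decoded_coloring n d k l adjB ep e v = hashed_coloring n d k l adjB ep a0 a g S v"
    proof (rule decoded_coloring_onto[where a = a and g = g and l = l and A = adjB and ep = ep,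
          OF n pos(2,1) *(1) _ _ *(4,5)])
      show "\<And>i. i < k \<Longrightarrow> a i < inner_range d k * outer_range d k" by (rule *(2))
      show "\<And>y. g y < 2" by (rule *(3))
    qed blast
    have "decoded_coloring n d k l adjB ep e = hashed_coloring n d k l adjB ep a0 a g S" using e(2) by blast
    then have "success rk ep e" using *(6) False unfolding success_iff guessedE_def by simp
    then show ?thesis using e(1) False by (auto simp: guesses_def)
  qed
qed

end

text \<open>In the time bound, 20 combines \<open>Suc guesses \<le> 2 * guesses\<close> with the 10
  of \<open>bitlen_B\<close>, the power of 2 comes from \<open>Suc R \<le> 2 * R\<close>, and
  \<open>bitlen_B\<close> adds 2 to the exponent of \<open>R\<close>.\<close>

lemma grundy_prog_decides:
  "\<exists>t s. exec grundy_prog (initial (spgc_encode x)) t s \<and>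
    t \<le> guesses * (20 * cost 0 grundy_prog * 2 ^ size grundy_prog * R ^ (size grundy_prog + 2)) \<and>
    (accepting s \<longleftrightarrow> spgc_yes x)"
proof -
  let ?s = "initial (spgc_encode x)"
  have "?s vRank v = 0" "?s 1 0 = 0" for v by (simp_all add: initial_def)
  from grundy_prog_run[where s = ?s, OF initial_bounded_B refl this low_degree edge_exists]
  obtain t s' rk ep where run: "exec grundy_prog ?s t s'" "t \<le> Suc guesses * cost R grundy_prog * bitlen B"
    "ranking n rk" "\<forall>t<l. edge_at ep t" "s' 1 0 \<noteq> 0 \<longleftrightarrow> (\<exists>e<guesses. success rk ep e)"
    by blast
  note ep = run(4)[rule_format]
  have "accepting s' \<longleftrightarrow> spgc_yes x"
    unfolding accepting_def run(5)
    using success_sound[OF run(3) ep] success_complete[OF run(3) ep] by blast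
  moreover have "t \<le> guesses * (20 * cost 0 grundy_prog * 2 ^ size grundy_prog * R ^ (size grundy_prog + 2))"
  proof -
    have "1 \<le> R" by (rule le_trans[OF _ R_bounds(11)]) simp
    then have R: "Suc R \<le> 2 * R" by linarith
    have "cost R grundy_prog \<le> cost 0 grundy_prog * Suc R ^ size grundy_prog" by (rule cost_le_polynomial)
    also have "\<dots> \<le> cost 0 grundy_prog * (2 * R) ^ size grundy_prog"
      using R by (intro mult_le_mono2 power_mono) simp_all
    finally have c: "cost R grundy_prog \<le> cost 0 grundy_prog * (2 * R) ^ size grundy_prog" .
    have g: "Suc guesses \<le> 2 * guesses" using guesses_pos by simp
    have "t \<le> (2 * guesses) * (cost 0 grundy_prog * (2 * R) ^ size grundy_prog) * (10 * R * R)"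
      by (rule order_trans[OF run(2)]) (intro mult_le_mono g c bitlen_B)
    also have "\<dots> = guesses * (20 * cost 0 grundy_prog * 2 ^ size grundy_prog * R ^ (size grundy_prog + 2))"
    proof -
      have "2 * g * (c * (2 * r) ^ m) * (10 * r * r) = g * (20 * c * 2 ^ m * r ^ (m + 2))" for g c m r :: nat
        unfolding power_mult_distrib power_add power2_eq_square by simp
      then show ?thesis .
    qed
    finally show ?thesis .
  qed
  ultimately show ?thesis using run(1) by blast
qed

end

theorem theorem20:
  shows "\<exists>(P :: com) (a :: nat) (b :: nat).
    decides_in_time P spgc_encode spgc_valid spgc_yes
      (\<lambda>x. let k = real (colors x); d = real (degeneracy x);
               l = real (length (bicliques x)); n = real (num_vertices x)
           in 2 powr (real a * (k\<^sup>2 * d)) * 2 powr (l * k + k\<^sup>2 * log 2 k) * n ^ b)"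
proof -
  \<comment> \<open>The constants depend on the fixed program only, so \<open>a\<close> and
    \<open>b\<close> can be chosen before the instance.\<close>
  obtain a b where ab: "\<And>n d k l. 0 < k \<Longrightarrow> 0 < d \<Longrightarrow> 0 < l \<Longrightarrow> 2 \<le> n \<Longrightarrow>
    (if n ^ (2 * k) \<le> 2 ^ l then n ^ (k * k) else num_guesses n d k l) *
      ((20 * cost 0 grundy_prog * 2 ^ size grundy_prog) *
        (13 * d * (k * k * k * k) * (n * n) * l) ^ (size grundy_prog + 2))
    \<le> 2 ^ (a * (k * k * d)) * (2 ^ (l * k) * k ^ (k * k)) * n ^ b"
    using guesses_polynomial_le[of "20 * cost 0 grundy_prog * 2 ^ size grundy_prog" "size grundy_prog + 2"]
    by (metis (no_types, lifting))
  show ?thesis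
  proof (rule exI[of _ grundy_prog], rule exI[of _ a], rule exI[of _ b], unfold decides_in_time_def, intro allI impI, goal_cases)
    case (1 x)
    then interpret spgc_instance x by unfold_locales
    obtain t s where t: "exec grundy_prog (initial (spgc_encode x)) t s"
      "t \<le> guesses * (20 * cost 0 grundy_prog * 2 ^ size grundy_prog * R ^ (size grundy_prog + 2))"
      "accepting s \<longleftrightarrow> spgc_yes x"
      using grundy_prog_decides by blast
    note t(2)
    also have "guesses * (20 * cost 0 grundy_prog * 2 ^ size grundy_prog * R ^ (size grundy_prog + 2))
        \<le> 2 ^ (a * (k * k * d)) * (2 ^ (l * k) * k ^ (k * k)) * n ^ b"
      unfolding guesses_def direct_def by (rule ab) (use pos n2 in auto)
    finally have "real t \<le> real (2 ^ (a * (k * k * d)) * (2 ^ (l * k) * k ^ (k * k)) * n ^ b)"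
      by (simp only: of_nat_le_iff)
    also have "\<dots> = 2 powr real (a * (k * k * d)) * (2 powr real (l * k) * real k powr real (k * k)) * real n ^ b"
    proof -
      have powr: "2 powr real m = 2 ^ m" "real k powr real m = real k ^ m" for m
        using pos by (simp_all add: powr_realpow)
      show ?thesis unfolding powr by (simp only: of_nat_mult of_nat_power of_nat_numeral)
    qed
    \<comment> \<open>Positivity of \<open>k\<close> allows the logarithm here.\<close>
    also have "real k powr real (k * k) = 2 powr ((real k)\<^sup>2 * log 2 (real k))"
      using pos by (simp add: powr_def log_def power2_eq_square)
    finally have "real t \<le> 2 powr (real a * ((real k)\<^sup>2 * real d)) *
        2 powr (real l * real k + (real k)\<^sup>2 * log 2 (real k)) * real n ^ b"
      by (simp add: powr_add power2_eq_square)
    then show ?case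
      using t(1,3) unfolding Let_def by blast
  qed
qed

end
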